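(* For every integer $d\ge2$, the invariant $\Theta_d$ of oriented classical links is not topologically equivalent to the Homflypt polynomial $P$; that is, it is not the case that for all oriented links $L,L'$ one has $\Theta_d(L)=\Theta_d(L')$ if and only if $P(L)=P(L')$.
   Context: Two link invariants are topologically equivalent if they distinguish the same pairs of knots and links. The Yokonuma--Hecke algebra $Y_{d,n}(q)$ ($q\in\mathbb{C}\setminus\{0\}$) is the $\mathbb{C}$-algebra generated by $g_1,\dots,g_{n-1},t_1,\dots,t_n$ with relations: $g_ig_jg_i=g_jg_ig_j$ for $|i-j|=1$; $g_ig_j=g_jg_i$ for $|i-j|>1$; $t_it_j=t_jt_i$; $t_jg_i=g_it_{s_i(j)}$ where $s_i=(i,i+1)$; $t_j^d=1$; and $g_i^2=1+(q-q^{-1})e_ig_i$, where $e_i=\frac1d\sum_{s=0}^{d-1}t_i^st_{i+1}^{d-s}$. Set $Y_{d,0}(q)=\mathbb{C}$; there are natural inclusions $Y_{d,n}(q)\subset Y_{d,n+1}(q)$. Let $D=\mathbb{Z}/d\mathbb{Z}$, $E_D=1/d$. The trace $\mathrm{tr}_{d,D}:\bigcup_{n}Y_{d,n}(q)\to\mathbb{C}[z]$ is the unique linear map with, for $a,b\in Y_{d,n}(q)$: $\mathrm{tr}_{d,D}(ab)=\mathrm{tr}_{d,D}(ba)$; $\mathrm{tr}_{d,D}(1)=1$; $\mathrm{tr}_{d,D}(ag_n)=z\,\mathrm{tr}_{d,D}(a)$; $\mathrm{tr}_{d,D}(at_{n+1}^k)=0$ for $1\le k\le d-1$. Set $\lambda_D=\frac{z-(q-q^{-1})E_D}{z}$,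 $\Lambda_D=\frac{1}{z\sqrt{\lambda_D}}$. For a braid $\alpha\in B_n$ with closure $\widehat\alpha$ and exponent sum $\epsilon(\alpha)$, $$\Theta_d(\widehat\alpha)=\Lambda_D^{n-1}(\sqrt{\lambda_D})^{\epsilon(\alpha)}\,\mathrm{tr}_{d,D}(\alpha),$$ where $\mathrm{tr}_{d,D}(\alpha)$ is the trace of the image of $\alpha$ under $\sigma_i\mapsto g_i$; this is an isotopy invariant of oriented links. Both $\Theta_d$ and $P=\Theta_1$ are $2$-variable invariants: equality of values means equality as functions of the two variables $(q,z)$, or equivalently of $(q,\lambda_D)$ via $z=\frac{(q-q^{-1})E_D}{1-\lambda_D}$. *)

theory Defs
  imports
    Complex_Main
    "HOL-Library.Poly_Mapping"
    "HOL-Library.FuncSet"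
    "HOL-Combinatorics.Transposition"
    "HOL-Computational_Algebra.Polynomial"
    "HOL-Algebra.QuotRing"
begin

section \<open>Braids and oriented links\<close>

text \<open>
  The letter \<open>(i, True)\<close> stands for the braid generator sigma_i and \<open>(i, False)\<close> for its
  inverse; indices start at 1.
\<close>

type_synonym braid_word = "(nat \<times> bool) list"

definition braid_words :: "nat \<Rightarrow> braid_word set" where
  "braid_words n = lists ({1..<n} \<times> UNIV)"

text \<open>Equality of the elements of the Artin braid group B_n represented by two words.\<close>

inductive braid_eq :: "nat \<Rightarrow> braid_word \<Rightarrow> braid_word \<Rightarrow> bool" for n where
  refl: "w \<in> braid_words n \<Longrightarrow> braid_eq n w w"
| sym: "braid_eq n u v \<Longrightarrow> braid_eq n v u"
| trans: "braid_eq n u v \<Longrightarrow> braid_eq n v w \<Longrightarrow> braid_eq n u w"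
| append: "braid_eq n u u' \<Longrightarrow> braid_eq n v v' \<Longrightarrow> braid_eq n (u @ v) (u' @ v')"
| inverse: "1 \<le> i \<Longrightarrow> i < n \<Longrightarrow> braid_eq n [(i, e), (i, \<not> e)] []"
| commute: "1 \<le> i \<Longrightarrow> i + 1 < j \<Longrightarrow> j < n \<Longrightarrow>
    braid_eq n [(i, True), (j, True)] [(j, True), (i, True)]"
| braid: "1 \<le> i \<Longrightarrow> i + 1 < n \<Longrightarrow>
    braid_eq n [(i, True), (i + 1, True), (i, True)] [(i + 1, True), (i, True), (i + 1, True)]"

text \<open>
  Markov equivalence of braids with a varying number of strands: the pair \<open>(n, w)\<close> is the
  element of B_n represented by \<open>w\<close>.  By the theorems of Alexander and Markov, taking closures
  induces a bijection from the classes of this relation onto the isotopy classes of (nonempty)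
  oriented classical links.
\<close>

inductive markov_eq :: "nat \<times> braid_word \<Rightarrow> nat \<times> braid_word \<Rightarrow> bool" where
  braid: "1 \<le> n \<Longrightarrow> braid_eq n u v \<Longrightarrow> markov_eq (n, u) (n, v)"
| sym: "markov_eq a b \<Longrightarrow> markov_eq b a"
| trans: "markov_eq a b \<Longrightarrow> markov_eq b c \<Longrightarrow> markov_eq a c"
| conjugation: "1 \<le> n \<Longrightarrow> u \<in> braid_words n \<Longrightarrow> v \<in> braid_words n \<Longrightarrow>
    markov_eq (n, u @ v) (n, v @ u)"
| stabilization: "1 \<le> n \<Longrightarrow> u \<in> braid_words n \<Longrightarrow> markov_eq (n, u) (n + 1, u @ [(n, e)])"

quotient_type oriented_link = "nat \<times> braid_word" / partial: markov_eq
proof (rule part_equivpI)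
  show "\<exists>x. markov_eq x x"
    by (rule exI[of _ "(1, [])"]) (auto intro!: markov_eq.braid braid_eq.refl simp: braid_words_def)
  show "symp markov_eq"
    by (auto intro: sympI markov_eq.sym)
  show "transp markov_eq"
    by (auto intro: transpI markov_eq.trans)
qed

definition braid_closure :: "nat \<Rightarrow> braid_word \<Rightarrow> oriented_link" where
  "braid_closure n w = abs_oriented_link (n, w)"

definition exponent_sum :: "braid_word \<Rightarrow> int" where
  "exponent_sum w = (\<Sum>(i, e)\<leftarrow>w. if e then 1 else - 1)"

definition topologically_equivalent ::
  "(oriented_link \<Rightarrow> 'a) \<Rightarrow> (oriented_link \<Rightarrow> 'b) \<Rightarrow> bool" where
  "topologically_equivalent I J \<longleftrightarrow> (\<forall>L L'. I L = I L' \<longleftrightarrow> J L = J L')"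


section \<open>The Yokonuma-Hecke algebras\<close>

text \<open>Lists form the free monoid, so that \<open>gen list \<Rightarrow>\<^sub>0 complex\<close> is the free complex algebra.\<close>

instantiation list :: (type) monoid_add
begin

definition zero_list :: "'a list" where
  "zero_list = []"

definition plus_list :: "'a list \<Rightarrow> 'a list \<Rightarrow> 'a list" where
  "plus_list = append"

instance
  by standard (simp_all add: zero_list_def plus_list_def)

end

datatype gen = Gen_G nat | Gen_T nat

type_synonym free_algebra = "gen list \<Rightarrow>\<^sub>0 complex"

definition scalar :: "complex \<Rightarrow> free_algebra" where
  "scalar c = Poly_Mapping.single 0 c"

definition gen_g :: "nat \<Rightarrow> free_algebra" where
  "gen_g i = Poly_Mapping.single [Gen_G i] 1"

definition gen_t :: "nat \<Rightarrow> free_algebra" where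
  "gen_t j = Poly_Mapping.single [Gen_T j] 1"

definition idem_e :: "nat \<Rightarrow> nat \<Rightarrow> free_algebra" where
  "idem_e d i = scalar (1 / of_nat d) * (\<Sum>s = 0..d - 1. gen_t i ^ s * gen_t (i + 1) ^ (d - s))"

definition gens :: "nat \<Rightarrow> gen set" where
  "gens n = Gen_G ` {1..<n} \<union> Gen_T ` {1..n}"

definition free_alg :: "nat \<Rightarrow> free_algebra ring" where
  "free_alg n =
    \<lparr>carrier = {a. Poly_Mapping.keys a \<subseteq> lists (gens n)}, mult = (*), one = 1, zero = 0, add = (+)\<rparr>"

definition yh_relators :: "nat \<Rightarrow> complex \<Rightarrow> nat \<Rightarrow> free_algebra set" where
  "yh_relators d q n =
     {gen_g i * gen_g j * gen_g i - gen_g j * gen_g i * gen_g j | i j.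
        i \<in> {1..<n} \<and> j \<in> {1..<n} \<and> \<bar>int i - int j\<bar> = 1} \<union>
     {gen_g i * gen_g j - gen_g j * gen_g i | i j.
        i \<in> {1..<n} \<and> j \<in> {1..<n} \<and> \<bar>int i - int j\<bar> > 1} \<union>
     {gen_t i * gen_t j - gen_t j * gen_t i | i j. i \<in> {1..n} \<and> j \<in> {1..n}} \<union>
     {gen_t j * gen_g i - gen_g i * gen_t (Transposition.transpose i (i + 1) j) | i j. i \<in> {1..<n} \<and> j \<in> {1..n}} \<union>
     {gen_t j ^ d - 1 | j. j \<in> {1..n}} \<union>
     {gen_g i ^ 2 - (1 + scalar (q - inverse q) * idem_e d i * gen_g i) | i. i \<in> {1..<n}}"

text \<open>For \<open>n = 0\<close> there are no generators and no relators, so \<open>YH d q 0\<close> is a copy of the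
  complex numbers.\<close>

definition yh_ideal :: "nat \<Rightarrow> complex \<Rightarrow> nat \<Rightarrow> free_algebra set" where
  "yh_ideal d q n = genideal (free_alg n) (yh_relators d q n)"

definition YH :: "nat \<Rightarrow> complex \<Rightarrow> nat \<Rightarrow> free_algebra set ring" where
  "YH d q n = free_alg n Quot yh_ideal d q n"

text \<open>The residue class of a noncommutative polynomial.\<close>

definition yh_class :: "nat \<Rightarrow> complex \<Rightarrow> nat \<Rightarrow> free_algebra \<Rightarrow> free_algebra set" where
  "yh_class d q n a = yh_ideal d q n +>\<^bsub>free_alg n\<^esub> a"


section \<open>The trace and the invariants\<close>

text \<open>
  A linear map on the union of the algebras \<open>YH d q n\<close> is a family of linear maps \<open>tr n\<close>
  compatible with the natural inclusions; the inclusion of \<open>YH d q n\<close> into \<open>YH d q (n + 1)\<close>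
  sends \<open>yh_class d q n a\<close> to \<open>yh_class d q (n + 1) a\<close>.  The values are polynomials in the
  variable \<open>z = [:0, 1:]\<close>.  Extensionality only serves to make the family unique as a HOL function.
\<close>

definition is_yh_trace ::
  "nat \<Rightarrow> complex \<Rightarrow> (nat \<Rightarrow> free_algebra set \<Rightarrow> complex poly) \<Rightarrow> bool" where
  "is_yh_trace d q tr \<longleftrightarrow>
     (\<forall>n. tr n \<in> extensional (carrier (YH d q n))) \<and>
     (\<forall>n. \<forall>x \<in> carrier (YH d q n). \<forall>y \<in> carrier (YH d q n).
        tr n (x \<oplus>\<^bsub>YH d q n\<^esub> y) = tr n x + tr n y) \<and>
     (\<forall>n c. \<forall>x \<in> carrier (YH d q n).
        tr n (yh_class d q n (scalar c) \<otimes>\<^bsub>YH d q n\<^esub> x) = smult c (tr n x)) \<and>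
     (\<forall>n. \<forall>a \<in> carrier (free_alg n).
        tr (n + 1) (yh_class d q (n + 1) a) = tr n (yh_class d q n a)) \<and>
     (\<forall>n. \<forall>x \<in> carrier (YH d q n). \<forall>y \<in> carrier (YH d q n).
        tr n (x \<otimes>\<^bsub>YH d q n\<^esub> y) = tr n (y \<otimes>\<^bsub>YH d q n\<^esub> x)) \<and>
     (\<forall>n. tr n \<one>\<^bsub>YH d q n\<^esub> = 1) \<and>
     (\<forall>n \<ge> 1. \<forall>a \<in> carrier (free_alg n).
        tr (n + 1) (yh_class d q (n + 1) (a * gen_g n)) = [:0, 1:] * tr n (yh_class d q n a)) \<and>
     (\<forall>n. \<forall>a \<in> carrier (free_alg n). \<forall>k. 1 \<le> k \<and> k \<le> d - 1 \<longrightarrow>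
        tr (n + 1) (yh_class d q (n + 1) (a * gen_t (n + 1) ^ k)) = 0)"

definition yh_trace :: "nat \<Rightarrow> complex \<Rightarrow> nat \<Rightarrow> free_algebra set \<Rightarrow> complex poly" where
  "yh_trace d q = (THE tr. is_yh_trace d q tr)"

fun letter_image :: "nat \<Rightarrow> complex \<Rightarrow> nat \<Rightarrow> nat \<times> bool \<Rightarrow> free_algebra set" where
  "letter_image d q n (i, True) = yh_class d q n (gen_g i)"
| "letter_image d q n (i, False) = inv\<^bsub>YH d q n\<^esub> (yh_class d q n (gen_g i))"

definition braid_image :: "nat \<Rightarrow> complex \<Rightarrow> nat \<Rightarrow> braid_word \<Rightarrow> free_algebra set" where
  "braid_image d q n w =
    foldr (\<lambda>l x. letter_image d q n l \<otimes>\<^bsub>YH d q n\<^esub> x) w \<one>\<^bsub>YH d q n\<^esub>"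

text \<open>The quantities E_D and lambda_D for D the full group of integers modulo \<open>d\<close>.\<close>

definition E_D :: "nat \<Rightarrow> complex" where
  "E_D d = 1 / of_nat d"

definition lambda_D :: "nat \<Rightarrow> complex \<Rightarrow> complex \<Rightarrow> complex" where
  "lambda_D d q z = (z - (q - inverse q) * E_D d) / z"

definition Lambda_D :: "nat \<Rightarrow> complex \<Rightarrow> complex \<Rightarrow> complex" where
  "Lambda_D d q z = 1 / (z * csqrt (lambda_D d q z))"

text \<open>
  The domain consists of the points at which the defining expression makes sense.  Outside of it the
  functions below are constantly \<open>undefined\<close>, so equality in HOL is equality on the domain.
\<close>

definition Theta_domain :: "nat \<Rightarrow> (complex \<times> complex) set" where
  "Theta_domain d = {(q, z). q \<noteq> 0 \<and> z \<noteq> 0 \<and> lambda_D d q z \<noteq> 0}"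

definition Theta_braid :: "nat \<Rightarrow> nat \<Rightarrow> braid_word \<Rightarrow> complex \<times> complex \<Rightarrow> complex" where
  "Theta_braid d n w = restrict
     (\<lambda>(q, z). Lambda_D d q z ^ (n - 1) * csqrt (lambda_D d q z) powi exponent_sum w *
        poly (yh_trace d q n (braid_image d q n w)) z)
     (Theta_domain d)"

text \<open>The choice of the braid is immaterial, because \<open>Theta_braid\<close> is invariant under Markov
  equivalence.\<close>

definition Theta :: "nat \<Rightarrow> oriented_link \<Rightarrow> complex \<times> complex \<Rightarrow> complex" where
  "Theta d L =
    (let (n, w) = (SOME (n, w). 1 \<le> n \<and> w \<in> braid_words n \<and> braid_closure n w = L)
     in Theta_braid d n w)"

definition homflypt :: "oriented_link \<Rightarrow> complex \<times> complex \<Rightarrow> complex" where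
  "homflypt = Theta 1"

end

theory Submission
  imports Defs
begin

text \<open>
  Two braids on three strands separate the invariants: \<open>sigma_1^6 Delta^(-2)\<close>, where \<open>Delta^2\<close> is the
  full twist, and its mirror image.  Both are pure and have exponent sum 0.

  The Homflypt polynomial does not distinguish their closures.  The reason is that the trace on the
  Hecke algebra of three strands is a combination of the characters of three irreducible
  representations.  The two of dimension one see only the exponent sum.  In the third, of dimension
  two, the full twist acts trivially and \<open>sigma_1^6\<close> has the eigenvalues \<open>q^6\<close> and \<open>q^(-6)\<close>, which the
  mirror image interchanges.  For \<open>d \<ge> 2\<close>, however, \<open>Theta d\<close> is a sum over colourings of the
  components by \<open>d\<close> colours, in which crossings between different colours contribute only through
  linking numbers.  So it depends on the linking numbers of the single pairs of components, and these
  are 2, -1, -1 for one link and -2, 1, 1 for the other.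

  The proof below does not use this analysis but computes both traces from the relations.  They
  differ by \<open>(q - 1/q)^3 (1 - 1/d) ((q - 1/q)/d - 2 z)\<close> (lemma \<open>trace_poly_mirror_pair\<close>).  The
  computation is short because the mirror image amounts to replacing the generators by their
  inverses, which satisfy relations of the same form (locale \<open>quadratic_braid_generators\<close>).

  Most of the work is to show that the trace exists and is unique, and hence that \<open>Theta d\<close> is
  an invariant of links.  The defining relations reduce every element on \<open>n + 1\<close> strands to a sum of
  elements for which the axioms of the trace lower the number of strands (\<open>q_family_spanned\<close>).  So
  the trace of an element is given by a polynomial in \<open>q - 1/q\<close> and \<open>z\<close> that does not depend on any
  choice of the trace (\<open>q_family_determined\<close>); in particular there is at most one trace.  For existence
  it remains to see that these polynomials are consistent with the relations.  The R-matrix of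
  quantum \<open>gl_N\<close>, extended by \<open>d\<close> colours, yields honest traces for every real \<open>q > 1\<close> and
  infinitely many values of \<open>z\<close>, one for each \<open>N\<close> (\<open>markov_functional_qtrace\<close>).  A polynomial identity
  that holds at all these points holds identically (\<open>universal_poly_unique\<close>), so all axioms carry over
  to arbitrary \<open>q\<close> and \<open>z\<close>, roots of unity included (\<open>markov_functional_trace_poly\<close>).
\<close>

section \<open>Noncommutative polynomials\<close>

text \<open>
  The span of the words over an alphabet.  For the alphabet \<open>gens n\<close> this is the carrier of
  \<open>free_alg n\<close>; writing it as a set inside one ring type makes the inclusions between different
  numbers of strands literal inclusions, so that one functional can serve all strand numbers.
\<close>

definition subalg :: "gen set \<Rightarrow> free_algebra set" where
  "subalg S = {a. Poly_Mapping.keys a \<subseteq> lists S}"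

lemma carrier_free_alg: "carrier (free_alg n) = subalg (gens n)"
  by (simp add: free_alg_def subalg_def)

lemma single_append: "Poly_Mapping.single (u @ v) (c * c') = (Poly_Mapping.single u c :: free_algebra) * Poly_Mapping.single v c'"
  by (simp add: mult_single plus_list_def)

lemma scalar_eq_single: "scalar c = Poly_Mapping.single [] c"
  by (simp add: scalar_def zero_list_def)

lemma scalar_1 [simp]: "scalar 1 = 1" and scalar_0 [simp]: "scalar 0 = 0"
  by (simp_all add: scalar_def)

lemma scalar_add: "scalar (a + b) = scalar a + scalar b"
  and scalar_mult: "scalar (a * b) = scalar a * scalar b"
  and scalar_uminus: "scalar (- a) = - scalar a"
  by (simp_all add: scalar_def single_add mult_single single_uminus)

lemma poly_mapping_sum_single: "a = (\<Sum>w\<in>Poly_Mapping.keys a. Poly_Mapping.single w (Poly_Mapping.lookup a w))"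
proof (rule poly_mapping_eqI)
  fix k
  show "Poly_Mapping.lookup a k =
    Poly_Mapping.lookup (\<Sum>w\<in>Poly_Mapping.keys a. Poly_Mapping.single w (Poly_Mapping.lookup a w)) k"
    by (auto simp: lookup_sum lookup_single when_def in_keys_iff)
qed

lemma subalg_add [intro]: "a \<in> subalg S \<Longrightarrow> b \<in> subalg S \<Longrightarrow> a + b \<in> subalg S"
  using keys_add[of a b] by (auto simp: subalg_def)

lemma subalg_uminus [intro]: "a \<in> subalg S \<Longrightarrow> - a \<in> subalg S"
  by (auto simp: subalg_def in_keys_iff)

lemma subalg_diff [intro]: "a \<in> subalg S \<Longrightarrow> b \<in> subalg S \<Longrightarrow> a - b \<in> subalg S"
  using subalg_add[of a S "- b"] by (auto dest: subalg_uminus)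

lemma subalg_mult [intro]: "a \<in> subalg S \<Longrightarrow> b \<in> subalg S \<Longrightarrow> a * b \<in> subalg S"
  using keys_mult[of a b] by (fastforce simp: subalg_def plus_list_def)

lemma subalg_scalar [simp, intro]: "scalar c \<in> subalg S"
  by (auto simp: subalg_def scalar_eq_single)

lemma subalg_0 [simp, intro]: "0 \<in> subalg S"
  using subalg_scalar[of 0 S] by simp

lemma subalg_1 [simp, intro]: "1 \<in> subalg S"
  using subalg_scalar[of 1 S] by simp

lemma subalg_sum [intro]: "(\<And>i. i \<in> I \<Longrightarrow> f i \<in> subalg S) \<Longrightarrow> sum f I \<in> subalg S"
  by (induction I rule: infinite_finite_induct) auto

lemma subalg_power [intro]: "a \<in> subalg S \<Longrightarrow> a ^ k \<in> subalg S"
  by (induction k) auto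

lemma subalg_mono: "S \<subseteq> S' \<Longrightarrow> subalg S \<subseteq> subalg S'"
  by (auto simp: subalg_def)

lemma subalg_letter: "x \<in> S \<Longrightarrow> Poly_Mapping.single [x] 1 \<in> subalg S"
  by (auto simp: subalg_def)

text \<open>
  Structural induction over noncommutative polynomials.  The multiplication case is what makes
  statements such as "commutes with every generator" pass to all elements.
\<close>

lemma subalg_induct [consumes 1, case_names scalar letter add mult]:
  assumes "a \<in> subalg S"
    and "\<And>c. P (scalar c)"
    and "\<And>x. x \<in> S \<Longrightarrow> P (Poly_Mapping.single [x] 1)"
    and "\<And>a b. a \<in> subalg S \<Longrightarrow> b \<in> subalg S \<Longrightarrow> P a \<Longrightarrow> P b \<Longrightarrow> P (a + b)"
    and "\<And>a b. a \<in> subalg S \<Longrightarrow> b \<in> subalg S \<Longrightarrow> P a \<Longrightarrow> P b \<Longrightarrow> P (a * b)"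
  shows "P a"
proof -
  have word: "P (Poly_Mapping.single w c) \<and> Poly_Mapping.single w c \<in> subalg S" if "w \<in> lists S" for w c
    using that
  proof (induction w)
    case Nil
    then show ?case using assms(2)[of c] subalg_scalar[of c S] by (simp add: scalar_eq_single)
  next
    case (Cons x w)
    then show ?case
      using assms(5)[of "Poly_Mapping.single [x] 1" "Poly_Mapping.single w c"]
        assms(3)[of x] subalg_letter[of x S] single_append[of "[x]" w 1 c]
        subalg_mult[of "Poly_Mapping.single [x] 1" S "Poly_Mapping.single w c"] by auto
  qed
  have "P (\<Sum>w\<in>W. Poly_Mapping.single w (Poly_Mapping.lookup a w)) \<and>
        (\<Sum>w\<in>W. Poly_Mapping.single w (Poly_Mapping.lookup a w)) \<in> subalg S"
    if "finite W" "W \<subseteq> lists S" for W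
    using that
  proof (induction W rule: finite_induct)
    case empty
    then show ?case using assms(2)[of 0] by simp
  next
    case (insert w W)
    then show ?case using word[of w] assms(4) by auto
  qed
  then show ?thesis
    using poly_mapping_sum_single[of a] assms(1) by (metis (no_types, lifting) finite_keys mem_Collect_eq subalg_def)
qed

lemma scalar_central: "scalar c * a = a * (scalar c :: free_algebra)"
proof -
  have "a \<in> subalg UNIV" by (simp add: subalg_def)
  then show ?thesis
  proof (induction rule: subalg_induct)
    case (mult a b)
    then show ?case by (metis mult.assoc)
  qed (simp_all add: scalar_eq_single mult_single plus_list_def algebra_simps)
qed

lemma gens_mono: "m \<le> n \<Longrightarrow> gens m \<subseteq> gens n"
  by (auto simp: gens_def)

definition falg :: "free_algebra set" where
  "falg = subalg (\<Union>n. gens n)"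

lemma subalg_gens_falg: "a \<in> subalg (gens n) \<Longrightarrow> a \<in> falg"
  unfolding falg_def using subalg_mono[of "gens n" "\<Union>n. gens n"] by auto

lemma falg_ex: "a \<in> falg \<Longrightarrow> \<exists>n. a \<in> subalg (gens n)"
  unfolding falg_def
proof (induction rule: subalg_induct)
  case (add a b)
  then obtain m n where "a \<in> subalg (gens m)" "b \<in> subalg (gens n)" by auto
  then have "a \<in> subalg (gens (max m n))" "b \<in> subalg (gens (max m n))"
    using subalg_mono[OF gens_mono[of m "max m n"]] subalg_mono[OF gens_mono[of n "max m n"]] by auto
  then show ?case by blast
next
  case (mult a b)
  then obtain m n where "a \<in> subalg (gens m)" "b \<in> subalg (gens n)" by auto
  then have "a \<in> subalg (gens (max m n))" "b \<in> subalg (gens (max m n))"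
    using subalg_mono[OF gens_mono[of m "max m n"]] subalg_mono[OF gens_mono[of n "max m n"]] by auto
  then show ?case by blast
qed (auto intro: subalg_letter)

lemma falg_closed [simp, intro]:
  "a \<in> falg \<Longrightarrow> b \<in> falg \<Longrightarrow> a + b \<in> falg"
  "a \<in> falg \<Longrightarrow> b \<in> falg \<Longrightarrow> a - b \<in> falg"
  "a \<in> falg \<Longrightarrow> b \<in> falg \<Longrightarrow> a * b \<in> falg"
  "a \<in> falg \<Longrightarrow> - a \<in> falg"
  "a \<in> falg \<Longrightarrow> a ^ k \<in> falg"
  "0 \<in> falg" "1 \<in> falg" "scalar c \<in> falg"
  by (auto simp: falg_def)

lemma falg_sum [simp, intro]: "(\<And>i. i \<in> I \<Longrightarrow> f i \<in> falg) \<Longrightarrow> sum f I \<in> falg"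
  unfolding falg_def by (rule subalg_sum)

lemma subalg_gen_g [intro]: "1 \<le> i \<Longrightarrow> i < n \<Longrightarrow> gen_g i \<in> subalg (gens n)"
  and subalg_gen_t [intro]: "1 \<le> j \<Longrightarrow> j \<le> n \<Longrightarrow> gen_t j \<in> subalg (gens n)"
  unfolding gen_g_def gen_t_def by (auto intro!: subalg_letter simp: gens_def)

lemma subalg_idem_e [intro]: "1 \<le> i \<Longrightarrow> i < n \<Longrightarrow> idem_e d i \<in> subalg (gens n)"
  unfolding idem_e_def by (intro subalg_mult subalg_scalar subalg_sum subalg_power subalg_gen_t) auto

lemma falg_gens [simp, intro]:
  "1 \<le> i \<Longrightarrow> gen_g i \<in> falg" "1 \<le> i \<Longrightarrow> gen_t i \<in> falg" "1 \<le> i \<Longrightarrow> idem_e d i \<in> falg"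
  by (rule subalg_gens_falg[of _ "Suc i"]; auto)+

lemma yh_relators_subalg: "yh_relators d q n \<subseteq> subalg (gens n)"
proof -
  have *: "Transposition.transpose i (Suc i) j \<in> {1..n}" if "i \<in> {1..<n}" "j \<in> {1..n}" for i j
    using that by (auto simp: Transposition.transpose_def)
  show ?thesis
    unfolding yh_relators_def power2_eq_square
    using * by (auto intro!: subalg_diff subalg_mult subalg_add subalg_power subalg_gen_g subalg_gen_t subalg_idem_e)
qed

section \<open>Markov functionals\<close>

text \<open>
  The trace evaluated at a fixed value of its variable, seen as a complex valued functional on the
  free algebra that vanishes on the two-sided ideal of the relators.  Traces on the quotient algebras
  and traces of explicit matrices both produce such functionals, and statements about traces are
  proved for all of them at once.
\<close>

locale markov_functional =
  fixes d :: nat and q z :: complex and F :: "free_algebra \<Rightarrow> complex"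
  assumes d_pos: "1 \<le> d" and q_nz: "q \<noteq> 0"
    and F_add: "a \<in> falg \<Longrightarrow> b \<in> falg \<Longrightarrow> F (a + b) = F a + F b"
    and F_scalar: "a \<in> falg \<Longrightarrow> F (scalar c * a) = c * F a"
    and F_relator: "r \<in> yh_relators d q n \<Longrightarrow> a \<in> falg \<Longrightarrow> b \<in> falg \<Longrightarrow> F (a * r * b) = 0"
    and F_cyclic: "a \<in> falg \<Longrightarrow> b \<in> falg \<Longrightarrow> F (a * b) = F (b * a)"
    and F_one: "F 1 = 1"
    and F_g: "1 \<le> n \<Longrightarrow> a \<in> subalg (gens n) \<Longrightarrow> F (a * gen_g n) = z * F a"
    and F_t: "a \<in> subalg (gens n) \<Longrightarrow> 1 \<le> k \<Longrightarrow> k \<le> d - 1 \<Longrightarrow> F (a * gen_t (n + 1) ^ k) = 0"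
begin

abbreviation h :: complex where "h \<equiv> q - inverse q"

lemma F_0 [simp]: "F 0 = 0"
  using F_scalar[of 0 0] by simp

lemma F_uminus: "a \<in> falg \<Longrightarrow> F (- a) = - F a"
  using F_scalar[of a "-1"] by (simp add: scalar_uminus)

lemma F_diff: "a \<in> falg \<Longrightarrow> b \<in> falg \<Longrightarrow> F (a - b) = F a - F b"
  using F_add[of a "- b"] F_uminus[of b] by simp

lemma F_sum: "(\<And>i. i \<in> I \<Longrightarrow> f i \<in> falg) \<Longrightarrow> F (sum f I) = (\<Sum>i\<in>I. F (f i))"
  by (induction I rule: infinite_finite_induct) (auto simp: F_add)

text \<open>
  Congruence modulo the largest two-sided ideal on which \<open>F\<close> vanishes.  It contains all relators,
  so that the defining relations of the Yokonuma-Hecke algebras become rewriting rules, without any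
  quotient being formed.
\<close>

definition eqv :: "free_algebra \<Rightarrow> free_algebra \<Rightarrow> bool" (infix \<open>\<approx>\<close> 50) where
  "x \<approx> y \<longleftrightarrow> x \<in> falg \<and> y \<in> falg \<and> (\<forall>u\<in>falg. \<forall>v\<in>falg. F (u * x * v) = F (u * y * v))"

lemma eqv_falg: "x \<approx> y \<Longrightarrow> x \<in> falg \<and> y \<in> falg"
  by (simp add: eqv_def)

lemma eqv_refl [simp, intro]: "x \<in> falg \<Longrightarrow> x \<approx> x"
  by (simp add: eqv_def)

lemma eqv_sym: "x \<approx> y \<Longrightarrow> y \<approx> x"
  by (simp add: eqv_def)

lemma eqv_trans [trans]: "x \<approx> y \<Longrightarrow> y \<approx> w \<Longrightarrow> x \<approx> w"
  by (simp add: eqv_def)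

lemma eqv_F: "x \<approx> y \<Longrightarrow> F x = F y"
  unfolding eqv_def by (metis falg_closed(7) mult_1 mult_1_right)

lemma eqv_add: "x \<approx> y \<Longrightarrow> x' \<approx> y' \<Longrightarrow> x + x' \<approx> y + y'"
  by (simp add: eqv_def distrib_left distrib_right F_add)

lemma eqv_diff: "x \<approx> y \<Longrightarrow> x' \<approx> y' \<Longrightarrow> x - x' \<approx> y - y'"
  by (simp add: eqv_def left_diff_distrib right_diff_distrib F_diff)

lemma eqv_mult: "x \<approx> y \<Longrightarrow> x' \<approx> y' \<Longrightarrow> x * x' \<approx> y * y'"
proof -
  assume a: "x \<approx> y" "x' \<approx> y'"
  show "x * x' \<approx> y * y'"
    unfolding eqv_def
  proof (intro conjI ballI)
    fix u v assume u: "u \<in> falg" and v: "v \<in> falg"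
    have "F (u * x * (x' * v)) = F (u * y * (x' * v))"
      using a u v by (simp add: eqv_def)
    also have "\<dots> = F ((u * y) * x' * v)" by (simp add: mult.assoc)
    also have "\<dots> = F ((u * y) * y' * v)"
      using a u v unfolding eqv_def by blast
    finally show "F (u * (x * x') * v) = F (u * (y * y') * v)" by (simp add: mult.assoc)
  qed (use a eqv_falg in auto)
qed

lemma eqv_multL: "x \<approx> y \<Longrightarrow> w \<in> falg \<Longrightarrow> w * x \<approx> w * y"
  and eqv_multR: "x \<approx> y \<Longrightarrow> w \<in> falg \<Longrightarrow> x * w \<approx> y * w"
  by (auto intro: eqv_mult)

lemma eqv_power: "x \<approx> y \<Longrightarrow> x ^ k \<approx> y ^ k"
  by (induction k) (auto intro: eqv_mult)

lemma eqv_sum: "(\<And>i. i \<in> I \<Longrightarrow> f i \<approx> f' i) \<Longrightarrow> sum f I \<approx> sum f' I"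
  by (induction I rule: infinite_finite_induct) (auto intro: eqv_add)

lemma eqv_relator:
  assumes "x - y \<in> yh_relators d q n" "x \<in> falg" "y \<in> falg"
  shows "x \<approx> y"
  unfolding eqv_def
proof (intro conjI ballI assms)
  fix u v assume "u \<in> falg" "v \<in> falg"
  moreover from this have "F (u * (x - y) * v) = 0" using assms(1) F_relator by blast
  ultimately show "F (u * x * v) = F (u * y * v)"
    using assms by (simp add: algebra_simps F_diff)
qed

lemma eqv_braid:
  assumes "1 \<le> i" "1 \<le> j" "\<bar>int i - int j\<bar> = 1"
  shows "gen_g i * gen_g j * gen_g i \<approx> gen_g j * gen_g i * gen_g j"
proof (rule eqv_relator[where n = "max i j + 1"])
  show "gen_g i * gen_g j * gen_g i - gen_g j * gen_g i * gen_g j \<in> yh_relators d q (max i j + 1)"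
    unfolding yh_relators_def
    apply (rule UnI1, rule UnI1, rule UnI1, rule UnI1, rule UnI1) using assms by fastforce
qed (use assms in auto)

lemma eqv_gg:
  assumes "1 \<le> i" "1 \<le> j" "\<bar>int i - int j\<bar> > 1"
  shows "gen_g i * gen_g j \<approx> gen_g j * gen_g i"
proof (rule eqv_relator[where n = "max i j + 1"])
  show "gen_g i * gen_g j - gen_g j * gen_g i \<in> yh_relators d q (max i j + 1)"
    unfolding yh_relators_def
    apply (rule UnI1, rule UnI1, rule UnI1, rule UnI1, rule UnI2) using assms by fastforce
qed (use assms in auto)

lemma eqv_tt:
  assumes "1 \<le> i" "1 \<le> j"
  shows "gen_t i * gen_t j \<approx> gen_t j * gen_t i"
proof (rule eqv_relator[where n = "max i j + 1"])
  show "gen_t i * gen_t j - gen_t j * gen_t i \<in> yh_relators d q (max i j + 1)"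
    unfolding yh_relators_def
    apply (rule UnI1, rule UnI1, rule UnI1, rule UnI2) using assms by fastforce
qed (use assms in auto)

lemma transpose_ge1: "1 \<le> i \<Longrightarrow> 1 \<le> j \<Longrightarrow> 1 \<le> Transposition.transpose i (Suc i) j"
  by (auto simp: Transposition.transpose_def)

lemma eqv_tg:
  assumes "1 \<le> i" "1 \<le> j"
  shows "gen_t j * gen_g i \<approx> gen_g i * gen_t (Transposition.transpose i (i + 1) j)"
proof (rule eqv_relator[where n = "max i j + 1"])
  show "gen_t j * gen_g i - gen_g i * gen_t (Transposition.transpose i (i + 1) j) \<in> yh_relators d q (max i j + 1)"
    unfolding yh_relators_def
    apply (rule UnI1, rule UnI1, rule UnI2) using assms by fastforce
qed (use assms transpose_ge1[of i j] in auto)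

lemma eqv_td:
  assumes "1 \<le> j"
  shows "gen_t j ^ d \<approx> 1"
proof (rule eqv_relator[where n = "j"])
  show "gen_t j ^ d - 1 \<in> yh_relators d q j"
    unfolding yh_relators_def
    apply (rule UnI1, rule UnI2) using assms by fastforce
qed (use assms in auto)

lemma eqv_g2:
  assumes "1 \<le> i"
  shows "gen_g i * gen_g i \<approx> 1 + scalar h * idem_e d i * gen_g i"
proof (rule eqv_relator[where n = "i + 1"])
  show "gen_g i * gen_g i - (1 + scalar h * idem_e d i * gen_g i) \<in> yh_relators d q (i + 1)"
    unfolding yh_relators_def
    apply (rule UnI2) using assms by (fastforce simp: power2_eq_square)
qed (use assms in auto)

lemma eqv_commute_power:
  assumes "x * y \<approx> y * x'" "x \<in> falg" "x' \<in> falg" "y \<in> falg"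
  shows "x ^ k * y \<approx> y * x' ^ k"
proof (induction k)
  case (Suc k)
  have "x ^ Suc k * y = x * (x ^ k * y)" by (simp add: mult.assoc)
  also have "\<dots> \<approx> x * (y * x' ^ k)" using Suc assms by (intro eqv_multL)
  also have "\<dots> = (x * y) * x' ^ k" by (simp add: mult.assoc)
  also have "\<dots> \<approx> (y * x') * x' ^ k" using assms by (intro eqv_multR) auto
  finally show ?case by (simp add: mult.assoc)
qed (use assms in auto)

lemma eqv_commute_subalg:
  assumes "a \<in> subalg S" "S \<subseteq> (\<Union>n. gens n)" "x \<in> falg"
    and "\<And>s. s \<in> S \<Longrightarrow> Poly_Mapping.single [s] 1 * x \<approx> x * Poly_Mapping.single [s] 1"
  shows "a * x \<approx> x * a"
proof -
  have U: "a \<in> falg" if "a \<in> subalg S" for a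
    using that subalg_mono[OF assms(2)] by (auto simp: falg_def)
  show ?thesis using assms(1)
  proof (induction rule: subalg_induct)
    case (scalar c)
    then show ?case using assms by (simp add: scalar_central)
  next
    case (letter s)
    then show ?case using assms by blast
  next
    case (add a b)
    then show ?case by (simp add: distrib_left distrib_right eqv_add)
  next
    case (mult a b)
    have "a * b * x = a * (b * x)" by (simp add: mult.assoc)
    also have "\<dots> \<approx> a * (x * b)" using mult U by (intro eqv_multL) auto
    also have "\<dots> = (a * x) * b" by (simp add: mult.assoc)
    also have "\<dots> \<approx> (x * a) * b" using mult U by (intro eqv_multR) auto
    finally show ?case by (simp add: mult.assoc)
  qed
qed

text \<open>
  The generators of the first \<open>n\<close> strands do not meet strand \<open>n + 1\<close>.
\<close>

lemma eqv_commute_t: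
  assumes "a \<in> subalg (gens n)"
  shows "a * gen_t (n + 1) ^ k \<approx> gen_t (n + 1) ^ k * a"
proof (rule eqv_commute_subalg[OF assms])
  fix s assume "s \<in> gens n"
  then consider i where "s = Gen_G i" "1 \<le> i" "i < n" | j where "s = Gen_T j" "1 \<le> j" "j \<le> n"
    by (auto simp: gens_def)
  then have "gen_t (n + 1) ^ k * Poly_Mapping.single [s] 1 \<approx> Poly_Mapping.single [s] 1 * gen_t (n + 1) ^ k"
  proof cases
    case 1
    then have "Transposition.transpose i (i + 1) (n + 1) = n + 1" by (simp add: Transposition.transpose_def)
    with 1 have "gen_t (n + 1) * gen_g i \<approx> gen_g i * gen_t (n + 1)" using eqv_tg[of i "n + 1"] by simp
    then have "gen_t (n + 1) ^ k * gen_g i \<approx> gen_g i * gen_t (n + 1) ^ k"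
      using 1 by (intro eqv_commute_power) auto
    then show ?thesis using 1 by (simp add: gen_g_def)
  next
    case 2
    then have "gen_t (n + 1) ^ k * gen_t j \<approx> gen_t j * gen_t (n + 1) ^ k"
      using eqv_tt[of "n + 1" j] by (intro eqv_commute_power) auto
    then show ?thesis using 2 by (simp add: gen_t_def)
  qed
  then show "Poly_Mapping.single [s] 1 * gen_t (n + 1) ^ k \<approx> gen_t (n + 1) ^ k * Poly_Mapping.single [s] 1"
    by (rule eqv_sym)
qed auto

lemma eqv_commute_g:
  assumes "a \<in> subalg (gens n)"
  shows "a * gen_g (n + 1) \<approx> gen_g (n + 1) * a"
proof (rule eqv_commute_subalg[OF assms])
  fix s assume "s \<in> gens n"
  then consider i where "s = Gen_G i" "1 \<le> i" "i < n" | j where "s = Gen_T j" "1 \<le> j" "j \<le> n"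
    by (auto simp: gens_def)
  then show "Poly_Mapping.single [s] 1 * gen_g (n + 1) \<approx> gen_g (n + 1) * Poly_Mapping.single [s] 1"
  proof cases
    case 1
    then show ?thesis using eqv_gg[of i "n + 1"] by (simp add: gen_g_def)
  next
    case 2
    then have "Transposition.transpose (n + 1) (n + 1 + 1) j = j" by (simp add: Transposition.transpose_def)
    with 2 show ?thesis using eqv_tg[of "n + 1" j] by (simp add: gen_t_def)
  qed
qed auto

lemma eqv_tng: "1 \<le> n \<Longrightarrow> gen_t n ^ k * gen_g n \<approx> gen_g n * gen_t (n + 1) ^ k"
  and eqv_tSng: "1 \<le> n \<Longrightarrow> gen_t (n + 1) ^ k * gen_g n \<approx> gen_g n * gen_t n ^ k"
  using eqv_tg[of n n] eqv_tg[of n "n + 1"] by (auto intro!: eqv_commute_power)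

end

section \<open>Markov functionals are determined by their parameters\<close>

text \<open>
  An element of the free algebra whose coefficients are polynomials in \<open>q - inverse q\<close>.  The
  quadratic relation, the only one that involves \<open>q\<close>, introduces no other coefficients.  Keeping
  track of this gives one evaluation polynomial for all \<open>q\<close> at once, which later carries the
  existence of the trace from generic \<open>q\<close> to all \<open>q\<close>.
\<close>

inductive q_family :: "nat \<Rightarrow> (complex \<Rightarrow> free_algebra) \<Rightarrow> bool" for n where
  scalar: "q_family n (\<lambda>_. scalar c)"
| h: "q_family n (\<lambda>q. scalar (q - inverse q))"
| letter: "x \<in> gens n \<Longrightarrow> q_family n (\<lambda>_. Poly_Mapping.single [x] 1)"
| add: "q_family n a \<Longrightarrow> q_family n b \<Longrightarrow> q_family n (\<lambda>q. a q + b q)"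
| mult: "q_family n a \<Longrightarrow> q_family n b \<Longrightarrow> q_family n (\<lambda>q. a q * b q)"

lemma q_family_const:
  assumes "a \<in> subalg (gens n)"
  shows "q_family n (\<lambda>_. a)"
  using assms by (induction rule: subalg_induct) (auto intro: q_family.intros)

lemma q_family_subalg: "q_family n a \<Longrightarrow> a q \<in> subalg (gens n)"
  by (induction rule: q_family.induct) (auto intro: subalg_letter)

lemma q_family_falg [simp]: "q_family n a \<Longrightarrow> a q \<in> falg"
  using q_family_subalg subalg_gens_falg by blast

lemma q_family_mono: "q_family m a \<Longrightarrow> m \<le> n \<Longrightarrow> q_family n a"
  by (induction rule: q_family.induct) (use gens_mono in \<open>auto intro: q_family.intros\<close>)

abbreviation eqv_under :: "free_algebra \<Rightarrow> (free_algebra \<Rightarrow> complex) \<Rightarrow> free_algebra \<Rightarrow> bool"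
  (\<open>(_ \<approx>\<^bsub>_\<^esub> _)\<close> [51, 0, 51] 50) where
  "x \<approx>\<^bsub>F\<^esub> y \<equiv> markov_functional.eqv F x y"

text \<open>
  Congruence that holds for every Markov functional, hence uniformly in \<open>q\<close> and \<open>z\<close>.
\<close>

definition always_eqv :: "nat \<Rightarrow> (complex \<Rightarrow> free_algebra) \<Rightarrow> (complex \<Rightarrow> free_algebra) \<Rightarrow> bool" where
  "always_eqv d x y \<longleftrightarrow>
     (\<forall>q z F. markov_functional d q z F \<longrightarrow> x q \<approx>\<^bsub>F\<^esub> y q)"

text \<open>
  Families that the relations reduce to sums of \<open>a * t_(n+1)^k\<close> and \<open>a * g_n * b\<close> with \<open>a\<close>
  and \<open>b\<close> on the first \<open>n\<close> strands.  These are exactly the shapes on which the axioms of the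
  trace allow it to be computed from its values on \<open>n\<close> strands.
\<close>

inductive spanned :: "nat \<Rightarrow> nat \<Rightarrow> (complex \<Rightarrow> free_algebra) \<Rightarrow> bool" for d n where
  t: "q_family n a \<Longrightarrow> spanned d n (\<lambda>q. a q * gen_t (n + 1) ^ k)"
| g: "1 \<le> n \<Longrightarrow> q_family n a \<Longrightarrow> q_family n b \<Longrightarrow> spanned d n (\<lambda>q. a q * gen_g n * b q)"
| add: "spanned d n x \<Longrightarrow> spanned d n y \<Longrightarrow> spanned d n (\<lambda>q. x q + y q)"
| cong: "spanned d n x \<Longrightarrow> always_eqv d x y \<Longrightarrow> spanned d n y"

lemma spanned_falg:
  assumes "spanned d n x" "markov_functional d q z F"
  shows "x q \<in> falg"
  using assms(1)
proof induction
  case (cong x y)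
  then show ?case using assms(2) markov_functional.eqv_falg[OF assms(2)] unfolding always_eqv_def by blast
qed auto

lemma spanned_1: "spanned d n (\<lambda>_. 1)"
  using spanned.t[of n "\<lambda>_. scalar 1" d 0] q_family.scalar[of n 1] by simp

text \<open>
  The spanned families form a two-sided module over the families on the first \<open>n\<close> strands, and
  also over the powers of \<open>t_(n+1)\<close>: all of these can be moved past each other, or past \<open>g_n\<close>
  at the price of turning \<open>t_(n+1)\<close> into \<open>t_n\<close>.
\<close>

lemma spanned_family_mult:
  assumes c: "q_family n c" and "spanned d n x"
  shows "spanned d n (\<lambda>q. c q * x q)"
  using assms(2)
proof induction
  case (t a k)
  then show ?case
    using spanned.t[OF q_family.mult[OF c t]] by (simp add: mult.assoc)
next
  case (g a b)
  then show ?case using spanned.g[OF g(1) q_family.mult[OF c g(2)] g(3)] by (simp add: mult.assoc)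
next
  case (add x y)
  then show ?case using spanned.add[OF add.IH] by (simp add: distrib_left)
next
  case (cong x y)
  have "always_eqv d (\<lambda>q. c q * x q) (\<lambda>q. c q * y q)"
    unfolding always_eqv_def using cong(2) c
    by (auto simp: always_eqv_def intro!: markov_functional.eqv_multL)
  then show ?case using cong spanned.cong by blast
qed

lemma spanned_mult_family:
  assumes c: "q_family n c" and "spanned d n x"
  shows "spanned d n (\<lambda>q. x q * c q)"
  using assms(2)
proof induction
  case (t a k)
  have "always_eqv d (\<lambda>q. (a q * c q) * gen_t (n + 1) ^ k) (\<lambda>q. a q * gen_t (n + 1) ^ k * c q)"
    unfolding always_eqv_def
  proof (intro allI impI)
    fix q z F assume "markov_functional d q z F"
    then interpret markov_functional d q z F .
    show "a q * c q * gen_t (n + 1) ^ k \<approx>\<^bsub>F\<^esub> a q * gen_t (n + 1) ^ k * c q"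
      unfolding mult.assoc using c t by (intro eqv_multL eqv_commute_t) (auto simp: q_family_subalg)
  qed
  then show ?case using spanned.cong spanned.t[OF q_family.mult[OF t c]] by blast
next
  case (g a b)
  then show ?case using spanned.g[OF g(1) g(2) q_family.mult[OF g(3) c]] by (simp add: mult.assoc)
next
  case (add x y)
  then show ?case using spanned.add[OF add.IH] by (simp add: distrib_right)
next
  case (cong x y)
  have "always_eqv d (\<lambda>q. x q * c q) (\<lambda>q. y q * c q)"
    unfolding always_eqv_def using cong(2) c
    by (auto simp: always_eqv_def intro!: markov_functional.eqv_multR)
  then show ?case using cong spanned.cong by blast
qed

lemma q_family_t: "1 \<le> j \<Longrightarrow> j \<le> n \<Longrightarrow> q_family n (\<lambda>_. gen_t j ^ k)"
  by (intro q_family_const subalg_power subalg_gen_t)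

lemma spanned_t_mult:
  assumes "spanned d n x"
  shows "spanned d n (\<lambda>q. gen_t (n + 1) ^ j * x q)"
  using assms
proof induction
  case (t a k)
  have "always_eqv d (\<lambda>q. a q * gen_t (n + 1) ^ (j + k)) (\<lambda>q. gen_t (n + 1) ^ j * (a q * gen_t (n + 1) ^ k))"
    unfolding always_eqv_def
  proof (intro allI impI)
    fix q z F assume "markov_functional d q z F"
    then interpret markov_functional d q z F .
    show "a q * gen_t (n + 1) ^ (j + k) \<approx>\<^bsub>F\<^esub> gen_t (n + 1) ^ j * (a q * gen_t (n + 1) ^ k)"
      unfolding power_add mult.assoc[symmetric] using t by (intro eqv_multR eqv_commute_t) (auto simp: q_family_subalg)
  qed
  then show ?case using spanned.cong spanned.t[OF t] by blast
next
  case (g a b)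
  have "always_eqv d (\<lambda>q. a q * gen_g n * (gen_t n ^ j * b q)) (\<lambda>q. gen_t (n + 1) ^ j * (a q * gen_g n * b q))"
    unfolding always_eqv_def
  proof (intro allI impI)
    fix q z F assume "markov_functional d q z F"
    then interpret markov_functional d q z F .
    have "a q * gen_g n * (gen_t n ^ j * b q) = a q * (gen_g n * gen_t n ^ j) * b q" by (simp add: mult.assoc)
    also have "\<dots> \<approx>\<^bsub>F\<^esub> a q * (gen_t (n + 1) ^ j * gen_g n) * b q"
      using g by (intro eqv_multL eqv_multR eqv_sym[OF eqv_tSng]) auto
    also have "\<dots> = (a q * gen_t (n + 1) ^ j) * (gen_g n * b q)" by (simp add: mult.assoc)
    also have "\<dots> \<approx>\<^bsub>F\<^esub> (gen_t (n + 1) ^ j * a q) * (gen_g n * b q)"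
      using g by (intro eqv_multR eqv_commute_t) (auto simp: q_family_subalg)
    finally show "a q * gen_g n * (gen_t n ^ j * b q) \<approx>\<^bsub>F\<^esub> gen_t (n + 1) ^ j * (a q * gen_g n * b q)"
      by (simp add: mult.assoc)
  qed
  moreover have "q_family n (\<lambda>q. gen_t n ^ j * b q)"
    using q_family.mult[OF q_family_t[of n n j] g(3)] g(1) by simp
  ultimately show ?case using spanned.cong spanned.g[OF g(1) g(2)] by blast
next
  case (add x y)
  then show ?case using spanned.add[OF add.IH] by (simp add: distrib_left)
next
  case (cong x y)
  have "always_eqv d (\<lambda>q. gen_t (n + 1) ^ j * x q) (\<lambda>q. gen_t (n + 1) ^ j * y q)"
    unfolding always_eqv_def using cong(2)
    by (auto simp: always_eqv_def intro!: markov_functional.eqv_multL)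
  then show ?case using cong spanned.cong by blast
qed

lemma spanned_mult_t:
  assumes "spanned d n x"
  shows "spanned d n (\<lambda>q. x q * gen_t (n + 1) ^ j)"
  using assms
proof induction
  case (t a k)
  then show ?case using spanned.t[OF t, of d "k + j"] by (simp add: power_add mult.assoc)
next
  case (g a b)
  have "always_eqv d (\<lambda>q. (a q * gen_t n ^ j) * gen_g n * b q) (\<lambda>q. (a q * gen_g n * b q) * gen_t (n + 1) ^ j)"
    unfolding always_eqv_def
  proof (intro allI impI)
    fix q z F assume "markov_functional d q z F"
    then interpret markov_functional d q z F .
    have "(a q * gen_t n ^ j) * gen_g n * b q = a q * (gen_t n ^ j * gen_g n) * b q" by (simp add: mult.assoc)
    also have "\<dots> \<approx>\<^bsub>F\<^esub> a q * (gen_g n * gen_t (n + 1) ^ j) * b q"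
      using g by (intro eqv_multL eqv_multR eqv_tng) auto
    also have "\<dots> = (a q * gen_g n) * (gen_t (n + 1) ^ j * b q)" by (simp add: mult.assoc)
    also have "\<dots> \<approx>\<^bsub>F\<^esub> (a q * gen_g n) * (b q * gen_t (n + 1) ^ j)"
      using g by (intro eqv_multL eqv_sym[OF eqv_commute_t]) (auto simp: q_family_subalg)
    finally show "(a q * gen_t n ^ j) * gen_g n * b q \<approx>\<^bsub>F\<^esub> (a q * gen_g n * b q) * gen_t (n + 1) ^ j"
      by (simp add: mult.assoc)
  qed
  moreover have "q_family n (\<lambda>q. a q * gen_t n ^ j)"
    using q_family.mult[OF g(2) q_family_t[of n n j]] g(1) by simp
  ultimately show ?case using spanned.cong spanned.g[OF g(1) _ g(3)] by blast
next
  case (add x y)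
  then show ?case using spanned.add[OF add.IH] by (simp add: distrib_right)
next
  case (cong x y)
  have "always_eqv d (\<lambda>q. x q * gen_t (n + 1) ^ j) (\<lambda>q. y q * gen_t (n + 1) ^ j)"
    unfolding always_eqv_def using cong(2)
    by (auto simp: always_eqv_def intro!: markov_functional.eqv_multR)
  then show ?case using cong spanned.cong by blast
qed

lemma spanned_0: "spanned d n (\<lambda>_. 0)"
  using spanned_family_mult[OF q_family.scalar[of n 0] spanned_1] by simp

lemma spanned_sum: "(\<And>i. i \<in> I \<Longrightarrow> spanned d n (f i)) \<Longrightarrow> spanned d n (\<lambda>q. \<Sum>i\<in>I. f i q)"
  by (induction I rule: infinite_finite_induct) (auto intro: spanned.add spanned_0)

lemma spanned_g: "1 \<le> n \<Longrightarrow> spanned d n (\<lambda>_. gen_g n)"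
  using spanned.g[OF _ q_family.scalar[of n 1] q_family.scalar[of n 1], of d] by simp

lemma spanned_gg:
  assumes "1 \<le> n"
  shows "spanned d n (\<lambda>_. gen_g n * gen_g n)"
proof -
  have "spanned d n (\<lambda>q. scalar (1 / of_nat d) * ((\<Sum>s = 0..d - 1. gen_t n ^ s * (gen_t (n + 1) ^ (d - s) * gen_g n))))"
    using assms by (intro spanned_family_mult[OF q_family.scalar] spanned_sum
        spanned_family_mult[OF q_family_t] spanned_t_mult spanned_g) auto
  then have "spanned d n (\<lambda>q. idem_e d n * gen_g n)"
    by (simp add: idem_e_def sum_distrib_right mult.assoc)
  then have "spanned d n (\<lambda>q. 1 + scalar (q - inverse q) * (idem_e d n * gen_g n))"
    by (intro spanned.add spanned_1 spanned_family_mult[OF q_family.h])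
  moreover have "always_eqv d (\<lambda>q. 1 + scalar (q - inverse q) * (idem_e d n * gen_g n)) (\<lambda>_. gen_g n * gen_g n)"
    unfolding always_eqv_def mult.assoc[symmetric]
    using assms by (intro allI impI) (rule markov_functional.eqv_sym, auto intro: markov_functional.eqv_g2)
  ultimately show ?thesis by (rule spanned.cong)
qed

text \<open>
  The essential reduction: two occurrences of \<open>g_n\<close> are merged into one.  The element between them
  is itself reduced on one strand less; if it contains no \<open>g_(n-1)\<close> the quadratic relation
  applies, and if it contains one the braid relation does.
\<close>

lemma spanned_g_family_g:
  assumes n: "n = m + 1" and "spanned d m a"
  shows "spanned d n (\<lambda>q. gen_g n * a q * gen_g n)"
  using assms(2)
proof induction
  case (t a k)
  have "always_eqv d (\<lambda>q. a q * ((gen_g n * gen_g n) * gen_t (n + 1) ^ k)) (\<lambda>q. gen_g n * (a q * gen_t (m + 1) ^ k) * gen_g n)"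
    unfolding always_eqv_def
  proof (intro allI impI)
    fix q z F assume "markov_functional d q z F"
    then interpret markov_functional d q z F .
    have [simp]: "a q \<in> falg" using t by auto
    have "a q * ((gen_g n * gen_g n) * gen_t (n + 1) ^ k) = a q * gen_g n * (gen_g n * gen_t (n + 1) ^ k)"
      by (simp add: mult.assoc)
    also have "\<dots> \<approx>\<^bsub>F\<^esub> a q * gen_g n * (gen_t n ^ k * gen_g n)"
      using n by (intro eqv_multL eqv_sym[OF eqv_tng]) auto
    also have "\<dots> = (a q * gen_g n) * gen_t n ^ k * gen_g n" by (simp add: mult.assoc)
    also have "\<dots> \<approx>\<^bsub>F\<^esub> (gen_g n * a q) * gen_t n ^ k * gen_g n"
      unfolding n using q_family_subalg[OF t] by (intro eqv_multR eqv_commute_g) auto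
    finally show "a q * ((gen_g n * gen_g n) * gen_t (n + 1) ^ k) \<approx>\<^bsub>F\<^esub> gen_g n * (a q * gen_t (m + 1) ^ k) * gen_g n"
      by (simp add: mult.assoc n)
  qed
  moreover have "spanned d n (\<lambda>q. a q * ((gen_g n * gen_g n) * gen_t (n + 1) ^ k))"
    using n by (intro spanned_family_mult[OF q_family_mono[OF t]] spanned_mult_t spanned_gg) auto
  ultimately show ?case using spanned.cong by blast
next
  case (g a b)
  have "always_eqv d (\<lambda>q. a q * gen_g m * gen_g n * (gen_g m * b q)) (\<lambda>q. gen_g n * (a q * gen_g m * b q) * gen_g n)"
    unfolding always_eqv_def
  proof (intro allI impI)
    fix q z F assume "markov_functional d q z F"
    then interpret markov_functional d q z F .
    have [simp]: "a q \<in> falg" "b q \<in> falg" using g by auto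
    have [simp]: "gen_g m \<in> falg" "gen_g n \<in> falg" using n g by auto
    have "a q * gen_g m * gen_g n * (gen_g m * b q) = a q * (gen_g m * gen_g n * gen_g m) * b q"
      by (simp add: mult.assoc)
    also have "\<dots> \<approx>\<^bsub>F\<^esub> a q * (gen_g n * gen_g m * gen_g n) * b q"
      using n g by (intro eqv_multL eqv_multR eqv_braid) auto
    also have "\<dots> = (a q * gen_g n) * gen_g m * (gen_g n * b q)" by (simp add: mult.assoc)
    also have "\<dots> \<approx>\<^bsub>F\<^esub> (gen_g n * a q) * gen_g m * (b q * gen_g n)"
      unfolding n using q_family_subalg[OF g(2)] q_family_subalg[OF g(3)] g(1)
      by (intro eqv_mult eqv_refl eqv_commute_g eqv_sym[OF eqv_commute_g]) auto
    finally show "a q * gen_g m * gen_g n * (gen_g m * b q) \<approx>\<^bsub>F\<^esub> gen_g n * (a q * gen_g m * b q) * gen_g n"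
      by (simp add: mult.assoc)
  qed
  moreover have "spanned d n (\<lambda>q. a q * gen_g m * gen_g n * (gen_g m * b q))"
  proof (rule spanned.g)
    have "q_family n (\<lambda>_. gen_g m)" using g n by (auto intro!: q_family_const)
    then show "q_family n (\<lambda>q. a q * gen_g m)" "q_family n (\<lambda>q. gen_g m * b q)"
      using q_family_mono[OF g(2), of n] q_family_mono[OF g(3), of n] n by (auto intro: q_family.mult)
  qed (use n in auto)
  ultimately show ?case using spanned.cong by blast
next
  case (add x y)
  then show ?case using spanned.add[OF add.IH] by (simp add: distrib_left distrib_right)
next
  case (cong x y)
  have "always_eqv d (\<lambda>q. gen_g n * x q * gen_g n) (\<lambda>q. gen_g n * y q * gen_g n)"
    unfolding always_eqv_def using cong(2) n
    by (auto simp: always_eqv_def intro!: markov_functional.eqv_multR markov_functional.eqv_multL)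
  then show ?case using cong spanned.cong by blast
qed

lemma spanned_g_mult:
  assumes n: "n = m + 1" and IH: "\<And>a. q_family n a \<Longrightarrow> spanned d m a" and "spanned d n x"
  shows "spanned d n (\<lambda>q. gen_g n * x q)"
  using assms(3)
proof induction
  case (t a k)
  have "always_eqv d (\<lambda>q. gen_t n ^ k * gen_g n * a q) (\<lambda>q. gen_g n * (a q * gen_t (n + 1) ^ k))"
    unfolding always_eqv_def
  proof (intro allI impI)
    fix q z F assume "markov_functional d q z F"
    then interpret markov_functional d q z F .
    have [simp]: "a q \<in> falg" using t by auto
    have "gen_t n ^ k * gen_g n * a q \<approx>\<^bsub>F\<^esub> (gen_g n * gen_t (n + 1) ^ k) * a q"
      using n by (intro eqv_multR eqv_tng) auto
    also have "\<dots> = gen_g n * (gen_t (n + 1) ^ k * a q)" by (simp add: mult.assoc)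
    also have "\<dots> \<approx>\<^bsub>F\<^esub> gen_g n * (a q * gen_t (n + 1) ^ k)"
      using q_family_subalg[OF t] n by (intro eqv_multL eqv_sym[OF eqv_commute_t]) auto
    finally show "gen_t n ^ k * gen_g n * a q \<approx>\<^bsub>F\<^esub> gen_g n * (a q * gen_t (n + 1) ^ k)" .
  qed
  moreover have "spanned d n (\<lambda>q. gen_t n ^ k * gen_g n * a q)"
    using n t by (intro spanned.g q_family_t) auto
  ultimately show ?case using spanned.cong by blast
next
  case (g a b)
  have "spanned d n (\<lambda>q. (gen_g n * a q * gen_g n) * b q)"
    using g by (intro spanned_mult_family spanned_g_family_g[OF n] IH)
  then show ?case by (simp add: mult.assoc)
next
  case (add x y)
  then show ?case using spanned.add[OF add.IH] by (simp add: distrib_left)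
next
  case (cong x y)
  have "always_eqv d (\<lambda>q. gen_g n * x q) (\<lambda>q. gen_g n * y q)"
    unfolding always_eqv_def using cong(2) n
    by (auto simp: always_eqv_def intro!: markov_functional.eqv_multL)
  then show ?case using cong spanned.cong by blast
qed

text \<open>
  The set of spanned families contains 1 and is stable under left multiplication by all generators
  on \<open>n + 1\<close> strands, so it is everything.
\<close>

theorem q_family_spanned: "q_family (n + 1) x \<Longrightarrow> spanned d n x"
proof (induction n arbitrary: x)
  case (0 x)
  have "spanned d 0 y \<Longrightarrow> spanned d 0 (\<lambda>q. x q * y q)" for y
    using 0
  proof (induction arbitrary: y rule: q_family.induct)
    case (letter s)
    then have "s = Gen_T 1" by (auto simp: gens_def)
    then show ?case using spanned_t_mult[OF letter(2), of 1] by (simp add: gen_t_def)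
  next
    case (add a b)
    then show ?case by (simp add: distrib_right spanned.add)
  next
    case (mult a b)
    then show ?case by (simp add: mult.assoc)
  qed (auto intro: spanned_family_mult q_family.scalar q_family.h)
  from this[OF spanned_1] show ?case by simp
next
  case (Suc m x)
  let ?n = "Suc m"
  have "spanned d ?n y \<Longrightarrow> spanned d ?n (\<lambda>q. x q * y q)" for y
    using Suc.prems
  proof (induction arbitrary: y rule: q_family.induct)
    case (letter s)
    then consider "s = Gen_T (?n + 1)" | "s = Gen_G ?n" | "s \<in> gens ?n"
      by (fastforce simp: gens_def)
    then show ?case
    proof cases
      case 1
      then show ?thesis using spanned_t_mult[OF letter(2), of 1] by (simp add: gen_t_def)
    next
      case 2
      then show ?thesis using spanned_g_mult[of ?n m d, OF _ _ letter(2)] Suc.IH by (simp add: gen_g_def)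
    next
      case 3
      then show ?thesis using letter by (auto intro: spanned_family_mult q_family.letter)
    qed
  next
    case (add a b)
    then show ?case by (simp add: distrib_right spanned.add)
  next
    case (mult a b)
    then show ?case by (simp add: mult.assoc)
  qed (auto intro: spanned_family_mult q_family.scalar q_family.h)
  from this[OF spanned_1] show ?case by simp
qed

text \<open>
  The value is given by one polynomial in \<open>q - inverse q\<close> (outer variable) and \<open>z\<close> (inner
  variable), the same for every Markov functional.
\<close>

definition determined :: "nat \<Rightarrow> (complex \<Rightarrow> free_algebra) \<Rightarrow> bool" where
  "determined d x \<longleftrightarrow> (\<exists>P :: complex poly poly. \<forall>q z F. markov_functional d q z F \<longrightarrow>
      F (x q) = poly (poly P [:q - inverse q:]) z)"

lemma (in markov_functional) F_t_power:
  assumes "a \<in> subalg (gens n)"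
  shows "F (a * gen_t (n + 1) ^ k) = (if d dvd k then F a else 0)"
proof -
  let ?t = "gen_t (n + 1)"
  have a: "a \<in> falg" using assms subalg_gens_falg by blast
  have "?t ^ k = (?t ^ d) ^ (k div d) * ?t ^ (k mod d)"
    by (metis mult_div_mod_eq power_add power_mult)
  moreover have "(?t ^ d) ^ (k div d) \<approx>\<^bsub>F\<^esub> 1 ^ (k div d)"
    by (intro eqv_power eqv_td) auto
  then have "a * ((?t ^ d) ^ (k div d) * ?t ^ (k mod d)) \<approx>\<^bsub>F\<^esub> a * (1 ^ (k div d) * ?t ^ (k mod d))"
    using a by (intro eqv_multL eqv_multR) auto
  ultimately have "a * ?t ^ k \<approx>\<^bsub>F\<^esub> a * (1 * ?t ^ (k mod d))"
    by simp
  then have "F (a * ?t ^ k) = F (a * ?t ^ (k mod d))"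
    by (metis eqv_F mult_1)
  moreover have "k mod d \<le> d - 1" using d_pos
    by (metis One_nat_def Suc_leI Suc_pred leD less_Suc_eq_le mod_less_divisor not_less)
  ultimately show ?thesis
    using F_t[OF assms, of "k mod d"] by (cases "k mod d = 0") (auto simp: dvd_eq_mod_eq_0)
qed

text \<open>
  Induction on the number of strands.  On the spanning elements the Markov property, cyclicity and
  the vanishing on the powers of \<open>t_(n+1)\<close> lower the number of strands.
\<close>

theorem q_family_determined: "q_family n x \<Longrightarrow> determined d x"
proof (induction n arbitrary: x)
  case 0
  then have "\<exists>c. \<forall>q. x q = scalar (poly c (q - inverse q))"
  proof (induction rule: q_family.induct)
    case (scalar c)
    then show ?case by (intro exI[of _ "[:c:]"]) simp
  next
    case h
    then show ?case by (intro exI[of _ "[:0, 1:]"]) simp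
  next
    case (letter x)
    then show ?case by (simp add: gens_def)
  next
    case (add a b)
    then show ?case by (metis poly_add scalar_add)
  next
    case (mult a b)
    then show ?case by (metis poly_mult scalar_mult)
  qed
  then obtain c where c: "\<And>q. x q = scalar (poly c (q - inverse q))" by blast
  have const: "poly (poly (map_poly (\<lambda>a. [:a:]) c) [:u:]) v = poly c u" for u v :: complex
    by (induction c) (auto simp: map_poly_pCons)
  show ?case unfolding determined_def
  proof (intro exI allI impI)
    fix q z F assume "markov_functional d q z F"
    then interpret markov_functional d q z F .
    have "F (x q) = poly c (q - inverse q)" using F_scalar[of 1] F_one by (simp add: c)
    then show "F (x q) = poly (poly (map_poly (\<lambda>a. [:a:]) c) [:q - inverse q:]) z"
      by (simp add: const)
  qed
next
  case (Suc n)
  then have "spanned d n x" using q_family_spanned by simp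
  then show ?case
  proof induction
    case (t a k)
    from Suc.IH[OF t] obtain P where
      P: "\<And>q z F. markov_functional d q z F \<Longrightarrow> F (a q) = poly (poly P [:q - inverse q:]) z"
      unfolding determined_def by blast
    show ?case unfolding determined_def
    proof (intro exI allI impI)
      fix q z F assume m: "markov_functional d q z F"
      show "F (a q * gen_t (n + 1) ^ k) = poly (poly (if d dvd k then P else 0) [:q - inverse q:]) z"
        using markov_functional.F_t_power[OF m q_family_subalg[OF t]] P[OF m] by simp
    qed
  next
    case (g a b)
    from Suc.IH[OF q_family.mult[OF g(3,2)]] obtain P where
      P: "\<And>q z F. markov_functional d q z F \<Longrightarrow> F (b q * a q) = poly (poly P [:q - inverse q:]) z"
      unfolding determined_def by blast
    show ?case unfolding determined_def
    proof (intro exI allI impI)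
      fix q z F assume m: "markov_functional d q z F"
      then interpret markov_functional d q z F .
      have "F (a q * gen_g n * b q) = F (b q * (a q * gen_g n))"
        using g by (intro F_cyclic) auto
      also have "\<dots> = z * F (b q * a q)"
        using F_g[OF g(1), of "b q * a q"] q_family_subalg[OF q_family.mult[OF g(3,2)], of q]
        by (simp add: mult.assoc)
      finally show "F (a q * gen_g n * b q) = poly (poly ([:[:0, 1:]:] * P) [:q - inverse q:]) z"
        by (simp add: P[OF m])
    qed
  next
    case (add x y)
    then obtain P Q where
      P: "\<And>q z F. markov_functional d q z F \<Longrightarrow> F (x q) = poly (poly P [:q - inverse q:]) z" and
      Q: "\<And>q z F. markov_functional d q z F \<Longrightarrow> F (y q) = poly (poly Q [:q - inverse q:]) z"
      unfolding determined_def by metis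
    show ?case unfolding determined_def
    proof (intro exI allI impI)
      fix q z F assume m: "markov_functional d q z F"
      show "F (x q + y q) = poly (poly (P + Q) [:q - inverse q:]) z"
        using markov_functional.F_add[OF m spanned_falg[OF add(1) m] spanned_falg[OF add(2) m]] P[OF m] Q[OF m]
        by simp
    qed
  next
    case (cong x y)
    then show ?case
      unfolding determined_def always_eqv_def by (metis markov_functional.eqv_F)
  qed
qed

section \<open>A coloured vertex model\<close>

text \<open>
  A state assigns to every strand position a label, a pair of a colour (first component) and a
  height (second component).  Operators act on complex functions of the infinitely many positions;
  only the trace restricts to finitely many.
\<close>

type_synonym state = "nat \<Rightarrow> nat \<times> nat"

text \<open>
  The eigenvalue of \<open>t_j\<close>: the first component of a label enters only through this root of unity.
\<close>

definition colour :: "nat \<Rightarrow> nat \<times> nat \<Rightarrow> complex" where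
  "colour d l = cis (2 * pi * real (fst l) / real d)"

abbreviation swap_state :: "nat \<Rightarrow> state \<Rightarrow> state" where
  "swap_state i s \<equiv> s \<circ> Transposition.transpose i (i + 1)"

text \<open>
  On strands of equal colour \<open>g_i\<close> acts by the R-matrix of the vector representation of quantum
  \<open>gl_N\<close>, which has the eigenvalues \<open>q\<close> and \<open>- inverse q\<close>; strands of different colours are
  merely interchanged.  The idempotent \<open>e_i\<close> then acts as the projection onto states with equal
  colours at \<open>i\<close> and \<open>i + 1\<close>, so the quadratic relation sees exactly the first case.
\<close>

fun letter_op :: "nat \<Rightarrow> complex \<Rightarrow> gen \<Rightarrow> (state \<Rightarrow> complex) \<Rightarrow> state \<Rightarrow> complex" where
  "letter_op d q (Gen_G i) f s =
     (if colour d (s i) \<noteq> colour d (s (i + 1)) then f (swap_state i s)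
      else if snd (s i) = snd (s (i + 1)) then q * f s
      else if snd (s i) < snd (s (i + 1)) then f (swap_state i s) + (q - inverse q) * f s
      else f (swap_state i s))"
| "letter_op d q (Gen_T j) f s = colour d (s j) * f s"

definition word_op :: "nat \<Rightarrow> complex \<Rightarrow> gen list \<Rightarrow> (state \<Rightarrow> complex) \<Rightarrow> state \<Rightarrow> complex" where
  "word_op d q w = foldr (letter_op d q) w"

definition rep :: "nat \<Rightarrow> complex \<Rightarrow> free_algebra \<Rightarrow> (state \<Rightarrow> complex) \<Rightarrow> state \<Rightarrow> complex" where
  "rep d q a f s = (\<Sum>w\<in>Poly_Mapping.keys a. Poly_Mapping.lookup a w * word_op d q w f s)"

text \<open>
  The coefficients of the interchanged and of the unchanged state in the action of \<open>g_i\<close>.  Writing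
  the action as one linear expression avoids case distinctions where only linearity matters.
\<close>

definition hop :: "nat \<Rightarrow> nat \<times> nat \<Rightarrow> nat \<times> nat \<Rightarrow> complex" where
  "hop d l m = (if colour d l = colour d m \<and> snd l = snd m then 0 else 1)"

definition stay :: "nat \<Rightarrow> complex \<Rightarrow> nat \<times> nat \<Rightarrow> nat \<times> nat \<Rightarrow> complex" where
  "stay d q l m = (if colour d l \<noteq> colour d m then 0 else if snd l = snd m then q
     else if snd l < snd m then q - inverse q else 0)"

lemma letter_op_G: "letter_op d q (Gen_G i) f s =
    hop d (s i) (s (i + 1)) * f (swap_state i s) + stay d q (s i) (s (i + 1)) * f s"
  by (simp add: hop_def stay_def)

lemma letter_op_linear:
  "letter_op d q x (\<lambda>s. \<Sum>i\<in>I. c i * f i s) = (\<lambda>s. \<Sum>i\<in>I. c i * letter_op d q x (f i) s)"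
  by (cases x) (auto simp: fun_eq_iff sum_distrib_left sum.distrib sum_subtractf algebra_simps intro!: sum.cong)

lemma word_op_linear:
  "word_op d q w (\<lambda>s. \<Sum>i\<in>I. c i * f i s) = (\<lambda>s. \<Sum>i\<in>I. c i * word_op d q w (f i) s)"
  by (induction w) (simp_all add: word_op_def letter_op_linear)

lemma rep_superset:
  assumes "finite W" "Poly_Mapping.keys a \<subseteq> W"
  shows "rep d q a f s = (\<Sum>w\<in>W. Poly_Mapping.lookup a w * word_op d q w f s)"
  unfolding rep_def using assms by (intro sum.mono_neutral_left) (auto simp: in_keys_iff)

lemma rep_add: "rep d q (a + b) f s = rep d q a f s + rep d q b f s"
proof -
  let ?W = "Poly_Mapping.keys a \<union> Poly_Mapping.keys b"
  have "rep d q (a + b) f s = (\<Sum>w\<in>?W. Poly_Mapping.lookup (a + b) w * word_op d q w f s)"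
    using keys_add[of a b] by (intro rep_superset) auto
  then show ?thesis
    using rep_superset[of ?W a] rep_superset[of ?W b]
    by (simp add: lookup_add distrib_right sum.distrib)
qed

lemma rep_single [simp]: "rep d q (Poly_Mapping.single w c) f s = c * word_op d q w f s"
  using rep_superset[of "{w}" "Poly_Mapping.single w c" d q f s] by simp

lemma rep_0 [simp]: "rep d q 0 f s = 0"
  by (simp add: rep_def)

lemma rep_sum: "rep d q (sum a I) f s = (\<Sum>i\<in>I. rep d q (a i) f s)"
  by (induction I rule: infinite_finite_induct) (simp_all add: rep_add)

lemma rep_mult: "rep d q (a * b) f = rep d q a (rep d q b f)"
proof
  fix s
  let ?l = "Poly_Mapping.lookup"
  have "a * b = (\<Sum>u\<in>Poly_Mapping.keys a. \<Sum>v\<in>Poly_Mapping.keys b.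
      Poly_Mapping.single (u @ v) (?l a u * ?l b v))"
    by (subst poly_mapping_sum_single[of a], subst poly_mapping_sum_single[of b])
      (simp only: sum_product single_append)
  then have "rep d q (a * b) f s = (\<Sum>u\<in>Poly_Mapping.keys a. \<Sum>v\<in>Poly_Mapping.keys b.
      ?l a u * ?l b v * word_op d q (u @ v) f s)"
    by (simp add: rep_sum)
  also have "\<dots> = (\<Sum>u\<in>Poly_Mapping.keys a. ?l a u *
      (\<Sum>v\<in>Poly_Mapping.keys b. ?l b v * word_op d q u (word_op d q v f) s))"
    by (simp add: sum_distrib_left mult.assoc word_op_def)
  also have "\<dots> = rep d q a (\<lambda>s. \<Sum>v\<in>Poly_Mapping.keys b. ?l b v * word_op d q v f s) s"
    unfolding rep_def[of d q a] word_op_linear ..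
  also have "\<dots> = rep d q a (rep d q b f) s"
    by (simp add: rep_def[of d q b, abs_def])
  finally show "rep d q (a * b) f s = rep d q a (rep d q b f) s" .
qed

lemma rep_scalar [simp]: "rep d q (scalar c) f = (\<lambda>s. c * f s)"
  by (simp add: scalar_eq_single word_op_def fun_eq_iff)

lemma rep_1 [simp]: "rep d q 1 f = f"
  using rep_scalar[of d q 1 f] by simp

lemma rep_uminus: "rep d q (- a) f s = - rep d q a f s"
  using rep_add[of d q a "- a" f s] by (simp add: add_eq_0_iff2)

lemma rep_diff: "rep d q (a - b) f s = rep d q a f s - rep d q b f s"
  using rep_add[of d q a "- b" f s] by (simp add: rep_uminus)

lemma rep_letter [simp]: "rep d q (Poly_Mapping.single [x] 1) f = letter_op d q x f"
  by (simp add: fun_eq_iff word_op_def)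

lemma rep_gen_g [simp]: "rep d q (gen_g i) f = letter_op d q (Gen_G i) f"
  by (simp add: gen_g_def del: letter_op.simps)

lemma rep_gen_t [simp]: "rep d q (gen_t j) f = (\<lambda>s. colour d (s j) * f s)"
  by (simp add: gen_t_def fun_eq_iff)

lemma rep_t_power [simp]: "rep d q (gen_t j ^ k) f = (\<lambda>s. colour d (s j) ^ k * f s)"
  by (induction k) (simp_all add: rep_mult fun_eq_iff mult.assoc)

lemma rep_linear: "rep d q a (\<lambda>s. \<Sum>i\<in>I. c i * f i s) s = (\<Sum>i\<in>I. c i * rep d q a (f i) s)"
  unfolding rep_def word_op_linear by (simp add: sum_distrib_left sum.swap[of _ I] mult_ac)

lemma rep_zero_fun [simp]: "rep d q a (\<lambda>s. 0) s = 0"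
  using rep_linear[of d q a _ _ "{}"] by simp

lemma colour_power_d: "1 \<le> d \<Longrightarrow> colour d l ^ d = 1"
  using cis_multiple_2pi[of "real (fst l)"] by (simp add: colour_def DeMoivre mult_ac)

text \<open>
  A geometric sum over roots of unity: the average of the powers of the quotient of the two colours.
\<close>

lemma rep_idem_e:
  assumes "1 \<le> d"
  shows "rep d q (idem_e d i) f s = (if colour d (s i) = colour d (s (i + 1)) then f s else 0)"
proof -
  let ?x = "colour d (s i)" and ?y = "colour d (s (i + 1))"
  have "rep d q (idem_e d i) f s = (\<Sum>k = 0..d - 1. ?x ^ k * ?y ^ (d - k)) / of_nat d * f s"
    by (simp add: idem_e_def rep_mult rep_sum sum_distrib_right sum_divide_distrib sum_distrib_left mult_ac)
  also have "(\<Sum>k = 0..d - 1. ?x ^ k * ?y ^ (d - k)) = (if ?x = ?y then of_nat d else 0)"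
  proof (cases "?x = ?y")
    case True
    have "(\<Sum>k = 0..d - 1. ?x ^ k * ?y ^ (d - k)) = (\<Sum>k = 0..d - 1. 1)"
      using assms True colour_power_d[OF assms] by (intro sum.cong HOL.refl) (auto simp: power_add[symmetric])
    then show ?thesis using True assms by simp
  next
    case False
    have "{0..d - 1} = {..<d}" using assms by auto
    then have "(\<Sum>k = 0..d - 1. ?x ^ k * ?y ^ (d - k)) = ?y * (\<Sum>k<d. ?y ^ (d - Suc k) * ?x ^ k)"
      unfolding sum_distrib_left
    proof (intro sum.cong)
      fix k assume "k \<in> {..<d}"
      then have "d - k = Suc (d - Suc k)" by auto
      then show "?x ^ k * ?y ^ (d - k) = ?y * (?y ^ (d - Suc k) * ?x ^ k)" by simp
    qed simp
    moreover have "(?x - ?y) * (\<Sum>k<d. ?y ^ (d - Suc k) * ?x ^ k) = 0"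
      using power_diff_sumr2[of ?x d ?y] colour_power_d[OF assms] by simp
    ultimately show ?thesis using False by simp
  qed
  finally show ?thesis using assms by auto
qed

lemma swap_braid:
  "swap_state i (swap_state (i + 1) (swap_state i s)) = swap_state (i + 1) (swap_state i (swap_state (i + 1) s))"
  by (auto simp: fun_eq_iff Transposition.transpose_def)

lemma swap_swap: "swap_state i (swap_state i s) = s"
  by (auto simp: fun_eq_iff Transposition.transpose_def)

text \<open>
  The Yang-Baxter equation, by comparing the colours and heights of the three labels involved.
\<close>

lemma letter_op_braid:
  assumes "q \<noteq> 0"
  shows "letter_op d q (Gen_G i) (letter_op d q (Gen_G (i + 1)) (letter_op d q (Gen_G i) f)) s =
    letter_op d q (Gen_G (i + 1)) (letter_op d q (Gen_G i) (letter_op d q (Gen_G (i + 1)) f)) s"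
proof -
  define \<tau> \<tau>' where "\<tau> = swap_state i" and "\<tau>' = swap_state (i + 1)"
  have ev: "\<tau> s i = s (Suc i)" "\<tau> s (Suc i) = s i" "\<tau> s (Suc (Suc i)) = s (Suc (Suc i))"
    "\<tau>' s i = s i" "\<tau>' s (Suc i) = s (Suc (Suc i))" "\<tau>' s (Suc (Suc i)) = s (Suc i)" for s
    by (auto simp: \<tau>_def \<tau>'_def Transposition.transpose_def)
  have inv: "\<tau> (\<tau> s) = s" "\<tau>' (\<tau>' s) = s" for s
    using swap_swap unfolding \<tau>_def \<tau>'_def by blast+
  have br: "\<tau> (\<tau>' (\<tau> s)) = \<tau>' (\<tau> (\<tau>' s))" for s
    using swap_braid unfolding \<tau>_def \<tau>'_def by blast
  have G: "letter_op d q (Gen_G i) f s =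
     (if colour d (s i) \<noteq> colour d (s (Suc i)) then f (\<tau> s)
      else if snd (s i) = snd (s (Suc i)) then q * f s
      else if snd (s i) < snd (s (Suc i)) then f (\<tau> s) + (q - inverse q) * f s
      else f (\<tau> s))" for f s by (simp add: \<tau>_def)
  have G': "letter_op d q (Gen_G (i + 1)) f s =
     (if colour d (s (Suc i)) \<noteq> colour d (s (Suc (Suc i))) then f (\<tau>' s)
      else if snd (s (Suc i)) = snd (s (Suc (Suc i))) then q * f s
      else if snd (s (Suc i)) < snd (s (Suc (Suc i))) then f (\<tau>' s) + (q - inverse q) * f s
      else f (\<tau>' s))" for f s by (simp add: \<tau>'_def)
  show ?thesis
    unfolding G G' ev inv br
    by (cases "colour d (s i) = colour d (s (Suc i))"; cases "colour d (s (Suc i)) = colour d (s (Suc (Suc i)))";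
        cases "colour d (s i) = colour d (s (Suc (Suc i)))";
        cases "snd (s i)" "snd (s (Suc i))" rule: linorder_cases;
        cases "snd (s (Suc i))" "snd (s (Suc (Suc i)))" rule: linorder_cases;
        cases "snd (s i)" "snd (s (Suc (Suc i)))" rule: linorder_cases;
        simp add: br assms field_simps)
qed


lemma rep_relator:
  assumes "r \<in> yh_relators d q n" "1 \<le> d" "q \<noteq> 0"
  shows "rep d q r f s = 0"
proof -
  have braid: "rep d q (gen_g i * gen_g j * gen_g i - gen_g j * gen_g i * gen_g j) f s = 0"
    if "\<bar>int i - int j\<bar> = 1" for i j
  proof -
    have "j = i + 1 \<or> i = j + 1" using that by auto
    then show ?thesis
      using letter_op_braid[OF assms(3), of d i f s] letter_op_braid[OF assms(3), of d j f s]
      by (auto simp: rep_diff rep_mult simp del: letter_op.simps)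
  qed
  have gg: "rep d q (gen_g i * gen_g j - gen_g j * gen_g i) f s = 0" if "\<bar>int i - int j\<bar> > 1" for i j
  proof -
    have ne: "i \<noteq> j" "i \<noteq> Suc j" "j \<noteq> Suc i" using that by auto
    define \<tau> \<tau>' where "\<tau> = swap_state i" and "\<tau>' = swap_state j"
    have comm: "\<tau> (\<tau>' s) = \<tau>' (\<tau> s)" for s
      using ne by (auto simp: \<tau>_def \<tau>'_def fun_eq_iff Transposition.transpose_def)
    have ev: "\<tau>' s i = s i" "\<tau>' s (Suc i) = s (Suc i)" "\<tau> s j = s j" "\<tau> s (Suc j) = s (Suc j)" for s
      using ne by (auto simp: \<tau>_def \<tau>'_def Transposition.transpose_def)
    have G: "letter_op d q (Gen_G i) f s = hop d (s i) (s (Suc i)) * f (\<tau> s) + stay d q (s i) (s (Suc i)) * f s"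
      and G': "letter_op d q (Gen_G j) f s = hop d (s j) (s (Suc j)) * f (\<tau>' s) + stay d q (s j) (s (Suc j)) * f s" for f s
      by (simp_all add: letter_op_G \<tau>_def \<tau>'_def del: letter_op.simps)
    have "letter_op d q (Gen_G i) (letter_op d q (Gen_G j) f) s =
        letter_op d q (Gen_G j) (letter_op d q (Gen_G i) f) s"
      unfolding G G' ev comm by (simp add: algebra_simps)
    then show ?thesis by (simp add: rep_diff rep_mult del: letter_op.simps)
  qed
  have tt: "rep d q (gen_t i * gen_t j - gen_t j * gen_t i) f s = 0" for i j
    by (simp add: rep_diff rep_mult)
  have tg: "rep d q (gen_t j * gen_g i - gen_g i * gen_t (Transposition.transpose i (i + 1) j)) f s = 0" for i j
    by (auto simp: rep_diff rep_mult Transposition.transpose_def algebra_simps)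
  have td: "rep d q (gen_t j ^ d - 1) f s = 0" for j
    using assms by (simp add: rep_diff colour_power_d)
  have g2: "rep d q (gen_g i ^ 2 - (1 + scalar (q - inverse q) * idem_e d i * gen_g i)) f s = 0" for i
  proof -
    define \<tau> where "\<tau> = swap_state i"
    have G: "letter_op d q (Gen_G i) f s = hop d (s i) (s (Suc i)) * f (\<tau> s) + stay d q (s i) (s (Suc i)) * f s" for f s
      by (simp add: letter_op_G \<tau>_def del: letter_op.simps)
    have ev: "\<tau> s i = s (Suc i)" "\<tau> s (Suc i) = s i" "\<tau> (\<tau> s) = s" for s
      using swap_swap[of s i] by (auto simp: \<tau>_def Transposition.transpose_def)
    have "letter_op d q (Gen_G i) (letter_op d q (Gen_G i) f) s = f s + (q - inverse q) *
        (if colour d (s i) = colour d (s (Suc i)) then letter_op d q (Gen_G i) f s else 0)"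
      unfolding G ev using assms(3)
      by (cases "snd (s i)" "snd (s (Suc i))" rule: linorder_cases) (simp_all add: hop_def stay_def field_simps)
    then show ?thesis
      using assms by (simp add: rep_diff rep_add rep_mult rep_idem_e power2_eq_square del: letter_op.simps)
  qed
  show ?thesis
    using assms(1) braid gg tt tg td g2 unfolding yh_relators_def by blast
qed

definition labels :: "nat \<Rightarrow> nat \<Rightarrow> (nat \<times> nat) set" where
  "labels d N = {..<d} \<times> {..<N}"

definition states :: "nat \<Rightarrow> nat \<Rightarrow> nat \<Rightarrow> state set" where
  "states d N n = {1..n} \<rightarrow>\<^sub>E labels d N"

text \<open>
  The diagonal operator of the quantum trace.  Interchanging two labels preserves it, which makes the
  weighted trace cyclic, and the geometric progression in the height makes the partial trace of
  \<open>g_n\<close> over the last strand a multiple of the identity.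
\<close>

definition weight :: "complex \<Rightarrow> nat \<Rightarrow> state \<Rightarrow> complex" where
  "weight q n s = (\<Prod>j = 1..n. q ^ (2 * snd (s j)))"

definition basis_state :: "state \<Rightarrow> state \<Rightarrow> complex" where
  "basis_state t s = (if s = t then 1 else 0)"

definition qtrace :: "nat \<Rightarrow> complex \<Rightarrow> nat \<Rightarrow> nat \<Rightarrow> free_algebra \<Rightarrow> complex" where
  "qtrace d q N n a = (\<Sum>s\<in>states d N n. weight q n s * rep d q a (basis_state s) s)"

lemma finite_states [simp]: "finite (states d N n)"
  by (auto simp: states_def labels_def intro!: finite_PiE)

lemma swap_states:
  assumes "s \<in> states d N n" "1 \<le> i" "i < n"
  shows "swap_state i s \<in> states d N n" and "weight q n (swap_state i s) = weight q n s"
proof -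
  have p: "Transposition.transpose i (i + 1) ` {1..n} = {1..n}"
    using assms(2,3) by (auto simp: Transposition.transpose_def image_def) 
  show "swap_state i s \<in> states d N n"
    using assms unfolding states_def
    by (auto simp: PiE_iff extensional_def Transposition.transpose_def)
  have "weight q n (swap_state i s) = (\<Prod>j\<in>{1..n}. q ^ (2 * snd (s (Transposition.transpose i (i + 1) j))))"
    by (simp add: weight_def)
  also have "\<dots> = (\<Prod>j\<in>Transposition.transpose i (i + 1) ` {1..n}. q ^ (2 * snd (s j)))"
    by (subst prod.reindex) (auto intro: inj_on_subset[OF inj_transpose])
  finally show "weight q n (swap_state i s) = weight q n s"
    unfolding p by (simp add: weight_def)
qed

lemma sum_basis_state:
  "s \<in> states d N n \<Longrightarrow> (\<Sum>t\<in>states d N n. f t * basis_state t s) = f s"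
  "s \<in> states d N n \<Longrightarrow> (\<Sum>t\<in>states d N n. f t * basis_state s t) = f s"
  by (simp_all add: basis_state_def if_distrib sum.delta cong: if_cong)

text \<open>
  Elements on \<open>n\<close> strands preserve the functions on the finite set of states, so there they act by
  a matrix whose entries are the values on basis states.
\<close>

lemma rep_expand:
  assumes "a \<in> subalg (gens n)" "s \<in> states d N n"
  shows "rep d q a f s = (\<Sum>t\<in>states d N n. f t * rep d q a (basis_state t) s)"
  using assms
proof (induction arbitrary: f s rule: subalg_induct)
  case (scalar c)
  then show ?case by (simp add: mult.left_commute[of _ c] sum_distrib_left[symmetric] sum_basis_state)
next
  case (letter x)
  then consider i where "x = Gen_G i" "1 \<le> i" "i < n" | j where "x = Gen_T j"
    by (auto simp: gens_def)
  then show ?case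
  proof cases
    case 1
    then show ?thesis
      using letter sum_basis_state(1)[of _ d N n f] swap_states(1)[of s d N n i]
      by (simp add: sum.distrib distrib_left mult.left_commute[of _ "q - inverse q"] mult.left_commute[of _ q]
          sum_distrib_left[symmetric] del: o_apply)
  next
    case 2
    then show ?thesis
      using letter by (simp add: mult.left_commute[of _ "colour _ _"] sum_distrib_left[symmetric] sum_basis_state)
  qed
next
  case (add a b)
  then show ?case by (simp add: rep_add sum.distrib distrib_left)
next
  case (mult a b)
  let ?S = "states d N n"
  have "rep d q (a * b) f s = (\<Sum>t\<in>?S. rep d q b f t * rep d q a (basis_state t) s)"
    unfolding rep_mult by (rule mult.IH) fact
  also have "\<dots> = (\<Sum>t\<in>?S. \<Sum>u\<in>?S. f u * (rep d q b (basis_state u) t * rep d q a (basis_state t) s))"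
    by (rule sum.cong[OF HOL.refl], subst mult.IH(2), assumption) (simp add: sum_distrib_right mult.assoc)
  also have "\<dots> = (\<Sum>u\<in>?S. f u * (\<Sum>t\<in>?S. rep d q b (basis_state u) t * rep d q a (basis_state t) s))"
    by (subst sum.swap) (simp add: sum_distrib_left)
  also have "\<dots> = (\<Sum>u\<in>?S. f u * rep d q (a * b) (basis_state u) s)"
    unfolding rep_mult by (intro sum.cong HOL.refl) (subst (2) mult.IH(1)[OF mult.prems], simp)
  finally show ?case .
qed

lemma rep_mult_entry:
  assumes "a \<in> subalg (gens n)" "s \<in> states d N n"
  shows "rep d q (a * b) f s = (\<Sum>t\<in>states d N n. rep d q b f t * rep d q a (basis_state t) s)"
  unfolding rep_mult using assms by (rule rep_expand)

lemma rep_weight: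
  assumes "a \<in> subalg (gens n)" "s \<in> states d N n" "t \<in> states d N n"
  shows "weight q n s * rep d q a (basis_state t) s = weight q n t * rep d q a (basis_state t) s"
  using assms
proof (induction arbitrary: s t rule: subalg_induct)
  case (scalar c)
  then show ?case by (simp add: basis_state_def)
next
  case (letter x)
  then consider i where "x = Gen_G i" "1 \<le> i" "i < n" | j where "x = Gen_T j"
    by (auto simp: gens_def)
  then show ?case
  proof cases
    case 1
    then have "weight q n s = weight q n t \<or> (s \<noteq> t \<and> swap_state i s \<noteq> t)"
      using swap_states(2)[OF letter(2), of i q] by auto
    then show ?thesis using 1 by (auto simp: basis_state_def simp del: o_apply)
  next
    case 2
    then show ?thesis by (auto simp: basis_state_def)
  qed
next
  case (add a b)
  show ?case by (simp only: rep_add distrib_left add.IH[OF add.prems])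
next
  case (mult a b)
  let ?S = "states d N n"
  have "weight q n s * rep d q (a * b) (basis_state t) s =
      (\<Sum>u\<in>?S. rep d q b (basis_state t) u * (weight q n s * rep d q a (basis_state u) s))"
    using mult by (simp add: rep_mult_entry sum_distrib_left mult_ac)
  also have "\<dots> = (\<Sum>u\<in>?S. (weight q n u * rep d q b (basis_state t) u) * rep d q a (basis_state u) s)"
  proof (rule sum.cong[OF HOL.refl])
    fix u assume u: "u \<in> ?S"
    show "rep d q b (basis_state t) u * (weight q n s * rep d q a (basis_state u) s) =
        (weight q n u * rep d q b (basis_state t) u) * rep d q a (basis_state u) s"
      unfolding mult.IH(1)[OF mult.prems(1) u] by (simp add: mult_ac)
  qed
  also have "\<dots> = (\<Sum>u\<in>?S. (weight q n t * rep d q b (basis_state t) u) * rep d q a (basis_state u) s)"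
    by (rule sum.cong[OF HOL.refl]) (simp only: mult.IH(2)[OF _ mult.prems(2)])
  also have "\<dots> = weight q n t * rep d q (a * b) (basis_state t) s"
    using mult by (simp add: rep_mult_entry sum_distrib_left mult_ac)
  finally show ?case .
qed

lemma qtrace_cyclic:
  assumes "a \<in> subalg (gens n)" "b \<in> subalg (gens n)"
  shows "qtrace d q N n (a * b) = qtrace d q N n (b * a)"
proof -
  let ?S = "states d N n" and ?r = "\<lambda>a t s. rep d q a (basis_state t) s"
  have "qtrace d q N n (a * b) = (\<Sum>s\<in>?S. \<Sum>t\<in>?S. ?r b s t * (weight q n s * ?r a t s))"
    unfolding qtrace_def using assms by (simp add: rep_mult_entry sum_distrib_left mult_ac)
  also have "\<dots> = (\<Sum>s\<in>?S. \<Sum>t\<in>?S. ?r b s t * (weight q n t * ?r a t s))"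
    by (intro sum.cong[OF HOL.refl]) (subst rep_weight[OF assms(1)], simp_all)
  also have "\<dots> = (\<Sum>t\<in>?S. \<Sum>s\<in>?S. weight q n t * (?r a t s * ?r b s t))"
    by (subst sum.swap) (simp add: mult_ac)
  also have "\<dots> = qtrace d q N n (b * a)"
    unfolding qtrace_def using assms by (simp add: rep_mult_entry sum_distrib_left mult_ac)
  finally show ?thesis .
qed

lemma rep_extend:
  assumes "a \<in> subalg (gens n)"
  shows "rep d q a f (s(n + 1 := l)) = rep d q a (\<lambda>s. f (s(n + 1 := l))) s"
  using assms
proof (induction arbitrary: f s rule: subalg_induct)
  case (letter x)
  then consider i where "x = Gen_G i" "1 \<le> i" "i < n" | j where "x = Gen_T j" "1 \<le> j" "j \<le> n"
    by (auto simp: gens_def)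
  then show ?case
  proof cases
    case 1
    then have "swap_state i (s(n + 1 := l)) = (swap_state i s)(n + 1 := l)"
      by (auto simp: fun_eq_iff Transposition.transpose_def)
    moreover have "(s(n + 1 := l)) i = s i" "(s(n + 1 := l)) (i + 1) = s (i + 1)" using 1 by auto
    ultimately show ?thesis by (simp only: 1(1) rep_letter letter_op_G)
  qed auto
qed (simp_all add: rep_add rep_mult)

lemma sum_states_Suc:
  "(\<Sum>s\<in>states d N (n + 1). g s) = (\<Sum>s\<in>states d N n. \<Sum>l\<in>labels d N. g (s(n + 1 := l)))"
proof -
  let ?f = "\<lambda>(l, s). (s :: state)(n + 1 := l)"
  have "states d N (n + 1) = ?f ` (labels d N \<times> states d N n)"
    unfolding states_def using PiE_insert_eq[of "n + 1" "{1..n}" "\<lambda>_. labels d N"]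
    by (simp add: atLeastAtMostSuc_conv)
  moreover have "inj_on ?f (labels d N \<times> states d N n)"
    unfolding states_def using inj_combinator[of "n + 1" "{1..n}" "\<lambda>_. labels d N"] by simp
  ultimately have "(\<Sum>s\<in>states d N (n + 1). g s) = (\<Sum>(l, s)\<in>labels d N \<times> states d N n. g (s(n + 1 := l)))"
    by (simp add: sum.reindex case_prod_unfold)
  also have "\<dots> = (\<Sum>l\<in>labels d N. \<Sum>s\<in>states d N n. g (s(n + 1 := l)))"
    by (simp add: sum.cartesian_product)
  finally show ?thesis by (subst sum.swap) simp
qed

lemma weight_Suc: "weight q (n + 1) (s(n + 1 := l)) = weight q n s * q ^ (2 * snd l)"
proof -
  have "(\<Prod>j = 1..n. q ^ (2 * snd ((s(n + 1 := l)) j))) = weight q n s"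
    unfolding weight_def by (intro prod.cong) auto
  then show ?thesis unfolding weight_def by simp
qed

lemma states_basis_Suc:
  assumes "s \<in> states d N n" "t \<in> states d N n"
  shows "basis_state (s(n + 1 := l)) (t(n + 1 := m)) = (if l = m then basis_state s t else 0)"
proof -
  have "s = t" if "s(n + 1 := l) = t(n + 1 := l)"
  proof
    fix j
    have "s (n + 1) = undefined" "t (n + 1) = undefined"
      using assms unfolding states_def by (auto simp: PiE_iff extensional_def)
    then show "s j = t j" using fun_cong[OF that, of j] by (cases "j = n + 1") auto
  qed
  moreover have "m = l" if "t(n + 1 := m) = s(n + 1 := l)"
    using fun_cong[OF that, of "n + 1"] by simp
  ultimately show ?thesis
    by (cases "l = m") (auto simp: basis_state_def)
qed

text \<open>
  The partial trace over the last strand.  Only the entries of \<open>b\<close> that preserve the last label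
  contribute, and if their weighted sum is a constant it factors out of the trace.
\<close>

lemma qtrace_Suc_diagonal:
  assumes "a \<in> subalg (gens n)" "b \<in> subalg (gens (n + 1))"
    and diag: "\<And>s t l. s \<in> states d N n \<Longrightarrow> t \<in> states d N n \<Longrightarrow> l \<in> labels d N \<Longrightarrow>
      rep d q b (basis_state (s(n + 1 := l))) (t(n + 1 := l)) = \<beta> s l * basis_state s t"
    and r: "\<And>s. s \<in> states d N n \<Longrightarrow> (\<Sum>l\<in>labels d N. q ^ (2 * snd l) * \<beta> s l) = r"
  shows "qtrace d q N (n + 1) (a * b) = r * qtrace d q N n a"
proof -
  let ?S = "states d N n" and ?L = "labels d N"
  have entry: "rep d q (a * b) (basis_state (s(n + 1 := l))) (s(n + 1 := l)) = \<beta> s l * rep d q a (basis_state s) s"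
    if "s \<in> ?S" "l \<in> ?L" for s l
  proof -
    have "rep d q (a * b) (basis_state (s(n + 1 := l))) (s(n + 1 := l)) =
      (\<Sum>t\<in>?S. rep d q b (basis_state (s(n + 1 := l))) (t(n + 1 := l)) * rep d q a (basis_state t) s)"
      unfolding rep_mult rep_extend[OF assms(1)] by (rule rep_expand[OF assms(1) that(1)])
    also have "\<dots> = (\<Sum>t\<in>?S. (\<beta> s l * rep d q a (basis_state t) s) * basis_state s t)"
      by (rule sum.cong[OF HOL.refl]) (simp only: diag[OF that(1) _ that(2)] mult_ac)
    also have "\<dots> = \<beta> s l * rep d q a (basis_state s) s"
      using that(1) by (rule sum_basis_state(2))
    finally show ?thesis .
  qed
  have "qtrace d q N (n + 1) (a * b) =
    (\<Sum>s\<in>?S. \<Sum>l\<in>?L. weight q n s * rep d q a (basis_state s) s * (q ^ (2 * snd l) * \<beta> s l))"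
    unfolding qtrace_def sum_states_Suc weight_Suc by (intro sum.cong HOL.refl) (simp only: entry mult_ac)
  also have "\<dots> = (\<Sum>s\<in>?S. weight q n s * rep d q a (basis_state s) s * r)"
    by (intro sum.cong HOL.refl) (simp add: sum_distrib_left[symmetric] r)
  finally show ?thesis by (simp add: qtrace_def sum_distrib_left mult_ac)
qed

lemma sum_labels: "(\<Sum>l\<in>labels d N. g l) = (\<Sum>c<d. \<Sum>k<N. g (c, k))"
  by (simp add: labels_def sum.cartesian_product)

definition label_sum :: "nat \<Rightarrow> complex \<Rightarrow> nat \<Rightarrow> complex" where
  "label_sum d q N = of_nat d * (\<Sum>k<N. q ^ (2 * k))"

lemma qtrace_Suc:
  assumes "a \<in> subalg (gens n)"
  shows "qtrace d q N (n + 1) a = label_sum d q N * qtrace d q N n a"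
proof -
  have "qtrace d q N (n + 1) (a * 1) = label_sum d q N * qtrace d q N n a"
  proof (rule qtrace_Suc_diagonal[where \<beta> = "\<lambda>_ _. 1"])
    show "(\<Sum>l\<in>labels d N. q ^ (2 * snd l) * 1) = label_sum d q N"
      by (simp add: sum_labels label_sum_def)
  qed (use assms in \<open>auto simp: states_basis_Suc[simplified]\<close>)
  then show ?thesis by simp
qed

lemma colour_inj: "colour d l = colour d m \<Longrightarrow> fst l < d \<Longrightarrow> fst m < d \<Longrightarrow> fst l = fst m"
  using bij_betw_roots_unity[of d] unfolding bij_betw_def inj_on_def colour_def by auto

lemma qtrace_t:
  assumes "a \<in> subalg (gens n)" "1 \<le> k" "k \<le> d - 1"
  shows "qtrace d q N (n + 1) (a * gen_t (n + 1) ^ k) = 0"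
proof -
  let ?\<omega> = "cis (2 * pi * real k / real d)"
  have d: "d > 1" and kd: "k < d" using assms by linarith+
  have "?\<omega> \<noteq> 1"
    using colour_inj[of d "(k, 0)" "(0, 0)"] assms d kd by (auto simp: colour_def)
  moreover have "?\<omega> ^ d = 1"
    using colour_power_d[of d "(k, 0)"] d by (simp add: colour_def)
  ultimately have z: "(\<Sum>c<d. ?\<omega> ^ c) = 0"
    using geometric_sum[of ?\<omega> d] by simp
  have pow: "colour d l ^ k = ?\<omega> ^ fst l" for l
    by (simp add: colour_def DeMoivre mult_ac)
  have "qtrace d q N (n + 1) (a * gen_t (n + 1) ^ k) = 0 * qtrace d q N n a"
  proof (rule qtrace_Suc_diagonal[where \<beta> = "\<lambda>_ l. colour d l ^ k"])
    show "(\<Sum>l\<in>labels d N. q ^ (2 * snd l) * colour d l ^ k) = 0"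
      unfolding pow sum_labels
      by (simp add: sum_distrib_right[symmetric] sum_distrib_left[symmetric] z)
  qed (use assms in \<open>auto simp: states_basis_Suc[simplified] intro!: subalg_power subalg_gen_t\<close>)
  then show ?thesis by simp
qed

text \<open>
  The weighted sum over the last label telescopes to a value that does not depend on the label of
  strand \<open>n\<close>; this is the Markov property.
\<close>

lemma qtrace_g:
  assumes "a \<in> subalg (gens n)" "1 \<le> n" "q \<noteq> 0"
  shows "qtrace d q N (n + 1) (a * gen_g n) = q ^ (2 * N - 1) * qtrace d q N n a"
proof -
  define \<beta> where "\<beta> s l = (if fst (s n) = fst l then
      if snd (s n) = snd l then q else if snd (s n) < snd l then q - inverse q else 0 else 0)"
    for s :: state and l
  show ?thesis
  proof (rule qtrace_Suc_diagonal[where \<beta> = \<beta>])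
    fix s assume "s \<in> states d N n"
    then have sn: "s n \<in> labels d N" using assms(2) by (auto simp: states_def)
    obtain c k where ck: "s n = (c, k)" "c < d" "k < N" using sn by (cases "s n") (auto simp: labels_def)
    have "(\<Sum>l\<in>labels d N. q ^ (2 * snd l) * \<beta> s l) =
      (\<Sum>c'<d. \<Sum>k'<N. if c = c' then q ^ (2 * k') * (if k = k' then q else if k < k' then q - inverse q else 0) else 0)"
      unfolding sum_labels by (rule sum.cong[OF HOL.refl], rule sum.cong[OF HOL.refl]) (simp add: \<beta>_def ck)
    also have "\<dots> = (\<Sum>k'<N. q ^ (2 * k') * (if k = k' then q else if k < k' then q - inverse q else 0))"
      using ck by (subst sum.swap) simp
    also have "\<dots> = q ^ (2 * N - 1)"
      using ck(3)
    proof (induction N)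
      case (Suc N)
      show ?case
      proof (cases "k = N")
        case True
        then have "(\<Sum>k'<N. q ^ (2 * k') * (if k = k' then q else if k < k' then q - inverse q else 0)) = 0"
          by (intro sum.neutral) auto
        then show ?thesis using True by simp
      next
        case False
        then have "k < N" using Suc.prems by simp
        then obtain M where M: "N = Suc M" by (cases N) auto
        show ?thesis using Suc.IH[OF \<open>k < N\<close>] \<open>k < N\<close> assms(3) by (simp add: M field_simps)
      qed
    qed simp
    finally show "(\<Sum>l\<in>labels d N. q ^ (2 * snd l) * \<beta> s l) = q ^ (2 * N - 1)" .
  next
    fix s t l assume st: "s \<in> states d N n" "t \<in> states d N n" and l: "l \<in> labels d N"
    have tn: "t n \<in> labels d N" using st assms(2) by (auto simp: states_def)
    let ?s = "s(n + 1 := l)" and ?t = "t(n + 1 := l)"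
    have col: "colour d (t n) = colour d l \<longleftrightarrow> fst (t n) = fst l"
      using tn l colour_inj[of d "t n" l] by (auto simp: labels_def colour_def)
    have sw: "basis_state ?s (swap_state n ?t) = 0" if "t n \<noteq> l"
    proof -
      have "swap_state n ?t (n + 1) \<noteq> ?s (n + 1)"
        using that by (simp add: Transposition.transpose_def)
      then have "swap_state n ?t \<noteq> ?s" by metis
      then show ?thesis by (simp add: basis_state_def)
    qed
    have b: "basis_state ?s ?t = basis_state s t" using states_basis_Suc[OF st] by simp
    have nz: "basis_state s t \<noteq> 0 \<Longrightarrow> t = s" by (simp add: basis_state_def split: if_splits)
    have "letter_op d q (Gen_G n) (basis_state ?s) ?t = \<beta> t l * basis_state s t"
      using sw assms(2) unfolding \<beta>_def by (auto simp: col b[simplified] prod_eq_iff simp del: o_apply)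
    then show "rep d q (gen_g n) (basis_state ?s) ?t = \<beta> s l * basis_state s t"
      using nz by (cases "basis_state s t = 0") (simp_all del: letter_op.simps)
  qed (use assms in auto)
qed

text \<open>
  Adding a strand multiplies the trace by \<open>label_sum\<close>, so the quotient does not depend on the number
  of strands; the least possible number serves as a representative.
\<close>

definition qtrace_normalized :: "nat \<Rightarrow> complex \<Rightarrow> nat \<Rightarrow> free_algebra \<Rightarrow> complex" where
  "qtrace_normalized d q N a =
    (let n = LEAST n. a \<in> subalg (gens n) in qtrace d q N n a / label_sum d q N ^ n)"

lemma qtrace_normalized_eq:
  assumes "a \<in> subalg (gens n)" "label_sum d q N \<noteq> 0"
  shows "qtrace_normalized d q N a = qtrace d q N n a / label_sum d q N ^ n"
proof -
  define m where "m = (LEAST n. a \<in> subalg (gens n))"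
  have m: "a \<in> subalg (gens m)" unfolding m_def using assms(1) by (rule LeastI)
  have "m \<le> n" unfolding m_def using assms(1) by (rule Least_le)
  then have "qtrace d q N n a / label_sum d q N ^ n = qtrace d q N m a / label_sum d q N ^ m"
  proof (induction n rule: dec_induct)
    case (step k)
    have "a \<in> subalg (gens k)" using m step(1) subalg_mono[OF gens_mono] by blast
    then show ?case using qtrace_Suc[of a k d q N] step assms(2) by simp
  qed simp
  then show ?thesis by (simp add: qtrace_normalized_def m_def[symmetric])
qed

lemma subalg_gens_mono: "a \<in> subalg (gens m) \<Longrightarrow> m \<le> n \<Longrightarrow> a \<in> subalg (gens n)"
  using subalg_mono[OF gens_mono] by blast

lemma falg_common:
  assumes "finite A" "A \<subseteq> falg"
  shows "\<exists>n. A \<subseteq> subalg (gens n)"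
  using assms
proof (induction rule: finite_induct)
  case (insert a A)
  then obtain m n where "A \<subseteq> subalg (gens m)" "a \<in> subalg (gens n)" using falg_ex by blast
  then have "insert a A \<subseteq> subalg (gens (max m n))"
    using subalg_gens_mono[of _ m "max m n"] subalg_gens_mono[of a n "max m n"] by auto
  then show ?case by blast
qed auto

theorem markov_functional_qtrace:
  assumes "1 \<le> d" "q \<noteq> 0" "label_sum d q N \<noteq> 0"
  shows "markov_functional d q (q ^ (2 * N - 1) / label_sum d q N) (qtrace_normalized d q N)"
proof
  let ?F = "qtrace_normalized d q N"
  note eq = qtrace_normalized_eq[OF _ assms(3)]
  show "?F (a + b) = ?F a + ?F b" if ab: "a \<in> falg" "b \<in> falg" for a b
  proof -
    obtain n where n: "a \<in> subalg (gens n)" "b \<in> subalg (gens n)"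
      using falg_common[of "{a, b}"] ab by auto
    show ?thesis using n
      by (simp add: eq[OF n(1)] eq[OF n(2)] eq[OF subalg_add[OF n]] qtrace_def rep_add sum.distrib distrib_left add_divide_distrib)
  qed
  show "?F (scalar c * a) = c * ?F a" if a: "a \<in> falg" for a c
  proof -
    obtain n where n: "a \<in> subalg (gens n)" using falg_ex a by auto
    show ?thesis
      by (simp add: eq[OF n] eq[OF subalg_mult[OF subalg_scalar n]] qtrace_def rep_mult sum_distrib_left mult_ac)
  qed
  show "?F (a * r * b) = 0" if r: "r \<in> yh_relators d q n" and ab: "a \<in> falg" "b \<in> falg" for a b r n
  proof -
    have "r \<in> falg" using r yh_relators_subalg[of d q n] subalg_gens_falg by blast
    then obtain m where m: "a * r * b \<in> subalg (gens m)" using falg_ex[of "a * r * b"] ab by auto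
    have "rep d q r f = (\<lambda>_. 0)" for f using rep_relator[OF r assms(1,2)] by (simp add: fun_eq_iff)
    then show ?thesis by (simp add: eq[OF m] qtrace_def rep_mult)
  qed
  show "?F (a * b) = ?F (b * a)" if ab: "a \<in> falg" "b \<in> falg" for a b
  proof -
    obtain n where n: "a \<in> subalg (gens n)" "b \<in> subalg (gens n)"
      using falg_common[of "{a, b}"] ab by auto
    show ?thesis using n
      by (simp add: eq[OF subalg_mult[OF n]] eq[OF subalg_mult[OF n(2,1)]] qtrace_cyclic)
  qed
  have "states d N 0 = {\<lambda>_. undefined}" by (simp add: states_def)
  then show "?F 1 = 1"
    by (simp add: eq[OF subalg_1, of 0] qtrace_def weight_def basis_state_def)
  show "?F (a * gen_g n) = q ^ (2 * N - 1) / label_sum d q N * ?F a"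
    if n: "1 \<le> n" and a: "a \<in> subalg (gens n)" for n a
  proof -
    have "a * gen_g n \<in> subalg (gens (n + 1))"
      using n a by (intro subalg_mult subalg_gen_g subalg_gens_mono[OF a]) auto
    then show ?thesis using eq[of "a * gen_g n" "n + 1"] eq[OF a] qtrace_g[OF a n assms(2), of d N] by simp
  qed
  show "?F (a * gen_t (n + 1) ^ k) = 0" if a: "a \<in> subalg (gens n)" and k: "1 \<le> k" "k \<le> d - 1" for n a k
  proof -
    have "a * gen_t (n + 1) ^ k \<in> subalg (gens (n + 1))"
      by (intro subalg_mult subalg_power subalg_gen_t subalg_gens_mono[OF a]) auto
    then show ?thesis using eq[of "a * gen_t (n + 1) ^ k" "n + 1"] qtrace_t[OF a k, of q N] by simp
  qed
qed (use assms in auto)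

section \<open>The universal evaluation polynomial\<close>

text \<open>
  The value of the trace variable that is realised by the state model with \<open>N\<close> heights.
\<close>

definition qtrace_z :: "nat \<Rightarrow> real \<Rightarrow> nat \<Rightarrow> complex" where
  "qtrace_z d x N = of_real x ^ (2 * N - 1) / label_sum d (of_real x) N"

lemma label_sum_pos:
  assumes "1 \<le> d" "x > 0" "N \<ge> 1"
  shows "label_sum d (of_real x) N \<noteq> 0"
proof -
  have "(\<Sum>k<N. x ^ (2 * k)) > 0"
    using assms by (intro sum_pos) (auto simp: lessThan_empty_iff)
  moreover have "label_sum d (of_real x) N = of_real (real d * (\<Sum>k<N. x ^ (2 * k)))"
    by (simp add: label_sum_def)
  ultimately show ?thesis using assms by (metis less_irrefl mult_eq_0_iff of_nat_0_less_iff of_real_eq_0_iff less_le_trans zero_less_one)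
qed

text \<open>
  The reciprocals of the values, divided by \<open>d\<close>, are the partial sums of the series of the odd
  negative powers of \<open>x\<close>, and therefore strictly increasing in the number of heights.
\<close>

lemma infinite_range_qtrace_z:
  assumes "1 \<le> d" "x > 0"
  shows "infinite (range (\<lambda>N. qtrace_z d x (Suc N)))"
proof -
  \<comment> \<open>up to the factor \<open>d\<close>, the reciprocal of the value for \<open>Suc N\<close> heights\<close>
  define w where "w N = (\<Sum>k<Suc N. x ^ (2 * k)) / x ^ (2 * N + 1)" for N
  have w_Suc: "w (Suc N) = w N + 1 / x ^ (2 * N + 3)" for N
  proof -
    have "(\<Sum>k<Suc (Suc N). x ^ (2 * k)) = 1 + x ^ 2 * (\<Sum>k<Suc N. x ^ (2 * k))"
      by (subst sum.lessThan_Suc_shift)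
        (simp add: sum_distrib_left power_add[symmetric] del: sum.lessThan_Suc)
    moreover have "x ^ (2 * Suc N + 1) = x ^ 2 * x ^ (2 * N + 1)" "x ^ (2 * N + 3) = x ^ 2 * x ^ (2 * N + 1)"
      by (simp_all add: eval_nat_numeral)
    ultimately show ?thesis
      using assms(2) unfolding w_def by (simp add: field_simps del: sum.lessThan_Suc power_Suc)
  qed
  have "strict_mono w"
    using assms(2) by (simp add: strict_mono_Suc_iff w_Suc)
  then have "inj w" by (rule strict_mono_imp_inj_on)
  have "inverse (qtrace_z d x (Suc N)) = of_real (real d * w N)" for N
    by (simp add: qtrace_z_def w_def label_sum_def)
  then have "inj (\<lambda>N. qtrace_z d x (Suc N))"
    using \<open>inj w\<close> assms(1) unfolding inj_def
    by (metis mult_cancel_left of_nat_0_less_iff of_real_eq_iff less_irrefl less_le_trans zero_less_one)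
  then show ?thesis by (rule range_inj_infinite)
qed

text \<open>
  The state models provide a Markov functional for infinitely many \<open>z\<close> over each of infinitely many
  \<open>q\<close>, which leaves no room for two different polynomials in \<open>q - inverse q\<close> and \<open>z\<close>.
\<close>

lemma universal_poly_unique:
  fixes P Q :: "complex poly poly"
  assumes d: "1 \<le> d"
    and eq: "\<And>q z F. markov_functional d q z F \<Longrightarrow>
      poly (poly P [:q - inverse q:]) z = poly (poly Q [:q - inverse q:]) z"
  shows "P = Q"
proof -
  define h :: "real \<Rightarrow> complex poly" where "h x = [:of_real x - inverse (of_real x):]" for x
  have root: "poly (P - Q) (h x) = 0" if "x > 1" for x
  proof (rule ccontr)
    assume nz: "poly (P - Q) (h x) \<noteq> 0"
    have "poly (poly (P - Q) (h x)) (qtrace_z d x (Suc N)) = 0" for N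
      using eq[OF markov_functional_qtrace[OF d _ label_sum_pos[OF d, of x "Suc N"]]] that
      by (simp add: h_def qtrace_z_def)
    then have "range (\<lambda>N. qtrace_z d x (Suc N)) \<subseteq> {z. poly (poly (P - Q) (h x)) z = 0}" by auto
    then show False
      using poly_roots_finite[OF nz] infinite_range_qtrace_z[OF d, of x] that by (auto dest: finite_subset)
  qed
  have "inj_on h {1<..}"
  proof (rule inj_onI)
    fix x y :: real assume xy: "x \<in> {1<..}" "y \<in> {1<..}" "h x = h y"
    then have "complex_of_real (x - inverse x) = complex_of_real (y - inverse y)" by (simp add: h_def)
    then have "x - inverse x = y - inverse y" by (simp only: of_real_eq_iff)
    moreover have "(x - y) * (1 + x * y) = x * y * ((x - inverse x) - (y - inverse y))"
      using xy by (simp add: field_simps)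
    ultimately have "(x - y) * (1 + x * y) = 0" by simp
    moreover have "1 + x * y > 0" using xy by (simp add: add_pos_pos)
    ultimately show "x = y" by simp
  qed
  then have "infinite (h ` {1<..})"
    using infinite_Ioi[of "1::real"] by (simp add: finite_image_iff)
  moreover have "h ` {1<..} \<subseteq> {c. poly (P - Q) c = 0}" using root by auto
  ultimately show ?thesis using poly_roots_finite[of "P - Q"] by (auto dest: finite_subset)
qed

definition universal_poly :: "nat \<Rightarrow> free_algebra \<Rightarrow> complex poly poly" where
  "universal_poly d a = (SOME P. \<forall>q z F. markov_functional d q z F \<longrightarrow>
     F a = poly (poly P [:q - inverse q:]) z)"

lemma universal_poly:
  assumes "a \<in> falg" "markov_functional d q z F"
  shows "F a = poly (poly (universal_poly d a) [:q - inverse q:]) z"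
proof -
  obtain n where "a \<in> subalg (gens n)" using falg_ex[OF assms(1)] by blast
  from q_family_determined[OF q_family_const[OF this], of d]
  have "\<exists>P. \<forall>q z F. markov_functional d q z F \<longrightarrow> F a = poly (poly P [:q - inverse q:]) z"
    unfolding determined_def .
  from someI_ex[OF this] show ?thesis using assms(2) unfolding universal_poly_def by blast
qed

text \<open>
  Evaluation of the universal polynomial makes sense for every \<open>q\<close>, also for roots of unity other
  than 1 and -1, for which the state models realise only finitely many values of \<open>z\<close>.
\<close>

definition trace_poly :: "nat \<Rightarrow> complex \<Rightarrow> free_algebra \<Rightarrow> complex poly" where
  "trace_poly d q a = poly (universal_poly d a) [:q - inverse q:]"

lemma subalg_times_g: "1 \<le> n \<Longrightarrow> a \<in> subalg (gens n) \<Longrightarrow> a * gen_g n \<in> subalg (gens (n + 1))"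
  and subalg_times_t: "a \<in> subalg (gens n) \<Longrightarrow> a * gen_t (n + 1) ^ k \<in> subalg (gens (n + 1))"
  by (auto intro!: subalg_mult subalg_power subalg_gen_g subalg_gen_t intro: subalg_gens_mono)

lemma scalar_left_commute: "a * (scalar c * b) = scalar c * (a * b)"
  by (metis scalar_central mult.assoc)

lemma yh_relators_mono:
  assumes "m \<le> n"
  shows "yh_relators d q m \<subseteq> yh_relators d q n"
proof -
  have "{1..<m} \<subseteq> {1..<n}" "{1..m} \<subseteq> {1..n}" using assms by auto
  then show ?thesis unfolding yh_relators_def by (intro Un_mono; blast)
qed

text \<open>
  The quadratic relators are the only ones that vary with \<open>q\<close>.
\<close>

lemma yh_relators_cases:
  assumes "r \<in> yh_relators d q n"
  shows "(\<forall>q'. r \<in> yh_relators d q' n) \<or>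
    (\<exists>i\<in>{1..<n}. r = gen_g i ^ 2 - (1 + scalar (q - inverse q) * idem_e d i * gen_g i))"
proof (cases "r \<in> {gen_g i ^ 2 - (1 + scalar (q - inverse q) * idem_e d i * gen_g i) | i. i \<in> {1..<n}}")
  case False
  then show ?thesis using assms unfolding yh_relators_def Un_iff by meson
qed blast

text \<open>
  Each axiom is a polynomial identity between universal polynomials.  It holds because it holds for
  every Markov functional and the universal polynomial is unique; then it can be specialised to any
  given \<open>q\<close> and \<open>z\<close>.
\<close>

theorem markov_functional_trace_poly:
  assumes d: "1 \<le> d" and q: "q \<noteq> 0"
  shows "markov_functional d q z (\<lambda>a. poly (trace_poly d q a) z)"
proof
  note uniq = universal_poly_unique[OF d]
  note univ = universal_poly[symmetric]
  have add: "universal_poly d (a + b) = universal_poly d a + universal_poly d b" if "a \<in> falg" "b \<in> falg" for a b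
    by (rule uniq) (simp add: univ that markov_functional.F_add)
  have scal: "universal_poly d (scalar c * a) = [:[:c:]:] * universal_poly d a" if "a \<in> falg" for a c
    by (rule uniq) (simp add: univ that markov_functional.F_scalar)
  show "poly (trace_poly d q (a + b)) z = poly (trace_poly d q a) z + poly (trace_poly d q b) z"
    if "a \<in> falg" "b \<in> falg" for a b
    using add[OF that] by (simp add: trace_poly_def)
  show "poly (trace_poly d q (scalar c * a)) z = c * poly (trace_poly d q a) z" if "a \<in> falg" for a c
    using scal[OF that] by (simp add: trace_poly_def)
  show "poly (trace_poly d q (a * r * b)) z = 0" if r: "r \<in> yh_relators d q n" and ab: "a \<in> falg" "b \<in> falg" for a b r n
    using yh_relators_cases[OF r]
  proof
    assume const: "\<forall>q'. r \<in> yh_relators d q' n"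
    have "r \<in> falg" using r yh_relators_subalg[of d q n] subalg_gens_falg by blast
    then have "universal_poly d (a * r * b) = 0"
      using ab const markov_functional.F_relator by (intro uniq) (simp add: univ, blast)
    then show ?thesis by (simp add: trace_poly_def)
  next
    assume "\<exists>i\<in>{1..<n}. r = gen_g i ^ 2 - (1 + scalar (q - inverse q) * idem_e d i * gen_g i)"
    then obtain i where quadratic: "i \<in> {1..<n}"
      "r = gen_g i ^ 2 - (1 + scalar (q - inverse q) * idem_e d i * gen_g i)" by blast
    let ?u = "a * (gen_g i ^ 2 - 1) * b" and ?v = "a * (idem_e d i * gen_g i) * b"
    have uv: "?u \<in> falg" "?v \<in> falg" using quadratic ab by auto
    have "universal_poly d ?u = [:0, 1:] * universal_poly d ?v"
    proof (rule uniq)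
      fix q z F assume m: "markov_functional d q z F"
      then interpret markov_functional d q z F .
      let ?r = "gen_g i ^ 2 - (1 + scalar (q - inverse q) * idem_e d i * gen_g i)"
      have "?r \<in> yh_relators d q n" unfolding yh_relators_def using quadratic by blast
      then have "F (a * ?r * b) = 0" using ab F_relator by blast
      moreover have "a * ?r * b = ?u - scalar (q - inverse q) * ?v"
        by (simp add: algebra_simps scalar_left_commute)
      ultimately have "F ?u = (q - inverse q) * F ?v"
        using uv by (simp add: F_diff F_scalar)
      then show "poly (poly (universal_poly d ?u) [:q - inverse q:]) z =
          poly (poly ([:0, 1:] * universal_poly d ?v) [:q - inverse q:]) z"
        using uv m by (simp add: univ)
    qed
    moreover have "universal_poly d (a * r * b) = universal_poly d ?u + [:[:- (q - inverse q):]:] * universal_poly d ?v"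
    proof -
      have "a * r * b = ?u + scalar (- (q - inverse q)) * ?v"
        using quadratic by (simp only: scalar_uminus) (simp add: algebra_simps scalar_left_commute)
      then show ?thesis using add[of ?u "scalar (- (q - inverse q)) * ?v"] scal[of ?v] uv by simp
    qed
    ultimately show ?thesis by (simp add: trace_poly_def algebra_simps)
  qed
  show "poly (trace_poly d q (a * b)) z = poly (trace_poly d q (b * a)) z" if "a \<in> falg" "b \<in> falg" for a b
  proof -
    have "universal_poly d (a * b) = universal_poly d (b * a)"
      by (rule uniq) (simp add: univ that markov_functional.F_cyclic)
    then show ?thesis by (simp add: trace_poly_def)
  qed
  have "universal_poly d 1 = 1"
    by (rule uniq) (simp add: univ markov_functional.F_one)
  then show "poly (trace_poly d q 1) z = 1" by (simp add: trace_poly_def)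
  show "poly (trace_poly d q (a * gen_g n)) z = z * poly (trace_poly d q a) z"
    if "1 \<le> n" "a \<in> subalg (gens n)" for a n
  proof -
    have "universal_poly d (a * gen_g n) = [:[:0, 1:]:] * universal_poly d a"
      using that by (intro uniq) (simp add: univ subalg_gens_falg[of a n] markov_functional.F_g)
    then show ?thesis by (simp add: trace_poly_def)
  qed
  show "poly (trace_poly d q (a * gen_t (n + 1) ^ k)) z = 0"
    if "a \<in> subalg (gens n)" "1 \<le> k" "k \<le> d - 1" for a n k
  proof -
    have "universal_poly d (a * gen_t (n + 1) ^ k) = 0"
      using that markov_functional.F_t[of d _ _ _ a n k]
      by (intro uniq) (simp add: univ subalg_gens_falg[of a n])
    then show ?thesis by (simp add: trace_poly_def)
  qed
qed (use d q in auto)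

section \<open>The trace on the quotient algebras\<close>

lemma ring_free_alg: "ring (free_alg n)"
proof (rule ringI)
  show "abelian_group (free_alg n)"
  proof (rule abelian_groupI)
    fix x assume "x \<in> carrier (free_alg n)"
    then have "- x \<in> carrier (free_alg n)" by (auto simp: carrier_free_alg)
    moreover have "- x \<oplus>\<^bsub>free_alg n\<^esub> x = \<zero>\<^bsub>free_alg n\<^esub>" by (simp add: free_alg_def)
    ultimately show "\<exists>y\<in>carrier (free_alg n). y \<oplus>\<^bsub>free_alg n\<^esub> x = \<zero>\<^bsub>free_alg n\<^esub>" by blast
  qed (auto simp: carrier_free_alg, auto simp: free_alg_def add_ac)
  show "Group.monoid (free_alg n)"
    by (rule monoidI) (auto simp: carrier_free_alg, auto simp: free_alg_def mult.assoc)
qed (auto simp: free_alg_def algebra_simps)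

lemma free_alg_minus:
  assumes "a \<in> subalg (gens n)"
  shows "\<ominus>\<^bsub>free_alg n\<^esub> a = - a"
proof (rule abelian_group.minus_equality[OF ring.is_abelian_group[OF ring_free_alg]])
  show "- a \<oplus>\<^bsub>free_alg n\<^esub> a = \<zero>\<^bsub>free_alg n\<^esub>" by (simp add: free_alg_def)
qed (use assms in \<open>auto simp: carrier_free_alg\<close>)

lemma ideal_yh_ideal: "ideal (yh_ideal d q n) (free_alg n)"
  unfolding yh_ideal_def
  by (rule ring.genideal_ideal[OF ring_free_alg]) (simp add: carrier_free_alg yh_relators_subalg)

lemma ring_YH: "ring (YH d q n)"
  unfolding YH_def by (rule ideal.quotient_is_ring[OF ideal_yh_ideal])

lemma yh_class_hom: "yh_class d q n \<in> ring_hom (free_alg n) (YH d q n)"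
  using ideal.rcos_ring_hom[OF ideal_yh_ideal] unfolding YH_def yh_class_def[abs_def] .

lemma yh_class_add:
  "a \<in> subalg (gens n) \<Longrightarrow> b \<in> subalg (gens n) \<Longrightarrow>
    yh_class d q n a \<oplus>\<^bsub>YH d q n\<^esub> yh_class d q n b = yh_class d q n (a + b)"
  and yh_class_mult:
  "a \<in> subalg (gens n) \<Longrightarrow> b \<in> subalg (gens n) \<Longrightarrow>
    yh_class d q n a \<otimes>\<^bsub>YH d q n\<^esub> yh_class d q n b = yh_class d q n (a * b)"
  and yh_class_1: "\<one>\<^bsub>YH d q n\<^esub> = yh_class d q n 1"
  and yh_class_closed: "a \<in> subalg (gens n) \<Longrightarrow> yh_class d q n a \<in> carrier (YH d q n)"
  using ring_hom_add[OF yh_class_hom[of d q n], of a b] ring_hom_mult[OF yh_class_hom[of d q n], of a b]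
    ring_hom_one[OF yh_class_hom[of d q n]] ring_hom_closed[OF yh_class_hom[of d q n], of a]
  by (simp_all add: carrier_free_alg) (simp_all add: free_alg_def)

lemma carrier_YH: "x \<in> carrier (YH d q n) \<Longrightarrow> \<exists>a\<in>subalg (gens n). x = yh_class d q n a"
  by (auto simp: YH_def FactRing_def A_RCOSETS_def' yh_class_def carrier_free_alg)

lemma yh_class_eq_iff:
  assumes "a \<in> subalg (gens n)" "b \<in> subalg (gens n)"
  shows "b \<in> yh_class d q n a \<longleftrightarrow> b - a \<in> yh_ideal d q n"
proof -
  have "b \<in> yh_class d q n a \<longleftrightarrow> (\<exists>i\<in>yh_ideal d q n. b = i + a)"
    unfolding yh_class_def a_r_coset_def' by (auto simp: free_alg_def)
  then show ?thesis by (metis add_diff_cancel diff_add_cancel)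
qed

lemma yh_class_eqI:
  assumes "a \<in> subalg (gens n)" "b \<in> subalg (gens n)" "b - a \<in> yh_ideal d q n"
  shows "yh_class d q n b = yh_class d q n a"
  using abelian_group.a_repr_independence[OF ring.is_abelian_group[OF ring_free_alg], of b n "yh_ideal d q n" a]
    additive_subgroup.a_subgroup[OF ideal.axioms(1)[OF ideal_yh_ideal]] yh_class_eq_iff[OF assms(1,2)] assms
  unfolding yh_class_def by (simp add: carrier_free_alg)

lemma relator_in_yh_ideal:
  assumes "r \<in> yh_relators d q n" "a \<in> subalg (gens n)" "b \<in> subalg (gens n)"
  shows "a * r * b \<in> yh_ideal d q n"
proof -
  interpret ideal "yh_ideal d q n" "free_alg n" by (rule ideal_yh_ideal)
  have "r \<in> yh_ideal d q n"
    unfolding yh_ideal_def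
    using genideal_self[of "yh_relators d q n"] yh_relators_subalg assms(1) by (auto simp: carrier_free_alg)
  then show ?thesis
    using I_l_closed[of r a] I_r_closed[of "a * r" b] assms by (simp add: carrier_free_alg, simp add: free_alg_def)
qed

text \<open>
  The elements all of whose two-sided multiples are killed by \<open>F\<close> form an ideal that contains the
  relators, hence the whole ideal that they generate.
\<close>

lemma (in markov_functional) F_yh_ideal:
  assumes "a \<in> yh_ideal d q n"
  shows "F a = 0"
proof -
  \<comment> \<open>the factors on both sides make this a two-sided ideal\<close>
  let ?K = "{a \<in> subalg (gens n). \<forall>u\<in>falg. \<forall>v\<in>falg. F (u * a * v) = 0}"
  note falg = subalg_gens_falg[of _ n]
  have "ideal ?K (free_alg n)"
  proof (rule idealI[OF ring_free_alg])
    show "subgroup ?K (add_monoid (free_alg n))"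
    proof (rule group.subgroupI[OF abelian_group.a_group[OF ring.is_abelian_group[OF ring_free_alg]]])
      fix a assume a: "a \<in> ?K"
      have "inv\<^bsub>add_monoid (free_alg n)\<^esub> a = - a"
        using a free_alg_minus[of a n] by (simp add: a_inv_def)
      then show "inv\<^bsub>add_monoid (free_alg n)\<^esub> a \<in> ?K"
        using a falg by (auto simp: F_uminus)
    next
      fix a b assume "a \<in> ?K" "b \<in> ?K"
      then show "a \<otimes>\<^bsub>add_monoid (free_alg n)\<^esub> b \<in> ?K"
        using falg by (auto simp: free_alg_def distrib_left distrib_right F_add)
    qed (auto simp: carrier_free_alg)
  next
    fix a x assume a: "a \<in> ?K" and "x \<in> carrier (free_alg n)"
    then have x: "x \<in> subalg (gens n)" by (simp add: carrier_free_alg)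
    have "F (u * (x * a) * v) = 0" if "u \<in> falg" "v \<in> falg" for u v
      using a that falg[OF x] by (auto simp: mult.assoc[symmetric])
    then show "x \<otimes>\<^bsub>free_alg n\<^esub> a \<in> ?K" using a x by (auto simp: free_alg_def)
    have "F (u * (a * x) * v) = 0" if "u \<in> falg" "v \<in> falg" for u v
    proof -
      have "F (u * a * (x * v)) = 0" using a that falg[OF x] by blast
      then show ?thesis by (simp add: mult.assoc)
    qed
    then show "a \<otimes>\<^bsub>free_alg n\<^esub> x \<in> ?K" using a x by (auto simp: free_alg_def)
  qed
  moreover have "yh_relators d q n \<subseteq> ?K" using yh_relators_subalg F_relator by blast
  ultimately have "yh_ideal d q n \<subseteq> ?K"
    unfolding yh_ideal_def by (intro ring.genideal_minimal[OF ring_free_alg])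
  then have "F (1 * a * 1) = 0" using assms by blast
  then show ?thesis by simp
qed

lemma complex_poly_eqI:
  "(\<And>z. poly (p :: complex poly) z = poly p' z) \<Longrightarrow> p = p'"
  by (simp add: poly_eq_poly_eq_iff[symmetric] fun_eq_iff)

lemma trace_poly_cong:
  assumes "1 \<le> d" "q \<noteq> 0" "a \<in> subalg (gens n)" "b \<in> yh_class d q n a"
  shows "trace_poly d q b = trace_poly d q a"
proof (rule complex_poly_eqI)
  fix z
  interpret markov_functional d q z "\<lambda>a. poly (trace_poly d q a) z"
    by (rule markov_functional_trace_poly[OF assms(1,2)])
  have "b \<in> subalg (gens n)"
  proof -
    obtain i where "i \<in> yh_ideal d q n" "b = i + a"
      using assms(4) unfolding yh_class_def a_r_coset_def' by (auto simp: free_alg_def)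
    then show ?thesis
      using additive_subgroup.a_Hcarr[OF ideal.axioms(1)[OF ideal_yh_ideal]] assms(3)
      by (auto simp: carrier_free_alg)
  qed
  then have "poly (trace_poly d q (b - a)) z = 0" "a \<in> falg" "b \<in> falg"
    using assms F_yh_ideal[of "b - a" n] yh_class_eq_iff[of a n b] subalg_gens_falg by auto
  then show "poly (trace_poly d q b) z = poly (trace_poly d q a) z"
    by (simp add: F_diff)
qed

definition quotient_trace :: "nat \<Rightarrow> complex \<Rightarrow> nat \<Rightarrow> free_algebra set \<Rightarrow> complex poly" where
  "quotient_trace d q n = restrict (\<lambda>x. trace_poly d q (SOME a. a \<in> x)) (carrier (YH d q n))"

lemma quotient_trace_class:
  assumes "1 \<le> d" "q \<noteq> 0" "a \<in> subalg (gens n)"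
  shows "quotient_trace d q n (yh_class d q n a) = trace_poly d q a"
proof -
  have "a \<in> yh_class d q n a"
    using yh_class_eq_iff[OF assms(3,3)] additive_subgroup.zero_closed[OF ideal.axioms(1)[OF ideal_yh_ideal]]
    by (simp add: free_alg_def)
  then have "(SOME b. b \<in> yh_class d q n a) \<in> yh_class d q n a" by (rule someI)
  then show ?thesis
    using trace_poly_cong[OF assms] yh_class_closed[OF assms(3)] by (simp add: quotient_trace_def)
qed

lemma is_yh_trace_quotient_trace:
  assumes "1 \<le> d" "q \<noteq> 0"
  shows "is_yh_trace d q (quotient_trace d q)"
proof -
  note cls = quotient_trace_class[OF assms]
  note m = markov_functional_trace_poly[OF assms]
  have falg: "a \<in> subalg (gens n) \<Longrightarrow> a \<in> falg" for a n by (rule subalg_gens_falg)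
  show ?thesis
    unfolding is_yh_trace_def carrier_free_alg
  proof (intro conjI allI ballI impI)
    fix n x y assume "x \<in> carrier (YH d q n)" "y \<in> carrier (YH d q n)"
    then obtain a b where ab: "a \<in> subalg (gens n)" "x = yh_class d q n a" "b \<in> subalg (gens n)" "y = yh_class d q n b"
      using carrier_YH by metis
    have "trace_poly d q (a + b) = trace_poly d q a + trace_poly d q b"
      using markov_functional.F_add[OF m] ab(1,3) falg by (intro complex_poly_eqI) auto
    then show "quotient_trace d q n (x \<oplus>\<^bsub>YH d q n\<^esub> y) = quotient_trace d q n x + quotient_trace d q n y"
      using ab by (simp add: yh_class_add cls subalg_add)
    have "trace_poly d q (a * b) = trace_poly d q (b * a)"
      using markov_functional.F_cyclic[OF m] ab(1,3) falg by (intro complex_poly_eqI) auto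
    then show "quotient_trace d q n (x \<otimes>\<^bsub>YH d q n\<^esub> y) = quotient_trace d q n (y \<otimes>\<^bsub>YH d q n\<^esub> x)"
      using ab by (simp add: yh_class_mult cls subalg_mult)
  next
    fix n c x assume "x \<in> carrier (YH d q n)"
    then obtain a where a: "a \<in> subalg (gens n)" "x = yh_class d q n a" using carrier_YH by metis
    have "trace_poly d q (scalar c * a) = smult c (trace_poly d q a)"
      using markov_functional.F_scalar[OF m] a falg by (intro complex_poly_eqI) auto
    then show "quotient_trace d q n (yh_class d q n (scalar c) \<otimes>\<^bsub>YH d q n\<^esub> x) = smult c (quotient_trace d q n x)"
      using a by (simp add: yh_class_mult cls subalg_mult)
  next
    fix n a assume "a \<in> subalg (gens n)"
    then show "quotient_trace d q (n + 1) (yh_class d q (n + 1) a) = quotient_trace d q n (yh_class d q n a)"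
      using subalg_gens_mono[of a n "n + 1"] by (simp add: cls)
  next
    fix n
    have "trace_poly d q 1 = 1"
      using markov_functional.F_one[OF m] by (intro complex_poly_eqI) auto
    then show "quotient_trace d q n \<one>\<^bsub>YH d q n\<^esub> = 1" by (simp add: yh_class_1 cls)
  next
    fix n :: nat and a assume n: "1 \<le> n" and a: "a \<in> subalg (gens n)"
    have "a * gen_g n \<in> subalg (gens (n + 1))" using n a by (rule subalg_times_g)
    moreover have "trace_poly d q (a * gen_g n) = [:0, 1:] * trace_poly d q a"
      using markov_functional.F_g[OF m n a] by (intro complex_poly_eqI) auto
    ultimately show "quotient_trace d q (n + 1) (yh_class d q (n + 1) (a * gen_g n)) =
        [:0, 1:] * quotient_trace d q n (yh_class d q n a)"
      using a by (simp only: cls)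
  next
    fix n a k assume a: "a \<in> subalg (gens n)" and k: "1 \<le> k \<and> k \<le> d - 1"
    have "a * gen_t (n + 1) ^ k \<in> subalg (gens (n + 1))"
      using a by (rule subalg_times_t)
    moreover have "trace_poly d q (a * gen_t (n + 1) ^ k) = 0"
      using markov_functional.F_t[OF m a] k by (intro complex_poly_eqI) auto
    ultimately show "quotient_trace d q (n + 1) (yh_class d q (n + 1) (a * gen_t (n + 1) ^ k)) = 0"
      by (simp only: cls)
  qed (simp add: quotient_trace_def)
qed

text \<open>
  Evaluating any trace at a point \<open>z\<close> gives a Markov functional, whose values are prescribed by the
  universal polynomial.
\<close>

lemma is_yh_trace_class:
  assumes tr: "is_yh_trace d q tr" and d: "1 \<le> d" and q: "q \<noteq> 0" and a: "a \<in> subalg (gens n)"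
  shows "tr n (yh_class d q n a) = trace_poly d q a"
proof (rule complex_poly_eqI)
  fix z
  have tr_add: "\<And>n x y. x \<in> carrier (YH d q n) \<Longrightarrow> y \<in> carrier (YH d q n) \<Longrightarrow>
      tr n (x \<oplus>\<^bsub>YH d q n\<^esub> y) = tr n x + tr n y"
    and tr_scalar: "\<And>n c x. x \<in> carrier (YH d q n) \<Longrightarrow>
      tr n (yh_class d q n (scalar c) \<otimes>\<^bsub>YH d q n\<^esub> x) = smult c (tr n x)"
    and tr_Suc: "\<And>n a. a \<in> subalg (gens n) \<Longrightarrow> tr (n + 1) (yh_class d q (n + 1) a) = tr n (yh_class d q n a)"
    and tr_cyclic: "\<And>n x y. x \<in> carrier (YH d q n) \<Longrightarrow> y \<in> carrier (YH d q n) \<Longrightarrow>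
      tr n (x \<otimes>\<^bsub>YH d q n\<^esub> y) = tr n (y \<otimes>\<^bsub>YH d q n\<^esub> x)"
    and tr_one: "\<And>n. tr n \<one>\<^bsub>YH d q n\<^esub> = 1"
    and tr_g: "\<And>n a. 1 \<le> n \<Longrightarrow> a \<in> subalg (gens n) \<Longrightarrow>
      tr (n + 1) (yh_class d q (n + 1) (a * gen_g n)) = [:0, 1:] * tr n (yh_class d q n a)"
    and tr_t: "\<And>n a k. a \<in> subalg (gens n) \<Longrightarrow> 1 \<le> k \<Longrightarrow> k \<le> d - 1 \<Longrightarrow>
      tr (n + 1) (yh_class d q (n + 1) (a * gen_t (n + 1) ^ k)) = 0"
    using tr unfolding is_yh_trace_def carrier_free_alg by blast+
  define F where "F a = (let n = LEAST n. a \<in> subalg (gens n) in poly (tr n (yh_class d q n a)) z)" for a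
  have F: "F a = poly (tr n (yh_class d q n a)) z" if a: "a \<in> subalg (gens n)" for a n
  proof -
    define m where "m = (LEAST n. a \<in> subalg (gens n))"
    have m: "a \<in> subalg (gens m)" unfolding m_def using a by (rule LeastI)
    have "m \<le> n" unfolding m_def using a by (rule Least_le)
    then have "tr n (yh_class d q n a) = tr m (yh_class d q m a)"
    proof (induction n rule: dec_induct)
      case (step k)
      then show ?case using tr_Suc[of a k] subalg_gens_mono[OF m step(1)] by simp
    qed simp
    then show ?thesis by (simp add: F_def m_def[symmetric])
  qed
  have "markov_functional d q z F"
  proof
    show "F (a + b) = F a + F b" if ab: "a \<in> falg" "b \<in> falg" for a b
    proof -
      obtain n where n: "a \<in> subalg (gens n)" "b \<in> subalg (gens n)"
        using falg_common[of "{a, b}"] ab by auto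
      show ?thesis
        using F[OF n(1)] F[OF n(2)] F[OF subalg_add[OF n]] tr_add[OF yh_class_closed yh_class_closed, OF n] n
        by (simp add: yh_class_add)
    qed
    show "F (scalar c * a) = c * F a" if a: "a \<in> falg" for a c
    proof -
      obtain n where n: "a \<in> subalg (gens n)" using falg_ex a by auto
      show ?thesis
        using F[OF n] F[OF subalg_mult[OF subalg_scalar n]] tr_scalar[OF yh_class_closed, OF n, of c] n
        by (simp add: yh_class_mult)
    qed
    show "F (a * r * b) = 0" if r: "r \<in> yh_relators d q n" and ab: "a \<in> falg" "b \<in> falg" for a b r n
    proof -
      obtain k where k: "a \<in> subalg (gens k)" "b \<in> subalg (gens k)"
        using falg_common[of "{a, b}"] ab by auto
      let ?m = "max n k"
      have r': "r \<in> yh_relators d q ?m"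
        using r yh_relators_mono[of n ?m d q] by auto
      have ab': "a \<in> subalg (gens ?m)" "b \<in> subalg (gens ?m)"
        using k subalg_gens_mono[of _ k ?m] by auto
      have rs: "r \<in> subalg (gens ?m)" using r' yh_relators_subalg by blast
      have "yh_class d q ?m (a * r * b) = yh_class d q ?m 0"
        using relator_in_yh_ideal[OF r' ab'] ab' rs by (intro yh_class_eqI) auto
      moreover have "tr ?m (yh_class d q ?m 0) = 0"
        using tr_scalar[OF yh_class_closed, of 0 ?m 0] by (simp add: yh_class_mult)
      ultimately show ?thesis using F[of "a * r * b" ?m] ab' rs by auto
    qed
    show "F (a * b) = F (b * a)" if ab: "a \<in> falg" "b \<in> falg" for a b
    proof -
      obtain n where n: "a \<in> subalg (gens n)" "b \<in> subalg (gens n)"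
        using falg_common[of "{a, b}"] ab by auto
      show ?thesis
        using F[OF subalg_mult[OF n]] F[OF subalg_mult[OF n(2,1)]] tr_cyclic[OF yh_class_closed yh_class_closed, OF n] n
        by (simp add: yh_class_mult)
    qed
    show "F 1 = 1" using F[of 1 0] tr_one[of 0] by (simp add: yh_class_1)
    show "F (a * gen_g n) = z * F a" if n: "1 \<le> n" and a: "a \<in> subalg (gens n)" for a n
    proof -
      have "a * gen_g n \<in> subalg (gens (n + 1))" using n a by (rule subalg_times_g)
      then show ?thesis using F[OF a] F[of "a * gen_g n" "n + 1"] tr_g[OF n a] by simp
    qed
    show "F (a * gen_t (n + 1) ^ k) = 0" if a: "a \<in> subalg (gens n)" and k: "1 \<le> k" "k \<le> d - 1" for a n k
    proof -
      have "a * gen_t (n + 1) ^ k \<in> subalg (gens (n + 1))"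
        using a by (rule subalg_times_t)
      then show ?thesis using F[of "a * gen_t (n + 1) ^ k" "n + 1"] tr_t[OF a k] by simp
    qed
  qed (use d q in auto)
  from universal_poly[OF subalg_gens_falg[OF a] this]
  show "poly (tr n (yh_class d q n a)) z = poly (trace_poly d q a) z"
    using F[OF a] by (simp add: trace_poly_def)
qed

text \<open>
  Existence and uniqueness of the trace, in the form in which it is used: its value at a residue class
  can be computed from any representative by means of Markov functionals.
\<close>

theorem yh_trace_class:
  assumes "1 \<le> d" "q \<noteq> 0" "a \<in> subalg (gens n)"
  shows "yh_trace d q n (yh_class d q n a) = trace_poly d q a"
proof -
  have "is_yh_trace d q (yh_trace d q)"
    unfolding yh_trace_def
  proof (rule theI[where P = "is_yh_trace d q" and a = "quotient_trace d q"])
    show "is_yh_trace d q (quotient_trace d q)" by (rule is_yh_trace_quotient_trace[OF assms(1,2)])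
    fix tr assume tr: "is_yh_trace d q tr"
    show "tr = quotient_trace d q"
    proof (intro ext)
      fix n x
      show "tr n x = quotient_trace d q n x"
      proof (cases "x \<in> carrier (YH d q n)")
        case True
        then show ?thesis
          using carrier_YH is_yh_trace_class[OF tr assms(1,2)] quotient_trace_class[OF assms(1,2)] by metis
      next
        case False
        moreover have "tr n \<in> extensional (carrier (YH d q n))" using tr by (simp add: is_yh_trace_def)
        ultimately show ?thesis by (simp add: quotient_trace_def extensional_def)
      qed
    qed
  qed
  then show ?thesis using assms by (rule is_yh_trace_class)
qed

section \<open>Markov invariance of Theta\<close>

text \<open>
  The inverse of \<open>g_i\<close> that the quadratic relation provides.
\<close>

definition inv_g :: "nat \<Rightarrow> complex \<Rightarrow> nat \<Rightarrow> free_algebra" where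
  "inv_g d q i = gen_g i - scalar (q - inverse q) * idem_e d i"

fun letter_elem :: "nat \<Rightarrow> complex \<Rightarrow> nat \<times> bool \<Rightarrow> free_algebra" where
  "letter_elem d q (i, True) = gen_g i"
| "letter_elem d q (i, False) = inv_g d q i"

definition word_elem :: "nat \<Rightarrow> complex \<Rightarrow> braid_word \<Rightarrow> free_algebra" where
  "word_elem d q w = prod_list (map (letter_elem d q) w)"

lemma word_elem_simps [simp]:
  "word_elem d q [] = 1"
  "word_elem d q (l # w) = letter_elem d q l * word_elem d q w"
  "word_elem d q (u @ v) = word_elem d q u * word_elem d q v"
  by (simp_all add: word_elem_def)

lemma subalg_inv_g: "1 \<le> i \<Longrightarrow> i < n \<Longrightarrow> inv_g d q i \<in> subalg (gens n)"
  unfolding inv_g_def by (intro subalg_diff subalg_mult subalg_scalar subalg_gen_g subalg_idem_e)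

lemma falg_inv_g [simp]: "1 \<le> i \<Longrightarrow> inv_g d q i \<in> falg"
  by (rule subalg_gens_falg[OF subalg_inv_g[of i "Suc i"]]) auto

lemma subalg_letter_elem: "1 \<le> i \<Longrightarrow> i < n \<Longrightarrow> letter_elem d q (i, e) \<in> subalg (gens n)"
  by (cases e) (auto simp: subalg_inv_g subalg_gen_g)

lemma braid_words_simps:
  "[] \<in> braid_words n"
  "(i, e) # w \<in> braid_words n \<longleftrightarrow> 1 \<le> i \<and> i < n \<and> w \<in> braid_words n"
  "u @ v \<in> braid_words n \<longleftrightarrow> u \<in> braid_words n \<and> v \<in> braid_words n"
  by (auto simp: braid_words_def)

lemma subalg_word_elem: "w \<in> braid_words n \<Longrightarrow> word_elem d q w \<in> subalg (gens n)"
  by (induction w) (auto simp: braid_words_simps intro!: subalg_mult subalg_letter_elem)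

lemma falg_word_elem: "w \<in> braid_words n \<Longrightarrow> word_elem d q w \<in> falg"
  using subalg_word_elem subalg_gens_falg by blast

lemma yh_class_mult_cong:
  assumes "a \<in> subalg (gens n)" "a' \<in> subalg (gens n)" "b \<in> subalg (gens n)" "b' \<in> subalg (gens n)"
    and "yh_class d q n a = yh_class d q n a'" "yh_class d q n b = yh_class d q n b'"
  shows "yh_class d q n (a * b) = yh_class d q n (a' * b')"
  unfolding yh_class_mult[OF assms(1,3), symmetric] yh_class_mult[OF assms(2,4), symmetric] assms(5,6) ..

lemma yh_class_multL:
  assumes "w \<in> subalg (gens n)" "b \<in> subalg (gens n)" "b' \<in> subalg (gens n)"
    and "yh_class d q n b = yh_class d q n b'"
  shows "yh_class d q n (w * b) = yh_class d q n (w * b')"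
  by (rule yh_class_mult_cong[OF assms(1,1-3) HOL.refl assms(4)])

lemma yh_class_multR:
  assumes "w \<in> subalg (gens n)" "a \<in> subalg (gens n)" "a' \<in> subalg (gens n)"
    and "yh_class d q n a = yh_class d q n a'"
  shows "yh_class d q n (a * w) = yh_class d q n (a' * w)"
  by (rule yh_class_mult_cong[OF assms(2,3,1,1,4) HOL.refl])

lemma yh_class_add_cong:
  assumes "a \<in> subalg (gens n)" "a' \<in> subalg (gens n)" "b \<in> subalg (gens n)" "b' \<in> subalg (gens n)"
    and "yh_class d q n a = yh_class d q n a'" "yh_class d q n b = yh_class d q n b'"
  shows "yh_class d q n (a + b) = yh_class d q n (a' + b')"
  unfolding yh_class_add[OF assms(1,3), symmetric] yh_class_add[OF assms(2,4), symmetric] assms(5,6) ..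

lemma yh_class_relator:
  assumes "a - b \<in> yh_relators d q n" "a \<in> subalg (gens n)" "b \<in> subalg (gens n)"
  shows "yh_class d q n a = yh_class d q n b"
  using relator_in_yh_ideal[OF assms(1) subalg_1 subalg_1] assms by (intro yh_class_eqI) auto

lemma yh_class_power_commute:
  assumes mem: "x \<in> subalg (gens n)" "x' \<in> subalg (gens n)" "y \<in> subalg (gens n)"
    and "yh_class d q n (x * y) = yh_class d q n (y * x')"
  shows "yh_class d q n (x ^ k * y) = yh_class d q n (y * x' ^ k)"
proof (induction k)
  case (Suc k)
  have "yh_class d q n (x * (x ^ k * y)) = yh_class d q n (x * (y * x' ^ k))"
    using Suc mem by (intro yh_class_multL) auto
  also have "\<dots> = yh_class d q n ((x * y) * x' ^ k)" by (simp add: mult.assoc)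
  also have "\<dots> = yh_class d q n ((y * x') * x' ^ k)"
    using assms by (intro yh_class_multR) auto
  finally show ?case by (simp add: mult.assoc)
qed simp

text \<open>
  Here the congruence relation of a functional does not suffice: the inverse has to be found in the
  quotient ring itself.  The quadratic relation gives a left inverse at once.  A right inverse
  arises after \<open>e_i\<close> is moved past \<open>g_i\<close>, which interchanges \<open>t_i\<close> and \<open>t_(i+1)\<close> in it.
\<close>

lemma inv_yh_class_g:
  assumes i: "1 \<le> i" "i < n"
  shows "inv\<^bsub>YH d q n\<^esub> (yh_class d q n (gen_g i)) = yh_class d q n (inv_g d q i)"
proof -
  let ?A = "subalg (gens n)" and ?c = "yh_class d q n" and ?t = "gen_t i" and ?t' = "gen_t (i + 1)" and ?g = "gen_g i"
  \<comment> \<open>the image of \<open>idem_e d i\<close> under conjugation by \<open>gen_g i\<close>\<close>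
  define e' where "e' = scalar (1 / of_nat d) * (\<Sum>s = 0..d - 1. ?t' ^ s * ?t ^ (d - s))"
  have mem: "?g \<in> ?A" "?t \<in> ?A" "?t' \<in> ?A" "idem_e d i \<in> ?A" "e' \<in> ?A"
    using i unfolding e'_def by (auto intro!: subalg_gen_g subalg_gen_t subalg_idem_e subalg_mult subalg_sum subalg_power)
  have tr: "Transposition.transpose i (i + 1) i = i + 1" "Transposition.transpose i (i + 1) (i + 1) = i"
    by (auto simp: Transposition.transpose_def)
  have "?t * ?g - ?g * gen_t (Transposition.transpose i (i + 1) i) \<in> yh_relators d q n"
    "?t' * ?g - ?g * gen_t (Transposition.transpose i (i + 1) (i + 1)) \<in> yh_relators d q n"
  proof -
    have "i \<in> {1..<n}" "i \<in> {1..n}" "i + 1 \<in> {1..n}" using i by auto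
    then show "?t * ?g - ?g * gen_t (Transposition.transpose i (i + 1) i) \<in> yh_relators d q n"
      "?t' * ?g - ?g * gen_t (Transposition.transpose i (i + 1) (i + 1)) \<in> yh_relators d q n"
      unfolding yh_relators_def by blast+
  qed
  then have rel: "?t * ?g - ?g * ?t' \<in> yh_relators d q n" "?t' * ?g - ?g * ?t \<in> yh_relators d q n"
    unfolding tr .
  have "?c (?t * ?g) = ?c (?g * ?t')" "?c (?t' * ?g) = ?c (?g * ?t)"
    using mem by (intro yh_class_relator[OF rel(1)] yh_class_relator[OF rel(2)] subalg_mult; simp)+
  then have p: "?c (?t ^ k * ?g) = ?c (?g * ?t' ^ k)" "?c (?t' ^ k * ?g) = ?c (?g * ?t ^ k)" for k
    using mem by (simp_all add: yh_class_power_commute)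
  have summand: "?c (?t ^ s * ?t' ^ k * ?g) = ?c (?g * (?t' ^ s * ?t ^ k))" for s k
  proof -
    have "?c (?t ^ s * (?t' ^ k * ?g)) = ?c (?t ^ s * (?g * ?t ^ k))"
      using mem p by (intro yh_class_multL) auto
    also have "\<dots> = ?c ((?t ^ s * ?g) * ?t ^ k)" by (simp add: mult.assoc)
    also have "\<dots> = ?c ((?g * ?t' ^ s) * ?t ^ k)"
      using mem p by (intro yh_class_multR) auto
    finally show ?thesis by (simp add: mult.assoc)
  qed
  have "?c (\<Sum>s\<in>I. ?t ^ s * ?t' ^ (d - s) * ?g) = ?c (\<Sum>s\<in>I. ?g * (?t' ^ s * ?t ^ (d - s)))" for I :: "nat set"
  proof (induction I rule: infinite_finite_induct)
    case (insert s I)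
    then show ?case
      using mem summand[of s "d - s"]
      by (simp, intro yh_class_add_cong) (auto intro!: subalg_sum subalg_mult subalg_power)
  qed simp_all
  then have "?c (scalar (1 / of_nat d) * (\<Sum>s = 0..d - 1. ?t ^ s * ?t' ^ (d - s) * ?g)) =
      ?c (scalar (1 / of_nat d) * (\<Sum>s = 0..d - 1. ?g * (?t' ^ s * ?t ^ (d - s))))"
    using mem by (intro yh_class_multL subalg_sum subalg_mult subalg_power) auto
  then have eg: "?c (idem_e d i * ?g) = ?c (?g * e')"
    unfolding idem_e_def e'_def scalar_left_commute mult.assoc[of "scalar _"] sum_distrib_right
    unfolding sum_distrib_left[of ?g] .
  have "?g ^ 2 - (1 + scalar (q - inverse q) * idem_e d i * ?g) \<in> yh_relators d q n"
  proof -
    have "i \<in> {1..<n}" using i by simp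
    then show ?thesis unfolding yh_relators_def by blast
  qed
  then have sq: "?c (?g * ?g) = ?c (1 + scalar (q - inverse q) * idem_e d i * ?g)"
    using mem by (intro yh_class_relator) (auto simp: power2_eq_square)
  \<comment> \<open>\<open>?x\<close> is a left inverse, \<open>?y\<close> a right inverse\<close>
  let ?x = "inv_g d q i" and ?y = "?g - scalar (q - inverse q) * e'"
  have mem': "?x \<in> ?A" "?y \<in> ?A" using mem i by (auto simp: subalg_inv_g)
  have "?c (?x * ?g) = ?c (?g * ?g + scalar (- (q - inverse q)) * (idem_e d i * ?g))"
    by (simp only: inv_g_def scalar_uminus) (simp add: algebra_simps)
  also have "\<dots> = ?c (1 + scalar (q - inverse q) * idem_e d i * ?g + scalar (- (q - inverse q)) * (idem_e d i * ?g))"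
    using mem by (intro yh_class_add_cong sq HOL.refl) auto
  finally have xg: "?c (?x * ?g) = ?c 1"
    by (simp only: scalar_uminus) (simp add: algebra_simps)
  have "?c (?g * ?y) = ?c (?g * ?g + scalar (- (q - inverse q)) * (?g * e'))"
    by (simp only: scalar_uminus) (simp add: algebra_simps scalar_left_commute)
  also have "\<dots> = ?c (1 + scalar (q - inverse q) * idem_e d i * ?g + scalar (- (q - inverse q)) * (idem_e d i * ?g))"
    using mem by (intro yh_class_add_cong yh_class_multL sq eg[symmetric]) auto
  finally have gy: "?c (?g * ?y) = ?c 1"
    by (simp only: scalar_uminus) (simp add: algebra_simps)
  have mon: "Group.monoid (YH d q n)" using ring_YH by (simp add: ring_def)
  have xg': "?c ?x \<otimes>\<^bsub>YH d q n\<^esub> ?c ?g = \<one>\<^bsub>YH d q n\<^esub>" and gy': "?c ?g \<otimes>\<^bsub>YH d q n\<^esub> ?c ?y = \<one>\<^bsub>YH d q n\<^esub>"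
    using xg gy mem mem' by (simp_all add: yh_class_mult yh_class_1)
  have "?c ?x = ?c ?y"
    using Group.monoid.inv_unique[OF mon xg' gy'] mem mem' by (simp add: yh_class_closed)
  then show ?thesis
    using Group.monoid.inv_unique'[OF mon, of "?c ?g" "?c ?x"] xg' gy' mem mem' by (simp add: yh_class_closed)
qed

lemma letter_image_eq:
  "1 \<le> i \<Longrightarrow> i < n \<Longrightarrow> letter_image d q n (i, e) = yh_class d q n (letter_elem d q (i, e))"
  by (cases e) (simp_all add: inv_yh_class_g)

lemma braid_image_eq:
  "w \<in> braid_words n \<Longrightarrow> braid_image d q n w = yh_class d q n (word_elem d q w)"
proof (induction w)
  case Nil
  then show ?case by (simp add: braid_image_def yh_class_1)
next
  case (Cons l w)
  obtain i e where l: "l = (i, e)" by (cases l)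
  then have "1 \<le> i" "i < n" "w \<in> braid_words n" using Cons.prems by (auto simp: braid_words_simps)
  then show ?case
    using Cons.IH l letter_image_eq[of i n d q e] subalg_letter_elem[of i n d q e] subalg_word_elem[of w n d q]
    by (simp add: braid_image_def yh_class_mult del: letter_image.simps letter_elem.simps)
qed

lemma sum_Suc_shift:
  fixes f :: "nat \<Rightarrow> 'a :: ab_group_add"
  shows "(\<Sum>s = 0..m. f (Suc s)) = (\<Sum>s = 0..m. f s) + f (Suc m) - f 0"
  by (induction m) simp_all

context markov_functional
begin

lemma eqv_t_commute: "1 \<le> i \<Longrightarrow> 1 \<le> j \<Longrightarrow> gen_t i ^ k * gen_t j ^ l \<approx> gen_t j ^ l * gen_t i ^ k"
proof -
  assume ij: "1 \<le> i" "1 \<le> j"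
  have "gen_t j ^ l * gen_t i \<approx> gen_t i * gen_t j ^ l"
    using ij by (intro eqv_commute_power eqv_tt) auto
  from eqv_sym[OF this] show ?thesis
    using ij by (intro eqv_commute_power) auto
qed

lemma average_const: "scalar (1 / of_nat d) * (\<Sum>s = 0..d - 1. x) = x"
proof -
  have "(\<Sum>s = 0..d - 1. x) = scalar (of_nat d) * x"
    using d_pos by (simp add: scalar_def)
  then show ?thesis using d_pos by (simp add: mult.assoc[symmetric] scalar_mult[symmetric])
qed

text \<open>
  Multiplying the sum that defines \<open>e_i\<close> by \<open>t_i\<close> or by \<open>t_(i+1)\<close> shifts its terms cyclically.
  It follows that \<open>e_i\<close> is idempotent.
\<close>

lemma eqv_te: "1 \<le> i \<Longrightarrow> gen_t i * idem_e d i \<approx> gen_t (i + 1) * idem_e d i"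
proof -
  assume i: "1 \<le> i"
  let ?t = "gen_t i" and ?t' = "gen_t (i + 1)"
  define f where "f k = ?t ^ k * ?t' ^ (d + 1 - k)" for k
  have f: "f k \<in> falg" for k using i by (simp add: f_def)
  have "f d \<approx> f 0"
  proof -
    have "?t ^ d * ?t' \<approx> 1 * ?t'" using i by (intro eqv_multR eqv_td) auto
    also have "\<dots> \<approx> ?t' ^ d * ?t'" using i by (intro eqv_multR eqv_sym[OF eqv_td]) auto
    finally show ?thesis by (simp add: f_def power_commutes)
  qed
  moreover have shift: "(\<Sum>s = 0..d - 1. f (Suc s)) = (\<Sum>s = 0..d - 1. f s) + f d - f 0"
    using d_pos sum_Suc_shift[of f "d - 1"] by simp
  ultimately have "(\<Sum>s = 0..d - 1. f (Suc s)) \<approx> (\<Sum>s = 0..d - 1. f s) + f 0 - f 0"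
    unfolding shift using f by (intro eqv_add eqv_diff eqv_refl falg_sum) auto
  then have 1: "(\<Sum>s = 0..d - 1. f (Suc s)) \<approx> (\<Sum>s = 0..d - 1. f s)" by simp
  have 2: "(\<Sum>s = 0..d - 1. f s) \<approx> (\<Sum>s = 0..d - 1. ?t' * (?t ^ s * ?t' ^ (d - s)))"
  proof (rule eqv_sum)
    fix s assume "s \<in> {0..d - 1}"
    then have s: "Suc d - s = Suc (d - s)" using d_pos by auto
    have "?t ^ s * ?t' ^ 1 * ?t' ^ (d - s) \<approx> ?t' ^ 1 * ?t ^ s * ?t' ^ (d - s)"
      using i by (intro eqv_multR eqv_t_commute) auto
    then show "f s \<approx> ?t' * (?t ^ s * ?t' ^ (d - s))" by (simp add: f_def s mult.assoc)
  qed
  have "(\<Sum>s = 0..d - 1. f (Suc s)) = ?t * (\<Sum>s = 0..d - 1. ?t ^ s * ?t' ^ (d - s))"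
    by (simp add: f_def sum_distrib_left mult.assoc)
  with eqv_trans[OF 1 2] have "?t * (\<Sum>s = 0..d - 1. ?t ^ s * ?t' ^ (d - s)) \<approx>
      ?t' * (\<Sum>s = 0..d - 1. ?t ^ s * ?t' ^ (d - s))" by (simp add: sum_distrib_left)
  then have "scalar (1 / of_nat d) * (?t * (\<Sum>s = 0..d - 1. ?t ^ s * ?t' ^ (d - s))) \<approx>
      scalar (1 / of_nat d) * (?t' * (\<Sum>s = 0..d - 1. ?t ^ s * ?t' ^ (d - s)))" by (intro eqv_multL) auto
  then show ?thesis unfolding idem_e_def scalar_left_commute .
qed

lemma eqv_t_power_e: "1 \<le> i \<Longrightarrow> gen_t (i + 1) ^ k * idem_e d i \<approx> gen_t i ^ k * idem_e d i"
proof (induction k)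
  case (Suc k)
  let ?t = "gen_t i" and ?t' = "gen_t (i + 1)" and ?e = "idem_e d i"
  have i: "1 \<le> i" by fact
  have "?t' ^ Suc k * ?e = ?t' ^ k * (?t' * ?e)" by (simp add: power_Suc2 mult.assoc del: power_Suc)
  also have "\<dots> \<approx> ?t' ^ k * (?t * ?e)" using i by (intro eqv_multL eqv_sym[OF eqv_te]) auto
  also have "\<dots> = ?t' ^ k * ?t ^ 1 * ?e" by (simp add: mult.assoc)
  also have "\<dots> \<approx> ?t ^ 1 * ?t' ^ k * ?e" using i by (intro eqv_multR eqv_t_commute) auto
  also have "\<dots> = ?t * (?t' ^ k * ?e)" by (simp add: mult.assoc)
  also have "\<dots> \<approx> ?t * (?t ^ k * ?e)" using Suc i by (intro eqv_multL) auto
  finally show ?case by (simp add: mult.assoc)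
qed auto

lemma eqv_ee: "1 \<le> i \<Longrightarrow> idem_e d i * idem_e d i \<approx> idem_e d i"
proof -
  assume i: "1 \<le> i"
  let ?t = "gen_t i" and ?t' = "gen_t (i + 1)" and ?e = "idem_e d i"
  have "?t ^ s * ?t' ^ (d - s) * ?e \<approx> ?e" if "s \<in> {0..d - 1}" for s
  proof -
    have "?t ^ s * (?t' ^ (d - s) * ?e) \<approx> ?t ^ s * (?t ^ (d - s) * ?e)"
      using i by (intro eqv_multL eqv_t_power_e) auto
    also have "\<dots> = ?t ^ d * ?e"
      using that d_pos by (simp add: mult.assoc[symmetric] power_add[symmetric])
    also have "\<dots> \<approx> 1 * ?e" using i by (intro eqv_multR eqv_td) auto
    finally show ?thesis by (simp add: mult.assoc)
  qed
  then have "scalar (1 / of_nat d) * (\<Sum>s = 0..d - 1. ?t ^ s * ?t' ^ (d - s) * ?e) \<approx>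
      scalar (1 / of_nat d) * (\<Sum>s = 0..d - 1. ?e)"
    by (intro eqv_multL eqv_sum) auto
  then show ?thesis
    unfolding average_const by (simp add: idem_e_def sum_distrib_right mult.assoc)
qed

text \<open>
  Conjugation by \<open>g_i\<close> interchanges \<open>t_i\<close> and \<open>t_(i+1)\<close>, which reverses the order of the terms in
  the sum that defines \<open>e_i\<close>; the two boundary terms agree because \<open>t_i^d = 1 = t_(i+1)^d\<close>.
\<close>

lemma eqv_eg: "1 \<le> i \<Longrightarrow> idem_e d i * gen_g i \<approx> gen_g i * idem_e d i"
proof -
  assume i: "1 \<le> i"
  let ?t = "gen_t i" and ?t' = "gen_t (i + 1)" and ?g = "gen_g i"
  define f where "f k = ?t ^ k * ?t' ^ (d - k)" for k
  have f: "f k \<in> falg" for k using i by (simp add: f_def)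
  have "f s * ?g \<approx> ?g * f (d - s)" if "s \<in> {0..d - 1}" for s
  proof -
    have ds: "d - (d - s) = s" using that d_pos by auto
    have "f s * ?g = ?t ^ s * (?t' ^ (d - s) * ?g)" by (simp add: f_def mult.assoc)
    also have "\<dots> \<approx> ?t ^ s * (?g * ?t ^ (d - s))" using i by (intro eqv_multL eqv_tSng) auto
    also have "\<dots> = (?t ^ s * ?g) * ?t ^ (d - s)" by (simp add: mult.assoc)
    also have "\<dots> \<approx> (?g * ?t' ^ s) * ?t ^ (d - s)" using i by (intro eqv_multR eqv_tng) auto
    also have "\<dots> = ?g * (?t' ^ s * ?t ^ (d - s))" by (simp add: mult.assoc)
    also have "\<dots> \<approx> ?g * (?t ^ (d - s) * ?t' ^ s)" using i by (intro eqv_multL eqv_t_commute) auto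
    finally show ?thesis by (simp add: f_def ds)
  qed
  then have "(\<Sum>s = 0..d - 1. f s * ?g) \<approx> (\<Sum>s = 0..d - 1. ?g * f (d - s))"
    by (rule eqv_sum)
  also have "\<dots> = ?g * (\<Sum>s = 0..d - 1. f (d - s))" by (simp add: sum_distrib_left)
  also have "(\<Sum>s = 0..d - 1. f (d - s)) = (\<Sum>s = 0..d - 1. f s) + f d - f 0"
  proof -
    have "(\<Sum>s = 0..d - 1. f (d - s)) = (\<Sum>s = 1..d. f s)"
      by (rule sum.reindex_bij_witness[of _ "\<lambda>s. d - s" "\<lambda>s. d - s"]) (use d_pos in auto)
    moreover have "(\<Sum>s = 0..d. f s) = f 0 + (\<Sum>s = 1..d. f s)"
      by (simp add: sum.atLeast_Suc_atMost)
    moreover have "(\<Sum>s = 0..d. f s) = (\<Sum>s = 0..d - 1. f s) + f d"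
      using d_pos by (cases d) simp_all
    ultimately show ?thesis by (simp add: algebra_simps)
  qed
  also have "?g * \<dots> \<approx> ?g * ((\<Sum>s = 0..d - 1. f s) + f 0 - f 0)"
  proof -
    have "f d \<approx> f 0"
      using eqv_trans[OF eqv_td eqv_sym[OF eqv_td], of i "i + 1"] i by (simp add: f_def)
    then show ?thesis using f i by (intro eqv_multL eqv_add eqv_diff) auto
  qed
  finally have "(\<Sum>s = 0..d - 1. f s * ?g) \<approx> ?g * (\<Sum>s = 0..d - 1. f s)" by simp
  then have "scalar (1 / of_nat d) * (\<Sum>s = 0..d - 1. f s * ?g) \<approx>
      scalar (1 / of_nat d) * (?g * (\<Sum>s = 0..d - 1. f s))" by (intro eqv_multL) auto
  then show ?thesis
    unfolding idem_e_def scalar_left_commute f_def by (simp add: sum_distrib_right mult.assoc)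
qed

abbreviation ginv :: "nat \<Rightarrow> free_algebra" where "ginv \<equiv> inv_g d q"

lemma eqv_ginv_g: "1 \<le> i \<Longrightarrow> ginv i * gen_g i \<approx> 1"
proof -
  assume i: "1 \<le> i"
  have "gen_g i * gen_g i - scalar h * idem_e d i * gen_g i \<approx>
      (1 + scalar h * idem_e d i * gen_g i) - scalar h * idem_e d i * gen_g i"
    using i by (intro eqv_diff eqv_g2) auto
  then show ?thesis by (simp add: inv_g_def left_diff_distrib)
qed

lemma eqv_g_ginv: "1 \<le> i \<Longrightarrow> gen_g i * ginv i \<approx> 1"
proof -
  assume i: "1 \<le> i"
  have "gen_g i * gen_g i - scalar h * (gen_g i * idem_e d i) \<approx>
      (1 + scalar h * idem_e d i * gen_g i) - scalar h * (idem_e d i * gen_g i)"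
    using i by (intro eqv_diff eqv_g2 eqv_multL eqv_sym[OF eqv_eg]) auto
  then show ?thesis by (simp add: inv_g_def right_diff_distrib scalar_left_commute mult.assoc)
qed

lemma eqv_commute_ginv:
  assumes "1 \<le> i" "x * gen_g i \<approx> gen_g i * y" "x \<in> falg" "y \<in> falg"
  shows "y * ginv i \<approx> ginv i * x"
proof -
  have "1 * (y * ginv i) \<approx> (ginv i * gen_g i) * (y * ginv i)"
    using assms by (intro eqv_multR eqv_sym[OF eqv_ginv_g]) auto
  also have "\<dots> = ginv i * (gen_g i * y) * ginv i" by (simp add: mult.assoc)
  also have "\<dots> \<approx> ginv i * (x * gen_g i) * ginv i"
    using assms by (intro eqv_multR eqv_multL eqv_sym[OF assms(2)]) auto
  also have "\<dots> = (ginv i * x) * (gen_g i * ginv i)" by (simp add: mult.assoc)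
  also have "\<dots> \<approx> (ginv i * x) * 1" using assms by (intro eqv_multL eqv_g_ginv) auto
  finally show ?thesis by simp
qed

lemma eqv_cancel3:
  assumes "a * a' \<approx> 1" "b * b' \<approx> 1" "c * c' \<approx> 1"
    and "a \<in> falg" "a' \<in> falg" "b \<in> falg" "b' \<in> falg" "c \<in> falg" "c' \<in> falg"
  shows "(a * b * c) * (c' * b' * a') \<approx> 1"
proof -
  have "(a * b * c) * (c' * b' * a') = a * b * (c * c') * (b' * a')" by (simp add: mult.assoc)
  also have "\<dots> \<approx> a * b * 1 * (b' * a')" using assms by (intro eqv_multR eqv_multL) auto
  also have "\<dots> = a * (b * b') * a'" by (simp add: mult.assoc)
  also have "\<dots> \<approx> a * 1 * a'" using assms by (intro eqv_multR eqv_multL) auto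
  finally show ?thesis using eqv_trans[OF _ assms(1)] by simp
qed

lemma eqv_braid_ginv:
  assumes i: "1 \<le> i"
  shows "ginv i * ginv (i + 1) * ginv i \<approx> ginv (i + 1) * ginv i * ginv (i + 1)"
proof -
  let ?x = "ginv i * ginv (i + 1) * ginv i" and ?y = "ginv (i + 1) * ginv i * ginv (i + 1)"
  let ?X = "gen_g i * gen_g (i + 1) * gen_g i" and ?Y = "gen_g (i + 1) * gen_g i * gen_g (i + 1)"
  have "?x * 1 \<approx> ?x * (?Y * ?y)"
    using i by (intro eqv_multL eqv_sym[OF eqv_cancel3] eqv_g_ginv) auto
  also have "\<dots> = (?x * ?Y) * ?y" by (simp add: mult.assoc)
  also have "\<dots> \<approx> (?x * ?X) * ?y"
    using i by (intro eqv_multR eqv_multL eqv_sym[OF eqv_braid]) auto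
  also have "\<dots> \<approx> 1 * ?y"
    using i by (intro eqv_multR eqv_cancel3 eqv_ginv_g) auto
  finally show ?thesis by simp
qed

lemma eqv_braid_eq:
  assumes "braid_eq n u v"
  shows "word_elem d q u \<approx> word_elem d q v"
  using assms
proof induction
  case (refl w)
  then show ?case by (simp add: falg_word_elem)
next
  case (sym u v)
  show ?case using sym.IH by (rule eqv_sym)
next
  case (trans u v w)
  then show ?case by (blast intro: eqv_trans)
next
  case (append u u' v v')
  then show ?case by (simp add: eqv_mult)
next
  case (inverse i e)
  then show ?case by (cases e) (simp_all add: eqv_g_ginv eqv_ginv_g)
next
  case (commute i j)
  then show ?case by (simp add: eqv_gg)
next
  case (braid i)
  then show ?case using eqv_braid[of i "i + 1"] by (simp add: mult.assoc)
qed

lemma F_mult_e: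
  assumes a: "a \<in> subalg (gens n)" and n: "1 \<le> n"
  shows "F (a * idem_e d n) = E_D d * F a"
proof -
  have falg: "a \<in> falg" using a subalg_gens_falg by blast
  have summand: "F (a * (gen_t n ^ s * gen_t (n + 1) ^ (d - s))) = (if s = 0 then F a else 0)" if "s \<in> {0..d - 1}" for s
  proof -
    have "a * gen_t n ^ s \<in> subalg (gens n)" using a n by (intro subalg_mult subalg_power subalg_gen_t) auto
    from F_t_power[OF this, of "d - s"]
    show ?thesis using that d_pos by (auto simp: mult.assoc dvd_eq_mod_eq_0)
  qed
  have "a * idem_e d n = scalar (1 / of_nat d) * (\<Sum>s = 0..d - 1. a * (gen_t n ^ s * gen_t (n + 1) ^ (d - s)))"
    by (simp add: idem_e_def scalar_left_commute sum_distrib_left)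
  then have "F (a * idem_e d n) = 1 / of_nat d * (\<Sum>s = 0..d - 1. F (a * (gen_t n ^ s * gen_t (n + 1) ^ (d - s))))"
    using falg n by (simp add: F_scalar F_sum)
  also have "(\<Sum>s = 0..d - 1. F (a * (gen_t n ^ s * gen_t (n + 1) ^ (d - s)))) = (\<Sum>s = 0..d - 1. if s = 0 then F a else 0)"
    by (rule sum.cong[OF HOL.refl]) (rule summand)
  finally show ?thesis by (simp add: E_D_def)
qed

text \<open>
  The factor is \<open>z\<close> times \<open>lambda_D d q z\<close>; this is why the normalisation of \<open>Theta_braid\<close> makes
  positive and negative stabilisations indistinguishable.
\<close>

lemma F_mult_ginv:
  assumes a: "a \<in> subalg (gens n)" and n: "1 \<le> n"
  shows "F (a * ginv n) = (z - h * E_D d) * F a"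
proof -
  have falg: "a \<in> falg" using a subalg_gens_falg by blast
  have "F (a * ginv n) = F (a * gen_g n) - h * F (a * idem_e d n)"
    using falg n by (simp add: inv_g_def right_diff_distrib scalar_left_commute F_diff F_scalar)
  then show ?thesis using F_g[OF n a] F_mult_e[OF a n] by (simp add: algebra_simps)
qed

end

lemma Theta_braid_eq:
  assumes "1 \<le> d" "(q, z) \<in> Theta_domain d" "w \<in> braid_words n"
  shows "Theta_braid d n w (q, z) = Lambda_D d q z ^ (n - 1) *
    csqrt (lambda_D d q z) powi exponent_sum w * poly (trace_poly d q (word_elem d q w)) z"
  using assms by (simp add: Theta_braid_def braid_image_eq yh_trace_class subalg_word_elem Theta_domain_def)

lemma exponent_sum_simps [simp]:
  "exponent_sum [] = 0"
  "exponent_sum ((i, e) # w) = (if e then 1 else - 1) + exponent_sum w"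
  "exponent_sum (u @ v) = exponent_sum u + exponent_sum v"
  by (simp_all add: exponent_sum_def)

lemma braid_eq_words: "braid_eq n u v \<Longrightarrow> u \<in> braid_words n \<and> v \<in> braid_words n"
  by (induction rule: braid_eq.induct) (auto simp: braid_words_simps)

lemma braid_eq_exponent_sum: "braid_eq n u v \<Longrightarrow> exponent_sum u = exponent_sum v"
  by (induction rule: braid_eq.induct) auto

lemma Theta_braid_eqI:
  assumes "\<And>q z. (q, z) \<in> Theta_domain d \<Longrightarrow> Theta_braid d n u (q, z) = Theta_braid d m v (q, z)"
  shows "Theta_braid d n u = Theta_braid d m v"
proof
  fix x show "Theta_braid d n u x = Theta_braid d m v x"
    using assms by (cases "x \<in> Theta_domain d"; cases x) (auto simp: Theta_braid_def)
qed

definition is_braid :: "nat \<times> braid_word \<Rightarrow> bool" where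
  "is_braid x \<longleftrightarrow> 1 \<le> fst x \<and> snd x \<in> braid_words (fst x)"

text \<open>
  Braid relations hold in the algebra, conjugation is covered by cyclicity, and stabilisation by the
  Markov property together with the normalising factors.
\<close>

lemma markov_eq_Theta_braid:
  assumes d: "1 \<le> d" and "markov_eq a b"
  shows "is_braid a \<and> is_braid b \<and> Theta_braid d (fst a) (snd a) = Theta_braid d (fst b) (snd b)"
  using assms(2)
proof induction
  case (braid n u v)
  have w: "u \<in> braid_words n" "v \<in> braid_words n" using braid_eq_words braid by auto
  have "Theta_braid d n u = Theta_braid d n v"
  proof (rule Theta_braid_eqI)
    fix q z assume qz: "(q, z) \<in> Theta_domain d"
    then interpret markov_functional d q z "\<lambda>a. poly (trace_poly d q a) z"
      using d by (intro markov_functional_trace_poly) (auto simp: Theta_domain_def)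
    show "Theta_braid d n u (q, z) = Theta_braid d n v (q, z)"
      using eqv_F[OF eqv_braid_eq[OF braid(2)]] braid_eq_exponent_sum[OF braid(2)]
      by (simp add: Theta_braid_eq[OF d qz] w)
  qed
  then show ?case using w braid by (simp add: is_braid_def)
next
  case (conjugation n u v)
  have "Theta_braid d n (u @ v) = Theta_braid d n (v @ u)"
  proof (rule Theta_braid_eqI)
    fix q z assume qz: "(q, z) \<in> Theta_domain d"
    then interpret markov_functional d q z "\<lambda>a. poly (trace_poly d q a) z"
      using d by (intro markov_functional_trace_poly) (auto simp: Theta_domain_def)
    show "Theta_braid d n (u @ v) (q, z) = Theta_braid d n (v @ u) (q, z)"
      using F_cyclic[of "word_elem d q u" "word_elem d q v"] conjugation
      by (simp add: Theta_braid_eq[OF d qz] braid_words_simps falg_word_elem add.commute)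
  qed
  then show ?case using conjugation by (simp add: is_braid_def braid_words_simps)
next
  case (stabilization n u e)
  have w: "u @ [(n, e)] \<in> braid_words (n + 1)"
    using stabilization by (auto simp: braid_words_def)
  have "Theta_braid d n u = Theta_braid d (n + 1) (u @ [(n, e)])"
  proof (rule Theta_braid_eqI)
    fix q z assume qz: "(q, z) \<in> Theta_domain d"
    then interpret markov_functional d q z "\<lambda>a. poly (trace_poly d q a) z"
      using d by (intro markov_functional_trace_poly) (auto simp: Theta_domain_def)
    let ?r = "csqrt (lambda_D d q z)" and ?L = "Lambda_D d q z"
    have nz: "z \<noteq> 0" "lambda_D d q z \<noteq> 0" "?r \<noteq> 0" using qz by (auto simp: Theta_domain_def)
    have rr: "?r * ?r = lambda_D d q z" using power2_csqrt[of "lambda_D d q z"] by (simp add: power2_eq_square)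
    have u: "word_elem d q u \<in> subalg (gens n)" using stabilization by (simp add: subalg_word_elem)
    have L: "?L ^ n = ?L ^ (n - 1) * ?L" using stabilization by (cases n) auto
    have "?L * ?r powi (if e then 1 else - 1) * poly (trace_poly d q (word_elem d q u * letter_elem d q (n, e))) z
        = poly (trace_poly d q (word_elem d q u)) z"
    proof (cases e)
      case True
      then show ?thesis using F_g[OF stabilization(1) u] nz by (simp add: Lambda_D_def)
    next
      case False
      have "z - h * E_D d = ?r * ?r * z" unfolding rr using nz by (simp add: lambda_D_def)
      then show ?thesis using False F_mult_ginv[OF u stabilization(1)] nz
        by (simp add: Lambda_D_def power_int_minus field_simps)
    qed
    then show "Theta_braid d n u (q, z) = Theta_braid d (n + 1) (u @ [(n, e)]) (q, z)"
      using nz w stabilization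
      by (simp add: Theta_braid_eq[OF d qz] L power_int_add mult_ac del: letter_elem.simps)
  qed
  then show ?case using stabilization w by (simp add: is_braid_def)
qed auto

lemma Theta_closure:
  assumes d: "1 \<le> d" and n: "1 \<le> n" "w \<in> braid_words n"
  shows "Theta d (braid_closure n w) = Theta_braid d n w"
proof -
  let ?P = "\<lambda>(m, u). 1 \<le> m \<and> u \<in> braid_words m \<and> braid_closure m u = braid_closure n w"
  obtain m u where mu: "(SOME x. ?P x) = (m, u)" by (cases "SOME x. ?P x")
  have "?P (SOME x. ?P x)" by (rule someI[of ?P "(n, w)"]) (use n in simp)
  then have "?P (m, u)" unfolding mu .
  then have P: "1 \<le> m" "u \<in> braid_words m" "braid_closure m u = braid_closure n w" by simp_all
  have "markov_eq (m, u) (m, u)" "markov_eq (n, w) (n, w)"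
    using P n by (auto intro!: markov_eq.braid braid_eq.refl)
  then have "markov_eq (m, u) (n, w)"
    using P(3) Quotient3_rel[OF Quotient3_oriented_link, of "(m, u)" "(n, w)"] by (simp add: braid_closure_def)
  from markov_eq_Theta_braid[OF d this] have "Theta_braid d m u = Theta_braid d n w" by simp
  then show ?thesis unfolding Theta_def mu by simp
qed

section \<open>A mirror pair of links with three components\<close>

text \<open>
  Both the \<open>g_i\<close> and their inverses satisfy these axioms, with \<open>(\<kappa>, \<zeta>)\<close> equal to
  \<open>(h, z)\<close> and \<open>(- h, z - h * E_D d)\<close> respectively.  A computation made here covers a braid and its
  mirror image.
\<close>

locale quadratic_braid_generators = markov_functional +
  fixes b :: "nat \<Rightarrow> free_algebra" and \<kappa> \<zeta> :: complex
  assumes b_subalg: "1 \<le> i \<Longrightarrow> i < n \<Longrightarrow> b i \<in> subalg (gens n)"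
    and b_square: "1 \<le> i \<Longrightarrow> b i * b i \<approx> 1 + scalar \<kappa> * (idem_e d i * b i)"
    and b_braid: "1 \<le> i \<Longrightarrow> b i * b (i + 1) * b i \<approx> b (i + 1) * b i * b (i + 1)"
    and b_t: "1 \<le> i \<Longrightarrow> 1 \<le> j \<Longrightarrow> gen_t j * b i \<approx> b i * gen_t (Transposition.transpose i (i + 1) j)"
    and b_e: "1 \<le> i \<Longrightarrow> idem_e d i * b i \<approx> b i * idem_e d i"
    and F_b: "1 \<le> n \<Longrightarrow> a \<in> subalg (gens n) \<Longrightarrow> F (a * b n) = \<zeta> * F a"
begin

lemma b_falg [simp]: "1 \<le> i \<Longrightarrow> b i \<in> falg"
  using subalg_gens_falg[OF b_subalg[of i "Suc i"]] by simp

lemma b_t_power: "1 \<le> i \<Longrightarrow> 1 \<le> j \<Longrightarrow>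
    gen_t j ^ k * b i \<approx> b i * gen_t (Transposition.transpose i (i + 1) j) ^ k"
  using transpose_ge1[of i j] by (intro eqv_commute_power b_t) auto

lemma b_t_power_simps:
  assumes "1 \<le> i"
  shows "gen_t i ^ k * b i \<approx> b i * gen_t (i + 1) ^ k"
    and "gen_t (i + 1) ^ k * b i \<approx> b i * gen_t i ^ k"
    and "1 \<le> j \<Longrightarrow> j < i \<Longrightarrow> gen_t j ^ k * b i \<approx> b i * gen_t j ^ k"
  using b_t_power[of i i k] b_t_power[of i "i + 1" k] b_t_power[of i j k] assms
  by (auto simp: Transposition.transpose_def)

lemma F_average:
  assumes "\<And>s. s \<in> {0..d - 1} \<Longrightarrow> F (f s) = c" "\<And>s. f s \<in> falg"
  shows "F (scalar (1 / of_nat d) * (\<Sum>s = 0..d - 1. f s)) = c"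
proof -
  have "F (scalar (1 / of_nat d) * (\<Sum>s = 0..d - 1. f s)) = 1 / of_nat d * (\<Sum>s = 0..d - 1. c)"
    using assms by (simp add: F_scalar F_sum)
  then show ?thesis using d_pos by (simp add: of_nat_diff)
qed

lemma eqv_power_split:
  assumes "1 \<le> j" "s \<in> {0..d - 1}" "x \<in> falg"
  shows "gen_t j ^ (d - s) * gen_t j ^ s * x \<approx> x" "gen_t j ^ s * gen_t j ^ (d - s) * x \<approx> x"
proof -
  have "gen_t j ^ d * x \<approx> 1 * x" using assms by (intro eqv_multR eqv_td) auto
  then show "gen_t j ^ (d - s) * gen_t j ^ s * x \<approx> x" "gen_t j ^ s * gen_t j ^ (d - s) * x \<approx> x"
    using assms d_pos by (auto simp: power_add[symmetric])
qed

text \<open>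
  Each term of the sum that defines \<open>e_n\<close> contributes the same amount: after \<open>t_(n+1)\<close> is moved past
  \<open>b n\<close> it becomes a power of \<open>t_n\<close>, which cyclicity cancels against the other factor.
\<close>

lemma F_e_b:
  assumes n: "1 \<le> n" and a: "a \<in> subalg (gens n)"
  shows "F (a * (idem_e d n * b n)) = \<zeta> * F a"
proof -
  let ?t = "gen_t n" and ?t' = "gen_t (n + 1)"
  have falg: "a \<in> falg" using a subalg_gens_falg by blast
  have "F (scalar (1 / of_nat d) * (\<Sum>s = 0..d - 1. a * (?t ^ s * ?t' ^ (d - s) * b n))) = \<zeta> * F a"
  proof (rule F_average)
    fix s assume s: "s \<in> {0..d - 1}"
    have "a * ?t ^ s * (?t' ^ (d - s) * b n) \<approx> a * ?t ^ s * (b n * ?t ^ (d - s))"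
      using n falg by (intro eqv_multL b_t_power_simps) auto
    then have "F (a * (?t ^ s * ?t' ^ (d - s) * b n)) = F ((a * ?t ^ s * b n) * ?t ^ (d - s))"
      using eqv_F by (simp add: mult.assoc)
    also have "\<dots> = F (?t ^ (d - s) * (a * ?t ^ s * b n))"
      using n falg by (intro F_cyclic) auto
    also have "\<dots> = F ((?t ^ (d - s) * a * ?t ^ s) * b n)" by (simp add: mult.assoc)
    also have "\<dots> = \<zeta> * F (?t ^ (d - s) * a * ?t ^ s)"
      using n a by (intro F_b subalg_mult subalg_power subalg_gen_t) auto
    also have "F (?t ^ (d - s) * a * ?t ^ s) = F (?t ^ s * (?t ^ (d - s) * a))"
      using n falg by (intro F_cyclic) auto
    also have "\<dots> = F a"
      using eqv_F[OF eqv_power_split(2)[OF n s falg]] by (simp add: mult.assoc)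
    finally show "F (a * (?t ^ s * ?t' ^ (d - s) * b n)) = \<zeta> * F a" .
  qed (use n falg in auto)
  then show ?thesis
    by (simp add: idem_e_def sum_distrib_left sum_distrib_right scalar_left_commute mult.assoc)
qed

lemma b_square_t: "gen_t 1 ^ k * (b 1 * b 1) \<approx> b 1 * b 1 * gen_t 1 ^ k"
proof -
  have "gen_t 1 ^ k * b 1 * b 1 \<approx> b 1 * gen_t (1 + 1) ^ k * b 1"
    by (intro eqv_multR b_t_power_simps) auto
  also have "\<dots> = b 1 * (gen_t (1 + 1) ^ k * b 1)" by (simp add: mult.assoc)
  also have "\<dots> \<approx> b 1 * (b 1 * gen_t 1 ^ k)"
    by (intro eqv_multL b_t_power_simps) auto
  finally show ?thesis by (simp add: mult.assoc)
qed

text \<open>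
  The strand that winds around the two others is removed.  Expanding the inner square gives the
  square of \<open>b 2\<close>, which is expanded again, and a term \<open>b 2 * e_1 * b 1 * b 2\<close>.  In the latter
  the powers of \<open>t_1\<close> and \<open>t_2\<close> move to the two ends and the braid relation leaves a single \<open>b 2\<close>.
\<close>

lemma F_b2_b1_b1_b2:
  assumes a: "a \<in> subalg (gens 2)"
  shows "F (a * (b 2 * (b 1 * b 1) * b 2)) = (1 + \<kappa> * \<zeta>) * F a + \<kappa> * \<zeta> * F (a * (b 1 * b 1))"
proof -
  let ?t = "gen_t 1" and ?t' = "gen_t 2"
  have falg: "a \<in> falg" using a subalg_gens_falg by blast
  have falg1 [simp]: "b 1 \<in> falg" "b 2 \<in> falg" "?t \<in> falg" "?t' \<in> falg" "idem_e d 1 \<in> falg" "idem_e d 2 \<in> falg"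
    "b (Suc 0) \<in> falg" "gen_t (Suc 0) \<in> falg" "idem_e d (Suc 0) \<in> falg"
    by auto
  have "b 2 * (b 1 * b 1) * b 2 \<approx> b 2 * (1 + scalar \<kappa> * (idem_e d 1 * b 1)) * b 2"
    by (intro eqv_multR eqv_multL b_square) auto
  also have "\<dots> = b 2 * b 2 + scalar \<kappa> * (b 2 * (idem_e d 1 * b 1) * b 2)"
    by (simp add: distrib_left distrib_right scalar_left_commute mult.assoc)
  also have "\<dots> \<approx> (1 + scalar \<kappa> * (idem_e d 2 * b 2)) + scalar \<kappa> * (b 2 * (idem_e d 1 * b 1) * b 2)"
    by (intro eqv_add b_square) auto
  finally have "a * (b 2 * (b 1 * b 1) * b 2) \<approx>
      a * ((1 + scalar \<kappa> * (idem_e d 2 * b 2)) + scalar \<kappa> * (b 2 * (idem_e d 1 * b 1) * b 2))"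
    using falg by (intro eqv_multL)
  then have "F (a * (b 2 * (b 1 * b 1) * b 2)) =
      F (a * ((1 + scalar \<kappa> * (idem_e d 2 * b 2)) + scalar \<kappa> * (b 2 * (idem_e d 1 * b 1) * b 2)))"
    by (rule eqv_F)
  also have "\<dots> = F a + \<kappa> * F (a * (idem_e d 2 * b 2)) + \<kappa> * F (a * (b 2 * (idem_e d 1 * b 1) * b 2))"
    using falg by (simp add: distrib_left scalar_left_commute F_add F_scalar)
  also have "F (a * (idem_e d 2 * b 2)) = \<zeta> * F a" using a by (intro F_e_b) auto
  also have "F (a * (b 2 * (idem_e d 1 * b 1) * b 2)) = \<zeta> * F (a * (b 1 * b 1))"
  proof -
    have "F (scalar (1 / of_nat d) * (\<Sum>s = 0..d - 1. a * (b 2 * (?t ^ s * ?t' ^ (d - s) * b 1) * b 2))) =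
        \<zeta> * F (a * (b 1 * b 1))"
    proof (rule F_average)
      fix s assume s: "s \<in> {0..d - 1}"
      let ?u = "?t ^ (d - s)"
      have t'b: "?t' ^ (d - s) * b 1 \<approx> b 1 * ?u"
        using b_t_power_simps(2)[of 1 "d - s"] by (simp add: numeral_2_eq_2)
      have "a * (b 2 * (?t ^ s * ?t' ^ (d - s) * b 1) * b 2) = a * (b 2 * ?t ^ s) * (?t' ^ (d - s) * b 1) * b 2"
        by (simp add: mult.assoc)
      also have "\<dots> \<approx> a * (?t ^ s * b 2) * (b 1 * ?u) * b 2"
      proof (rule eqv_trans)
        show "a * (b 2 * ?t ^ s) * (?t' ^ (d - s) * b 1) * b 2 \<approx> a * (?t ^ s * b 2) * (?t' ^ (d - s) * b 1) * b 2"
          using falg by (intro eqv_multR eqv_multL eqv_sym[OF b_t_power_simps(3)]) auto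
        show "a * (?t ^ s * b 2) * (?t' ^ (d - s) * b 1) * b 2 \<approx> a * (?t ^ s * b 2) * (b 1 * ?u) * b 2"
          using falg t'b by (intro eqv_multR eqv_multL) auto
      qed
      also have "\<dots> = (a * ?t ^ s * b 2 * b 1) * (?u * b 2)" by (simp add: mult.assoc)
      also have "\<dots> \<approx> (a * ?t ^ s * b 2 * b 1) * (b 2 * ?u)"
        using falg by (intro eqv_multL b_t_power_simps(3)) auto
      also have "\<dots> = (a * ?t ^ s) * (b 2 * b 1 * b 2) * ?u" by (simp add: mult.assoc)
      also have "\<dots> \<approx> (a * ?t ^ s) * (b 1 * b 2 * b 1) * ?u"
        using falg eqv_sym[OF b_braid[of 1]] by (intro eqv_multR eqv_multL) (auto simp: numeral_2_eq_2)
      also have "\<dots> = (a * ?t ^ s * b 1 * b 2) * (b 1 * ?u)" by (simp add: mult.assoc)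
      finally have "F (a * (b 2 * (?t ^ s * ?t' ^ (d - s) * b 1) * b 2)) =
          F ((a * ?t ^ s * b 1 * b 2) * (b 1 * ?u))" by (rule eqv_F)
      also have "\<dots> = F ((b 1 * ?u) * (a * ?t ^ s * b 1 * b 2))"
        using falg by (intro F_cyclic) auto
      also have "\<dots> = F ((b 1 * ?u * (a * ?t ^ s * b 1)) * b 2)" by (simp add: mult.assoc)
      also have "\<dots> = \<zeta> * F ((b 1 * ?u) * (a * ?t ^ s * b 1))"
        using a b_subalg[of 1 2] by (intro F_b subalg_mult subalg_power subalg_gen_t) auto
      also have "F ((b 1 * ?u) * (a * ?t ^ s * b 1)) = F ((a * ?t ^ s * b 1) * (b 1 * ?u))"
        using falg by (intro F_cyclic) auto
      also have "\<dots> = F (a * (?t ^ s * (b 1 * b 1 * ?u)))" by (simp add: mult.assoc)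
      also have "\<dots> = F (a * (b 1 * b 1))"
      proof (rule eqv_F)
        have "?t ^ s * (b 1 * b 1 * ?u) \<approx> ?t ^ s * (?u * (b 1 * b 1))"
          by (intro eqv_multL eqv_sym[OF b_square_t]) auto
        also have "\<dots> = ?t ^ s * ?u * (b 1 * b 1)" by (simp add: mult.assoc)
        also have "\<dots> \<approx> b 1 * b 1" using s by (intro eqv_power_split) auto
        finally show "a * (?t ^ s * (b 1 * b 1 * ?u)) \<approx> a * (b 1 * b 1)"
          using falg by (intro eqv_multL)
      qed
      finally show "F (a * (b 2 * (?t ^ s * ?t' ^ (d - s) * b 1) * b 2)) = \<zeta> * F (a * (b 1 * b 1))" .
    qed (use falg in auto)
    then show ?thesis
      by (simp add: idem_e_def sum_distrib_left sum_distrib_right scalar_left_commute mult.assoc numeral_2_eq_2)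
  qed
  finally show ?thesis by (simp add: algebra_simps)
qed

lemma F_b1_square: "F (b 1 * b 1) = 1 + \<kappa> * \<zeta>"
proof -
  have "F (b 1 * b 1) = F (1 + scalar \<kappa> * (idem_e d 1 * b 1))"
    by (intro eqv_F b_square) simp
  then show ?thesis using F_e_b[of 1 1] by (simp add: F_add F_scalar F_one)
qed

text \<open>
  The quadratic relation is applied until no square is left.  The idempotent \<open>e_1\<close> commutes with
  \<open>b 1\<close> and absorbs its own powers, so only the traces of \<open>e_1\<close> and \<open>e_1 * b 1\<close> remain.
\<close>

lemma F_b1_fourth: "F (b 1 * b 1 * (b 1 * b 1)) = 1 + 2 * \<kappa> * \<zeta> + \<kappa>\<^sup>2 * E_D d + \<kappa> ^ 3 * \<zeta>"
proof -
  let ?b = "b 1" and ?e = "idem_e d 1"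
  have falg1 [simp]: "?b \<in> falg" "?e \<in> falg" by auto
  have sq: "?b * ?b \<approx> 1 + scalar \<kappa> * (?e * ?b)" by (rule b_square) simp
  have "?b * ?b * (?e * ?b) \<approx> (1 + scalar \<kappa> * (?e * ?b)) * (?e * ?b)"
    using sq by (rule eqv_multR) simp
  also have "\<dots> = ?e * ?b + scalar \<kappa> * (?e * (?b * ?e) * ?b)"
    by (simp add: distrib_right mult.assoc)
  also have "\<dots> \<approx> ?e * ?b + scalar \<kappa> * (?e * (?e * ?b) * ?b)"
    by (intro eqv_add eqv_refl eqv_multL eqv_multR eqv_sym[OF b_e]) auto
  also have "\<dots> = ?e * ?b + scalar \<kappa> * ((?e * ?e) * (?b * ?b))"
    by (simp add: mult.assoc)
  also have "\<dots> \<approx> ?e * ?b + scalar \<kappa> * (?e * (1 + scalar \<kappa> * (?e * ?b)))"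
    using sq by (intro eqv_add eqv_refl eqv_multL eqv_mult[OF eqv_ee]) auto
  also have "\<dots> = ?e * ?b + scalar \<kappa> * ?e + scalar (\<kappa>\<^sup>2) * ((?e * ?e) * ?b)"
  proof -
    have "?e * (1 + scalar \<kappa> * (?e * ?b)) = ?e + scalar \<kappa> * (?e * ?e * ?b)"
      by (simp add: distrib_left scalar_left_commute mult.assoc)
    then show ?thesis by (simp add: distrib_left mult.assoc power2_eq_square scalar_mult add.assoc)
  qed
  also have "\<dots> \<approx> ?e * ?b + scalar \<kappa> * ?e + scalar (\<kappa>\<^sup>2) * (?e * ?b)"
    by (intro eqv_add eqv_refl eqv_multL eqv_multR eqv_ee) auto
  finally have "F (?b * ?b * (?e * ?b)) = F (?e * ?b + scalar \<kappa> * ?e + scalar (\<kappa>\<^sup>2) * (?e * ?b))"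
    by (rule eqv_F)
  then have "F (?b * ?b * (?e * ?b)) = F (?e * ?b) + \<kappa> * F ?e + \<kappa>\<^sup>2 * F (?e * ?b)"
    by (simp add: F_add F_scalar)
  moreover have "F (?e * ?b) = \<zeta>" using F_e_b[of 1 1] by (simp add: F_one)
  moreover have "F ?e = E_D d" using F_mult_e[of 1 1] by (simp add: F_one)
  moreover have "F (?b * ?b * (?b * ?b)) = F (?b * ?b * (1 + scalar \<kappa> * (?e * ?b)))"
    using sq by (intro eqv_F eqv_multL) auto
  moreover have "\<dots> = F (?b * ?b) + \<kappa> * F (?b * ?b * (?e * ?b))"
    by (simp add: distrib_left scalar_left_commute F_add F_scalar)
  ultimately show ?thesis
    using F_b1_square by (simp add: algebra_simps power2_eq_square power3_eq_cube)
qed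

end

context markov_functional
begin

lemma quadratic_g: "quadratic_braid_generators d q z F gen_g h z"
proof
  show "gen_g i * gen_g i \<approx> 1 + scalar h * (idem_e d i * gen_g i)" if "1 \<le> i" for i
    using eqv_g2[OF that] by (simp add: mult.assoc)
qed (auto simp: F_g intro: eqv_braid eqv_tg[simplified] eqv_eg subalg_gen_g)

lemma quadratic_ginv: "quadratic_braid_generators d q z F ginv (- h) (z - h * E_D d)"
proof
  show "ginv i * ginv i \<approx> 1 + scalar (- h) * (idem_e d i * ginv i)" if i: "1 \<le> i" for i
  proof -
    have "gen_g i * ginv i - scalar h * (idem_e d i * ginv i) \<approx> 1 - scalar h * (idem_e d i * ginv i)"
      using i by (intro eqv_diff eqv_g_ginv) auto
    then show ?thesis
      by (simp only: scalar_uminus) (simp add: inv_g_def left_diff_distrib mult.assoc)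
  qed
  show "gen_t j * ginv i \<approx> ginv i * gen_t (Transposition.transpose i (i + 1) j)" if ij: "1 \<le> i" "1 \<le> j" for i j
    using eqv_commute_ginv[OF ij(1) eqv_tg[OF ij(1)], of "Transposition.transpose i (i + 1) j"]
      transpose_ge1[OF ij] ij by simp
  show "idem_e d i * ginv i \<approx> ginv i * idem_e d i" if i: "1 \<le> i" for i
    using i by (intro eqv_commute_ginv eqv_eg) auto
qed (auto simp: F_mult_ginv intro: eqv_braid_ginv[simplified] subalg_inv_g)

lemma eqv_cancel_squares:
  assumes "a * a' \<approx> 1" "a \<in> falg" "a' \<in> falg"
  shows "a * a * (a * a) * (a' * a') \<approx> a * a"
proof -
  have "a * a * (a * a) * (a' * a') = a * a * a * (a * a') * a'" by (simp add: mult.assoc)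
  also have "\<dots> \<approx> a * a * a * 1 * a'" using assms by (intro eqv_multR eqv_multL) auto
  also have "\<dots> = a * a * (a * a')" by (simp add: mult.assoc)
  also have "\<dots> \<approx> a * a * 1" using assms by (intro eqv_multL) auto
  finally show ?thesis by simp
qed

end

text \<open>
  For \<open>e = True\<close> this is \<open>sigma_1^4 sigma_2^(-1) sigma_1^(-2) sigma_2^(-1)\<close>, that is
  \<open>sigma_1^6\<close> divided by the full twist, written without cancelling pairs; \<open>e = False\<close> is the mirror
  image.  The closures are links of three components, with pairwise linking numbers 2, -1, -1 and
  -2, 1, 1.
\<close>

definition mirror_pair :: "bool \<Rightarrow> braid_word" where
  "mirror_pair e = [(1, e), (1, e), (1, e), (1, e), (2, \<not> e), (1, \<not> e), (1, \<not> e), (2, \<not> e)]"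

lemma mirror_pair_words: "mirror_pair e \<in> braid_words 3"
  by (simp add: mirror_pair_def braid_words_def)

lemma exponent_sum_mirror_pair: "exponent_sum (mirror_pair e) = 0"
  by (simp add: mirror_pair_def)

lemma (in markov_functional) F_mirror_pair:
  shows "F (word_elem d q (mirror_pair True)) =
      (1 - h * (z - h * E_D d)) * (1 + 2 * h * z + h\<^sup>2 * E_D d + h ^ 3 * z) - h * (z - h * E_D d) * (1 + h * z)"
    and "F (word_elem d q (mirror_pair False)) =
      (1 + h * z) * (1 - 2 * h * (z - h * E_D d) + h\<^sup>2 * E_D d - h ^ 3 * (z - h * E_D d)) +
      h * z * (1 - h * (z - h * E_D d))"
proof -
  interpret pos: quadratic_braid_generators d q z F gen_g h z by (rule quadratic_g)
  interpret neg: quadratic_braid_generators d q z F ginv "- h" "z - h * E_D d" by (rule quadratic_ginv)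
  have mem: "gen_g 1 * gen_g 1 * (gen_g 1 * gen_g 1) \<in> subalg (gens 2)"
    "ginv 1 * ginv 1 * (ginv 1 * ginv 1) \<in> subalg (gens 2)"
    by (intro subalg_mult subalg_gen_g subalg_inv_g; simp)+
  have "F (word_elem d q (mirror_pair True)) =
      F (gen_g 1 * gen_g 1 * (gen_g 1 * gen_g 1) * (ginv 2 * (ginv 1 * ginv 1) * ginv 2))"
    by (simp add: mirror_pair_def mult.assoc)
  also have "\<dots> = (1 + - h * (z - h * E_D d)) * F (gen_g 1 * gen_g 1 * (gen_g 1 * gen_g 1)) +
      - h * (z - h * E_D d) * F (gen_g 1 * gen_g 1 * (gen_g 1 * gen_g 1) * (ginv 1 * ginv 1))"
    by (rule neg.F_b2_b1_b1_b2[OF mem(1)])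
  also have "F (gen_g 1 * gen_g 1 * (gen_g 1 * gen_g 1) * (ginv 1 * ginv 1)) = F (gen_g 1 * gen_g 1)"
    by (intro eqv_F eqv_cancel_squares eqv_g_ginv) auto
  finally show "F (word_elem d q (mirror_pair True)) =
      (1 - h * (z - h * E_D d)) * (1 + 2 * h * z + h\<^sup>2 * E_D d + h ^ 3 * z) - h * (z - h * E_D d) * (1 + h * z)"
    by (simp only: pos.F_b1_square pos.F_b1_fourth) (simp add: algebra_simps)
  have "F (word_elem d q (mirror_pair False)) =
      F (ginv 1 * ginv 1 * (ginv 1 * ginv 1) * (gen_g 2 * (gen_g 1 * gen_g 1) * gen_g 2))"
    by (simp add: mirror_pair_def mult.assoc)
  also have "\<dots> = (1 + h * z) * F (ginv 1 * ginv 1 * (ginv 1 * ginv 1)) +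
      h * z * F (ginv 1 * ginv 1 * (ginv 1 * ginv 1) * (gen_g 1 * gen_g 1))"
    by (rule pos.F_b2_b1_b1_b2[OF mem(2)])
  also have "F (ginv 1 * ginv 1 * (ginv 1 * ginv 1) * (gen_g 1 * gen_g 1)) = F (ginv 1 * ginv 1)"
    by (intro eqv_F eqv_cancel_squares eqv_ginv_g) auto
  finally show "F (word_elem d q (mirror_pair False)) =
      (1 + h * z) * (1 - 2 * h * (z - h * E_D d) + h\<^sup>2 * E_D d - h ^ 3 * (z - h * E_D d)) +
      h * z * (1 - h * (z - h * E_D d))"
    by (simp only: neg.F_b1_square neg.F_b1_fourth) (simp add: algebra_simps power2_eq_square power3_eq_cube)
qed

text \<open>
  The factor \<open>1 - E_D d\<close> vanishes for \<open>d = 1\<close> and only then.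
\<close>

lemma trace_poly_mirror_pair:
  assumes "1 \<le> d" "q \<noteq> 0"
  shows "poly (trace_poly d q (word_elem d q (mirror_pair False))) z -
      poly (trace_poly d q (word_elem d q (mirror_pair True))) z =
    (q - inverse q) ^ 3 * (1 - E_D d) * ((q - inverse q) * E_D d - 2 * z)"
proof -
  interpret markov_functional d q z "\<lambda>a. poly (trace_poly d q a) z"
    by (rule markov_functional_trace_poly[OF assms])
  define k where "k = h"
  show ?thesis
    unfolding F_mirror_pair k_def[symmetric]
    by (simp add: algebra_simps power2_eq_square power3_eq_cube)
qed

text \<open>
  Both braids have exponent sum 0 and three strands, so the normalising factors agree and the
  difference of the traces decides.  The point \<open>q = 2\<close>, \<open>z = 1\<close> lies in the domain and separates the
  two values for every \<open>d \<ge> 2\<close>.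
\<close>

theorem theorem6:
  fixes d :: nat
  assumes "d \<ge> 2"
  shows "\<not> topologically_equivalent (Theta d) homflypt"
proof
  let ?L = "\<lambda>e. braid_closure 3 (mirror_pair e)"
  have Theta: "Theta m (?L e) (q, z) = Lambda_D m q z ^ 2 * poly (trace_poly m q (word_elem m q (mirror_pair e))) z"
    if "1 \<le> m" "(q, z) \<in> Theta_domain m" for m e q z
    using that Theta_closure[OF that(1) _ mirror_pair_words[of e]] Theta_braid_eq[OF that mirror_pair_words[of e]]
    by (simp add: exponent_sum_mirror_pair)
  have "Theta_braid 1 3 (mirror_pair True) = Theta_braid 1 3 (mirror_pair False)"
  proof (rule Theta_braid_eqI)
    fix q z assume qz: "(q, z) \<in> Theta_domain 1"
    then have "q \<noteq> 0" by (simp add: Theta_domain_def)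
    then show "Theta_braid 1 3 (mirror_pair True) (q, z) = Theta_braid 1 3 (mirror_pair False) (q, z)"
      unfolding Theta_braid_eq[OF order_refl qz mirror_pair_words] exponent_sum_mirror_pair
      using trace_poly_mirror_pair[of 1 q z] by (simp add: E_D_def)
  qed
  then have "homflypt (?L True) = homflypt (?L False)"
    unfolding homflypt_def by (simp add: Theta_closure[OF order_refl _ mirror_pair_words, simplified])
  moreover assume "topologically_equivalent (Theta d) homflypt"
  ultimately have eq: "Theta d (?L True) = Theta d (?L False)"
    by (simp add: topologically_equivalent_def)
  have E: "E_D d = of_real (1 / real d)" by (simp add: E_D_def)
  have d: "1 / real d \<le> 1 / 2" using assms by (intro divide_left_mono) auto
  have lam: "lambda_D d 2 1 = of_real (1 - 3 / 2 * (1 / real d))"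
    by (simp add: lambda_D_def E)
  moreover have "1 - 3 / 2 * (1 / real d) \<noteq> 0" using d by linarith
  ultimately have "lambda_D d 2 1 \<noteq> 0" by (simp only: of_real_eq_0_iff not_False_eq_True)
  then have dom: "(2, 1) \<in> Theta_domain d" and L: "Lambda_D d 2 1 \<noteq> 0"
    by (auto simp: Theta_domain_def Lambda_D_def)
  have "(3 / 2) ^ 3 * (1 - E_D d) * (3 / 2 * E_D d - 2) = of_real ((3 / 2) ^ 3 * (1 - 1 / real d) * (3 / 2 * (1 / real d) - 2))"
    by (simp add: E)
  also have "\<dots> \<noteq> 0" using d by (simp only: of_real_eq_0_iff mult_eq_0_iff) auto
  finally show False
    using trace_poly_mirror_pair[of d 2 1] fun_cong[OF eq, of "(2, 1)"] Theta[OF _ dom] L assms by simp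
qed

end
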